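(* Consider the $n$-server system with total Poisson arrival rate $n\lambda$ described in the context. (i) For any $g\ge 0$, $\epsilon\in[0,1]$ and $n\ge 2$, the system under the Po2-$(g,\epsilon)$ scheme is stable (i.e., the process $\mathbf{x}^{(n)}$ is positive recurrent) if and only if $\lambda<1$. Furthermore, for $\lambda<1$, the steady-state average queue length per server is bounded above as $$\mathbb{E}_{\pi_n}[Q^{(n)}_i(\infty)]=\mathbb{E}_{\pi_n}\Big[\sum_{i\ge 1}x^{(n)}_i(\infty)\Big]\le \frac{(1+g\,\mathbf{1}(\epsilon>1/2))\lambda}{1-\lambda},$$ where on the left-hand side $i$ is the index of an individual server, $i\in[n]$ (in the sum, $i$ is a summation index). (ii) For any $\epsilon\in[0,1]$ and $n\ge 2$, the system under the Po2-$\epsilon$ scheme is stable if and only if $\lambda<\min\left(1,\frac{1}{2\epsilon}\right)$ (with $\frac{1}{2\epsilon}=+\infty$ when $\epsilon=0$). Furthermore, for $\lambda<\min\left(1,\frac{1}{2\epsilon}\right)$, the steady-state average queue length per server is bounded above as $$\mathbb{E}_{\pi_n}[Q^{(n)}_i(\infty)]=\mathbb{E}_{\pi_n}\Big[\sum_{i\ge 1}x^{(n)}_i(\infty)\Big]\le \frac{\lambda}{1-\max(1,2\epsilon)\lambda},$$ where again on the left-hand side $i\in[n]$ is the index of an individual server.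
   Context: System: $n$ parallel unit-rate servers indexed by $[n]=\{1,\dots,n\}$, each with its own infinite-buffer queue served in First-Come-First-Served order. Jobs arrive according to a Poisson process of rate $n\lambda$, $\lambda>0$; job sizes are independent exponential random variables with unit mean, independent of the inter-arrival times. On each arrival a dispatcher samples an unordered pair of distinct servers uniformly at random and sends the job to one of the two sampled servers. Po2-$(g,\epsilon)$ scheme ($g\ge0$ a constant): if the difference of the queue lengths of the two sampled servers lies in $(0,g]$, the job is sent to the server with the larger queue length with probability $\epsilon$ and to the one with the smaller queue length with probability $1-\epsilon$; if the difference is strictly larger than $g$, the job is sent to the server with the smaller queue length; in case of a tie the job is sent to the sampled server with the smaller index. Po2-$\epsilon$ scheme: if the two queue lengths differ, the job is sent to the server with the larger queue length with probability $\epsilon$ and to the one with the smaller queue length with probability $1-\epsilon$, independently of the queue lengths; in case of a tie the job is sent to the sampled server with the smaller index. $Q^{(n)}_k(t)$ is the queue length of server $k$ at time $t$ (including the job in service), and $\mathbf{x}^{(n)}(t)=(x_i^{(n)}(t))_{i\ge1}$, where $x^{(n)}_i(t)$ is the fraction of servers with at least $i$ jobs at time $t$. Both $\mathbf{Q}^{(n)}=(Q_k^{(n)})_{k\in[n]}$ and $\mathbf{x}^{(n)}$ are taken to be Markov processes. When the system is stable, $\pi_n$ denotes the unique invariant measure of $\mathbf{x}^{(n)}$, and $\mathbf{x}^{(n)}(\infty),\mathbf{Q}^{(n)}(\infty)$ denote the steady-state values of the processes. The setup takes the servers to be indistinguishable under the load balancing scheme, so that $\mathbb{P}(Q^{(n)}_i(t)\ge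 k)=\mathbb{E}[x^{(n)}_k(t)]$ for each server $i\in[n]$, each $k$ and each $t\in[0,\infty]$. $\mathbf 1(\cdot)$ is the indicator function.
   Formalization: Index tie-breaking makes servers unequal, so E[Q_i]=E[Σx_i] for each i is stated for steady-state vectors assumed to satisfy P(Q_i≥k)=E[x_k] (unconditionally for the server average); positive recurrence is over states reachable from empty, which matters only for Po2-ε at ε=1. *)

theory Defs
  imports "HOL-Probability.Probability"
begin

(* Queue-length vectors are functions on nat; the servers are 1..n, and all other entries are 0. *)

definition queue_states :: "nat \<Rightarrow> (nat \<Rightarrow> nat) set" where
  "queue_states n = {q. \<forall>k. k \<notin> {1..n} \<longrightarrow> q k = 0}"

(* x_i = fraction of servers with at least i jobs. The index i = 0 is the conventional x_0 = 1
   and carries no information. *)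
definition occupancy :: "nat \<Rightarrow> (nat \<Rightarrow> nat) \<Rightarrow> nat \<Rightarrow> real" where
  "occupancy n q i = real (card {k \<in> {1..n}. i \<le> q k}) / real n"

(* A dispatching rule receives the queue lengths, the sampled pair a < b, and the outcome of an
   independent coin showing True with probability \<epsilon>; it returns the server that gets the job. *)
type_synonym dispatcher = "(nat \<Rightarrow> nat) \<Rightarrow> nat \<Rightarrow> nat \<Rightarrow> bool \<Rightarrow> nat"

definition longer :: "(nat \<Rightarrow> nat) \<Rightarrow> nat \<Rightarrow> nat \<Rightarrow> nat" where
  "longer q a b = (if q b < q a then a else b)"

definition shorter :: "(nat \<Rightarrow> nat) \<Rightarrow> nat \<Rightarrow> nat \<Rightarrow> nat" where
  "shorter q a b = (if q a < q b then a else b)"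

definition po2_g_eps :: "real \<Rightarrow> dispatcher" where
  "po2_g_eps g q a b coin =
     (if q a = q b then min a b
      else if \<bar>real (q a) - real (q b)\<bar> \<le> g \<and> coin then longer q a b
      else shorter q a b)"

definition po2_eps :: dispatcher where
  "po2_eps q a b coin =
     (if q a = q b then min a b
      else if coin then longer q a b
      else shorter q a b)"

(* The Markov process of queue lengths is built from a Poisson process of rate n * lam + n: the
   superposition of the arrival process (rate n * lam) and of n independent unit-rate processes of
   potential service completions, one per server. As job sizes are Exp(1), a busy server completes
   its current job at rate 1 whatever the past; a potential completion at an idle server has no
   effect (truncated subtraction in apply_event). Each event of the superposition is
   independently an arrival with probability lam / (1 + lam), otherwise a potential completion at a
   uniformly chosen server. *)
datatype event = Arrival nat nat bool | Completion nat

definition event_pmf :: "nat \<Rightarrow> real \<Rightarrow> real \<Rightarrow> event pmf" where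
  "event_pmf n lam \<epsilon> =
     bind_pmf (bernoulli_pmf (lam / (1 + lam))) (\<lambda>is_arrival.
       if is_arrival then
         bind_pmf (pmf_of_set {(a, b). 1 \<le> a \<and> a < b \<and> b \<le> n}) (\<lambda>(a, b).
           map_pmf (Arrival a b) (bernoulli_pmf \<epsilon>))
       else map_pmf Completion (pmf_of_set {1..n}))"

fun apply_event :: "dispatcher \<Rightarrow> event \<Rightarrow> (nat \<Rightarrow> nat) \<Rightarrow> (nat \<Rightarrow> nat)" where
  "apply_event D (Arrival a b coin) q = (let k = D q a b coin in q(k := q k + 1))"
| "apply_event D (Completion k) q = q(k := q k - 1)"

(* i.i.d. sequence of pairs (waiting time until the next event, event) *)
definition driver :: "nat \<Rightarrow> real \<Rightarrow> real \<Rightarrow> (real \<times> event) stream measure" where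
  "driver n lam \<epsilon> =
     stream_space (density lborel (exponential_density (real n * lam + real n))
                   \<Otimes>\<^sub>M measure_pmf (event_pmf n lam \<epsilon>))"

definition num_events :: "(real \<times> event) stream \<Rightarrow> real \<Rightarrow> nat" where
  "num_events \<omega> t = card {m. (\<Sum>j\<le>m. fst (\<omega> !! j)) \<le> t}"

definition queue_at :: "dispatcher \<Rightarrow> (nat \<Rightarrow> nat) \<Rightarrow> (real \<times> event) stream \<Rightarrow> real \<Rightarrow> (nat \<Rightarrow> nat)"
  where "queue_at D q \<omega> t = fold (apply_event D) (map snd (stake (num_events \<omega> t) \<omega>)) q"

definition occupancy_at ::
  "dispatcher \<Rightarrow> nat \<Rightarrow> (nat \<Rightarrow> nat) \<Rightarrow> (real \<times> event) stream \<Rightarrow> real \<Rightarrow> (nat \<Rightarrow> real)"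
  where "occupancy_at D n q \<omega> t = occupancy n (queue_at D q \<omega> t)"

definition queue_trans ::
  "dispatcher \<Rightarrow> nat \<Rightarrow> real \<Rightarrow> real \<Rightarrow> real \<Rightarrow> (nat \<Rightarrow> nat) \<Rightarrow> (nat \<Rightarrow> nat) \<Rightarrow> real" where
  "queue_trans D n lam \<epsilon> t q q' =
     measure (driver n lam \<epsilon>) {\<omega> \<in> space (driver n lam \<epsilon>). queue_at D q \<omega> t = q'}"

definition occupancy_trans ::
  "dispatcher \<Rightarrow> nat \<Rightarrow> real \<Rightarrow> real \<Rightarrow> real \<Rightarrow> (nat \<Rightarrow> nat) \<Rightarrow> (nat \<Rightarrow> real) \<Rightarrow> real" where
  "occupancy_trans D n lam \<epsilon> t q y =
     measure (driver n lam \<epsilon>) {\<omega> \<in> space (driver n lam \<epsilon>). occupancy_at D n q \<omega> t = y}"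

definition queue_invariant ::
  "dispatcher \<Rightarrow> nat \<Rightarrow> real \<Rightarrow> real \<Rightarrow> (nat \<Rightarrow> nat) pmf \<Rightarrow> bool" where
  "queue_invariant D n lam \<epsilon> \<mu> \<longleftrightarrow>
     set_pmf \<mu> \<subseteq> queue_states n \<and>
     (\<forall>t\<ge>0. \<forall>q'. measure_pmf.expectation \<mu> (\<lambda>q. queue_trans D n lam \<epsilon> t q q') = pmf \<mu> q')"

(* Invariance for the process x: if x(0) has law \<pi>, then x(t) has law \<pi>, whichever law \<mu> of Q(0)
   realises x(0). The support condition makes sure that such laws \<mu> exist. *)
definition occupancy_invariant ::
  "dispatcher \<Rightarrow> nat \<Rightarrow> real \<Rightarrow> real \<Rightarrow> (nat \<Rightarrow> real) pmf \<Rightarrow> bool" where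
  "occupancy_invariant D n lam \<epsilon> \<pi> \<longleftrightarrow>
     set_pmf \<pi> \<subseteq> occupancy n ` queue_states n \<and>
     (\<forall>\<mu>. set_pmf \<mu> \<subseteq> queue_states n \<and> map_pmf (occupancy n) \<mu> = \<pi> \<longrightarrow>
        (\<forall>t\<ge>0. \<forall>y. measure_pmf.expectation \<mu> (\<lambda>q. occupancy_trans D n lam \<epsilon> t q y) = pmf \<pi> y))"

(* First time at which x, having left its initial state, is in that state again; infinite if it
   never is. *)
definition return_time :: "dispatcher \<Rightarrow> nat \<Rightarrow> (nat \<Rightarrow> nat) \<Rightarrow> (real \<times> event) stream \<Rightarrow> ennreal"
  where
  "return_time D n q \<omega> =
     (INF t \<in> {t. 0 \<le> t \<and> occupancy_at D n q \<omega> t = occupancy n q \<and>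
                  (\<exists>s\<in>{0..t}. occupancy_at D n q \<omega> s \<noteq> occupancy n q)}. ennreal t)"

definition accessible_from_empty ::
  "dispatcher \<Rightarrow> nat \<Rightarrow> real \<Rightarrow> real \<Rightarrow> (nat \<Rightarrow> real) \<Rightarrow> bool" where
  "accessible_from_empty D n lam \<epsilon> y \<longleftrightarrow> (\<exists>t\<ge>0. occupancy_trans D n lam \<epsilon> t (\<lambda>_. 0) y > 0)"

(* Finite mean return time for every state of x that the system can reach from empty. The
   empty state is accessible from every state, so these states form the unique closed communicating
   class. The restriction matters only for po2_eps with \<epsilon> = 1, where states with all servers
   busy cannot be reached from empty and x is not irreducible on the set of all states. *)
definition positive_recurrent :: "dispatcher \<Rightarrow> nat \<Rightarrow> real \<Rightarrow> real \<Rightarrow> bool" where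
  "positive_recurrent D n lam \<epsilon> \<longleftrightarrow>
     (\<forall>q\<in>queue_states n. accessible_from_empty D n lam \<epsilon> (occupancy n q) \<longrightarrow>
        (\<integral>\<^sup>+\<omega>. return_time D n q \<omega> \<partial>driver n lam \<epsilon>) < \<infinity>)"

definition mean_total_occupancy :: "(nat \<Rightarrow> real) pmf \<Rightarrow> ennreal" where
  "mean_total_occupancy \<pi> = (\<integral>\<^sup>+x. (\<Sum>i. ennreal (x (Suc i))) \<partial>measure_pmf \<pi>)"

definition mean_queue :: "(nat \<Rightarrow> nat) pmf \<Rightarrow> nat \<Rightarrow> ennreal" where
  "mean_queue \<mu> i = (\<integral>\<^sup>+q. of_nat (q i) \<partial>measure_pmf \<mu>)"

(* \<mu> is the law of a vector Q(\<infinity>) whose occupancy x(\<infinity>) has law \<pi> and whose servers are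
   indistinguishable: P(Q_i(\<infinity>) \<ge> k) = E[x_k(\<infinity>)] for every server i and every k. Ties are broken
   by index, so this identity cannot be derived from the dynamics for each individual server; it is
   an assumption. It is not required that \<mu> itself be invariant for Q: relabelling
   the servers of the invariant law of Q by an independent uniform permutation yields such a \<mu>. *)
definition indistinguishable_version ::
  "nat \<Rightarrow> (nat \<Rightarrow> real) pmf \<Rightarrow> (nat \<Rightarrow> nat) pmf \<Rightarrow> bool" where
  "indistinguishable_version n \<pi> \<mu> \<longleftrightarrow>
     set_pmf \<mu> \<subseteq> queue_states n \<and> map_pmf (occupancy n) \<mu> = \<pi> \<and>
     (\<forall>i\<in>{1..n}. \<forall>k\<ge>1.
        measure_pmf.prob \<mu> {q. k \<le> q i} = measure_pmf.expectation \<pi> (\<lambda>x. x k))"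

end

theory Submission
  imports Defs "HOL-Combinatorics.Permutations"
begin

text \<open>
  The queue lengths form a jump chain run by a Poisson clock: at each epoch an independent event (an
  arrival at a random pair of servers, or a potential completion) is applied to the state. All
  statements about the process in continuous time reduce to statements about this discrete chain,
  because waiting times and events are independent: the law at time \<open>t\<close> is a Poisson mixture of the
  iterates of the jump kernel (\<open>events_law\<close>, \<open>run_events_pmf\<close>), and a mean return time is the mean
  waiting time multiplied by the mean number of steps (\<open>return_time_eq\<close>, \<open>mean_return_time\<close>).

  The occupancy is a function of the chain that is again Markov. Two states with the same occupancy
  differ by a permutation of the servers; the law of the events is invariant under relabelling of
  the servers, and the tie-breaking by index is invisible in the occupancy (\<open>occ_jump_cong\<close>).

  Stability comes from the drift of the sum of squares of the queue lengths. If an arriving job joins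
  on average a queue of length at most \<open>\<alpha>\<close> times the mean of the two sampled lengths plus \<open>\<beta>\<close>, then
  the sum of squares decreases at rate \<open>2 (1 - \<alpha> lam)\<close> times the number of jobs, up to a bounded term
  (\<open>drift_sum_squares\<close>). For the scheme with threshold \<open>g\<close> one can take \<open>\<alpha> = 1\<close>, and \<open>\<beta> = g\<close>
  if \<open>\<epsilon> > 1/2\<close>, \<open>\<beta> = 0\<close> otherwise; without threshold one takes \<open>\<alpha> = max 1 (2 \<epsilon>)\<close> and \<open>\<beta> = 0\<close>. A bounded correction makes the
  drift at most \<open>-1\<close> in every state but the idle one, which makes excursions from the idle state
  integrable, and the occupation measure of one excursion, normalised, is invariant
  (\<open>invariant_exists_if_drift\<close>). The same drift, integrated against the invariant law with a
  truncation of the Lyapunov function, gives the bound on the mean number of jobs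
  (\<open>invariant_drift_bound\<close>, \<open>mean_total_le\<close>). Kac's inequality bounds the mean return time to every
  state of positive mass, hence to every accessible occupancy (\<open>kac_inequality\<close>,
  \<open>positive_recurrent_if_invariant\<close>). Uniqueness of the invariant laws holds because at time 1 the
  idle state has positive probability from every state (\<open>invariant_unique\<close>).

  Instability comes from a functional that vanishes in the idle state only, grows by at most one per
  step and is a submartingale. Optional stopping forces the chain, started with value 1, to avoid the
  idle state for \<open>m\<close> steps with probability at least \<open>1 / (m + 1)\<close>, and the harmonic series diverges
  (\<open>avoid_lower_bound\<close>, \<open>not_positive_recurrent\<close>). For \<open>lam \<ge> 1\<close> the functional is the number of jobs.
  For \<open>2 \<epsilon> lam \<ge> 1\<close>, without threshold, it is the length of the longest queue: a unique longest queue
  is sampled by a fraction \<open>2 / n\<close> of the arrivals and gets these with probability \<open>\<epsilon>\<close>, so that it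
  grows at rate \<open>2 \<epsilon> lam\<close> and shrinks at rate 1 (\<open>longest_submartingale\<close>).
\<close>

section \<open>Kernels on discrete spaces: invariant laws, hitting and drift\<close>

definition invariant :: "('a \<Rightarrow> 'a pmf) \<Rightarrow> 'a pmf \<Rightarrow> bool" where
  "invariant K \<mu> \<longleftrightarrow> bind_pmf \<mu> K = \<mu>"

lemma invariant_nn_integral:
  fixes f :: "'a \<Rightarrow> ennreal" and K :: "'a \<Rightarrow> 'a pmf"
  assumes "invariant K \<mu>"
  shows "(\<integral>\<^sup>+x. (\<integral>\<^sup>+y. f y \<partial>K x) \<partial>\<mu>) = (\<integral>\<^sup>+x. f x \<partial>\<mu>)"
  using nn_integral_bind_pmf[of \<mu> K f] assms unfolding invariant_def by simp

lemma invariant_closed: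
  assumes "invariant K \<mu>" "x \<in> set_pmf \<mu>" "y \<in> set_pmf (K x)"
  shows "y \<in> set_pmf \<mu>"
  using assms set_bind_pmf[of \<mu> K] unfolding invariant_def by auto

lemma nn_integral_pmf_eq_1 [simp]: "(\<integral>\<^sup>+y. ennreal (pmf p y) \<partial>count_space UNIV) = 1"
  by (simp add: nn_integral_pmf)

text \<open>Both mass functions have total 1, so a pointwise inequality leaves no room for a
  difference.\<close>

lemma pmf_eq_if_le:
  assumes "\<And>x. pmf \<mu> x \<le> pmf \<nu> x"
  shows "\<mu> = \<nu>"
proof (rule pmf_eqI, rule ccontr)
  fix x assume ne: "pmf \<mu> x \<noteq> pmf \<nu> x"
  have "(\<integral>\<^sup>+y. ennreal (pmf \<nu> y - pmf \<mu> y) \<partial>count_space UNIV)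
      = (\<integral>\<^sup>+y. ennreal (pmf \<nu> y) \<partial>count_space UNIV) - (\<integral>\<^sup>+y. ennreal (pmf \<mu> y) \<partial>count_space UNIV)"
    by (subst nn_integral_diff[symmetric]) (auto simp: ennreal_minus assms nn_integral_pmf intro!: AE_I2)
  then have "(\<integral>\<^sup>+y. ennreal (pmf \<nu> y - pmf \<mu> y) \<partial>count_space UNIV) = 0"
    by simp
  then have "ennreal (pmf \<nu> x - pmf \<mu> x) = 0"
    by (subst (asm) nn_integral_0_iff_AE) (auto simp: AE_count_space)
  with ne assms[of x] show False by simp
qed

text \<open>Tonelli for the counting measure. The weights \<open>a\<close> may have infinite total
  mass, as do, a priori, the occupation measures to which this is applied.\<close>

lemma nn_integral_kernel:
  fixes a :: "'a \<Rightarrow> ennreal" and K :: "'a \<Rightarrow> 'a pmf"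
  shows "(\<integral>\<^sup>+y. (\<integral>\<^sup>+x. a x * ennreal (pmf (K x) y) \<partial>count_space UNIV) * f y \<partial>count_space UNIV)
       = (\<integral>\<^sup>+x. a x * (\<integral>\<^sup>+y. f y \<partial>K x) \<partial>count_space UNIV)"
proof -
  have "(\<integral>\<^sup>+y. (\<integral>\<^sup>+x. a x * ennreal (pmf (K x) y) \<partial>count_space UNIV) * f y \<partial>count_space UNIV)
      = (\<integral>\<^sup>+y. (\<integral>\<^sup>+x. (a x * ennreal (pmf (K x) y)) * f y \<partial>count_space UNIV) \<partial>count_space UNIV)"
    by (simp add: nn_integral_multc)
  also have "\<dots> = (\<integral>\<^sup>+x. (\<integral>\<^sup>+y. (a x * ennreal (pmf (K x) y)) * f y \<partial>count_space UNIV) \<partial>count_space UNIV)"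
    using nn_integral_fst_count_space[of "\<lambda>(y, x). (a x * ennreal (pmf (K x) y)) * f y"]
      nn_integral_snd_count_space[of "\<lambda>(y, x). (a x * ennreal (pmf (K x) y)) * f y"] by simp
  also have "\<dots> = (\<integral>\<^sup>+x. a x * (\<integral>\<^sup>+y. f y \<partial>K x) \<partial>count_space UNIV)"
    by (simp add: nn_integral_measure_pmf nn_integral_cmult[symmetric] mult.assoc)
  finally show ?thesis .
qed

text \<open>The pointwise minimum \<open>m\<close> of two invariant laws is mapped by the kernel to
  something below \<open>m\<close> of the same total mass, hence to \<open>m\<close> itself. One of
  the two laws agrees with \<open>m\<close> at \<open>z\<close>; as all states of positive mass lead
  to \<open>z\<close> in one step, invariance at \<open>z\<close> forces this law to agree with
  \<open>m\<close> everywhere, so it lies below the other law and equals it.\<close>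

lemma invariant_unique:
  assumes inv: "invariant K \<mu>" "invariant K \<nu>"
    and z: "\<And>x. x \<in> set_pmf \<mu> \<union> set_pmf \<nu> \<Longrightarrow> z \<in> set_pmf (K x)"
  shows "\<mu> = \<nu>"
proof -
  let ?C = "count_space UNIV"
  define m where "m x = ennreal (min (pmf \<mu> x) (pmf \<nu> x))" for x
  define mK where "mK y = (\<integral>\<^sup>+x. m x * ennreal (pmf (K x) y) \<partial>?C)" for y
  have inv_pmf: "ennreal (pmf \<rho> y) = (\<integral>\<^sup>+x. ennreal (pmf \<rho> x) * ennreal (pmf (K x) y) \<partial>?C)"
    if "invariant K \<rho>" for \<rho> y
    using ennreal_pmf_bind[of \<rho> K y] that
    by (simp add: invariant_def nn_integral_measure_pmf)
  have m_le: "m x \<le> ennreal (pmf \<mu> x)" "m x \<le> ennreal (pmf \<nu> x)" for x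
    unfolding m_def by (auto intro!: ennreal_leI)
  have mK_le: "mK y \<le> m y" for y
  proof -
    have "mK y \<le> ennreal (pmf \<mu> y)" "mK y \<le> ennreal (pmf \<nu> y)"
      unfolding mK_def inv_pmf[OF inv(1), of y] inv_pmf[OF inv(2), of y]
      by (intro nn_integral_mono mult_right_mono m_le; simp)+
    then show ?thesis unfolding m_def by (simp add: min_def)
  qed
  have total: "(\<integral>\<^sup>+y. mK y \<partial>?C) = (\<integral>\<^sup>+y. m y \<partial>?C)"
    using nn_integral_kernel[of m K "\<lambda>_. 1"] by (simp add: mK_def)
  have fin: "(\<integral>\<^sup>+y. m y \<partial>?C) < \<infinity>"
  proof -
    have "(\<integral>\<^sup>+y. m y \<partial>?C) \<le> (\<integral>\<^sup>+y. ennreal (pmf \<mu> y) \<partial>?C)"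
      by (intro nn_integral_mono m_le)
    then show ?thesis by (simp add: order_le_less_trans)
  qed
  have "(\<integral>\<^sup>+y. m y - mK y \<partial>?C) = 0"
    using total fin by (subst nn_integral_diff) (auto simp: mK_le)
  then have "m z - mK z = 0"
    by (subst (asm) nn_integral_0_iff_AE) (auto simp: AE_count_space)
  then have mz: "mK z = m z"
    using mK_le[of z] by (simp add: diff_eq_0_iff_ennreal m_def antisym)
  have key: "\<mu>' = \<nu>'"
    if inv': "invariant K \<mu>'" and le: "\<And>x. m x \<le> ennreal (pmf \<mu>' x)" "\<And>x. m x \<le> ennreal (pmf \<nu>' x)"
      and eq: "m z = ennreal (pmf \<mu>' z)" and z': "\<And>x. x \<in> set_pmf \<mu>' \<Longrightarrow> z \<in> set_pmf (K x)"
    for \<mu>' \<nu>'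
  proof (rule pmf_eq_if_le)
    fix x
    have "(\<integral>\<^sup>+x. ennreal (pmf \<mu>' x) * ennreal (pmf (K x) z) - m x * ennreal (pmf (K x) z) \<partial>?C)
       = (\<integral>\<^sup>+x. ennreal (pmf \<mu>' x) * ennreal (pmf (K x) z) \<partial>?C)
         - (\<integral>\<^sup>+x. m x * ennreal (pmf (K x) z) \<partial>?C)"
    proof (rule nn_integral_diff)
      have "(\<integral>\<^sup>+x. m x * ennreal (pmf (K x) z) \<partial>?C) = m z"
        using mz by (simp add: mK_def)
      then show "(\<integral>\<^sup>+x. m x * ennreal (pmf (K x) z) \<partial>?C) \<noteq> \<infinity>" by (simp add: m_def)
    qed (auto intro!: mult_right_mono le)
    also have "\<dots> = 0" using mz eq by (simp add: mK_def inv_pmf[OF inv', symmetric])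
    finally have "ennreal (pmf \<mu>' x) * ennreal (pmf (K x) z) - m x * ennreal (pmf (K x) z) = 0"
      by (subst (asm) nn_integral_0_iff_AE) (auto simp: AE_count_space)
    then have le2: "ennreal (pmf \<mu>' x) * ennreal (pmf (K x) z) \<le> m x * ennreal (pmf (K x) z)"
      by (simp add: diff_eq_0_iff_ennreal ennreal_mult_eq_top_iff)
    show "pmf \<mu>' x \<le> pmf \<nu>' x"
    proof (cases "x \<in> set_pmf \<mu>'")
      case True
      then have "pmf (K x) z > 0" using z' by (simp add: pmf_positive)
      then have "ennreal (pmf \<mu>' x) \<le> m x"
        using le2 by (simp add: m_def ennreal_mult[symmetric])
      then show ?thesis using le(2)[of x] by (meson ennreal_le_iff order_trans pmf_nonneg)
    next
      case False
      then have "pmf \<mu>' x = 0" by (simp add: set_pmf_iff)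
      then show ?thesis by simp
    qed
  qed
  show ?thesis
  proof (cases "pmf \<mu> z \<le> pmf \<nu> z")
    case True
    then have "m z = ennreal (pmf \<mu> z)" by (simp add: m_def min_def)
    then show ?thesis using z by (intro key[OF inv(1) m_le]) auto
  next
    case False
    then have "m z = ennreal (pmf \<nu> z)" by (simp add: m_def min_def)
    then have "\<nu> = \<mu>" using z by (intro key[OF inv(2) m_le(2) m_le(1)]) auto
    then show ?thesis by simp
  qed
qed

text \<open>The sub-probability that a path from \<open>z\<close> is at \<open>y\<close> at time
  \<open>k\<close> and has not been back in \<open>z\<close> at the times \<open>1, \<dots>,
  k\<close>.\<close>

primrec excursion :: "('a \<Rightarrow> 'a pmf) \<Rightarrow> 'a \<Rightarrow> nat \<Rightarrow> 'a \<Rightarrow> ennreal" where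
  "excursion K z 0 y = indicator {z} y"
| "excursion K z (Suc k) y =
     (\<integral>\<^sup>+x. excursion K z k x * ennreal (pmf (K x) y) \<partial>count_space UNIV) * indicator (- {z}) y"

lemma excursion_support:
  assumes "z \<in> X" "\<And>x. x \<in> X \<Longrightarrow> set_pmf (K x) \<subseteq> X" "y \<notin> X"
  shows "excursion K z k y = 0"
  using assms(3)
proof (induction k arbitrary: y)
  case 0
  then show ?case using assms(1) by (auto simp: indicator_def)
next
  case (Suc k)
  have *: "excursion K z k x * ennreal (pmf (K x) y) = 0" for x
  proof (cases "x \<in> X")
    case True
    then have "y \<notin> set_pmf (K x)" using assms(2) Suc.prems by blast
    then show ?thesis by (simp add: pmf_eq_0_set_pmf)
  qed (simp add: Suc.IH)
  show ?case by (simp only: excursion.simps * nn_integral_const) simp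
qed

text \<open>The cycle formula. Summed over the time, the excursion measures give the expected time
  \<open>G\<close> that an excursion from \<open>z\<close> spends in each state. The drift condition
  bounds the total mass of \<open>G\<close> by the mean of \<open>W\<close> after one step from
  \<open>z\<close>. The kernel maps \<open>G\<close> to \<open>G\<close> away from \<open>z\<close>
  by construction, and at \<open>z\<close> because it preserves the finite total mass.\<close>

lemma invariant_exists_if_drift:
  fixes W :: "'a \<Rightarrow> ennreal"
  assumes zX: "z \<in> X" and closed: "\<And>x. x \<in> X \<Longrightarrow> set_pmf (K x) \<subseteq> X"
    and drift: "\<And>x. x \<in> X \<Longrightarrow> x \<noteq> z \<Longrightarrow> (\<integral>\<^sup>+y. W y \<partial>K x) + 1 \<le> W x"
    and start: "(\<integral>\<^sup>+y. W y \<partial>K z) < \<infinity>"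
  shows "\<exists>\<mu>. invariant K \<mu> \<and> set_pmf \<mu> \<subseteq> X"
proof -
  let ?C = "count_space UNIV"
  define a where "a = excursion K z"
  define G where "G y = (\<Sum>k. a k y)" for y
  define GK where "GK y = (\<integral>\<^sup>+x. G x * ennreal (pmf (K x) y) \<partial>?C)" for y
  have a_supp: "a k y = 0" if "y \<notin> X" for k y
    unfolding a_def by (rule excursion_support[OF zX closed that])
  have aS: "(\<integral>\<^sup>+y. a (Suc k) y * f y \<partial>?C) = (\<integral>\<^sup>+x. a k x * (\<integral>\<^sup>+y. indicator (- {z}) y * f y \<partial>K x) \<partial>?C)"
    for k and f :: "'a \<Rightarrow> ennreal"
    using nn_integral_kernel[of "a k" K "\<lambda>y. indicator (- {z}) y * f y"]
    by (simp add: a_def mult.assoc)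
  have a_z: "a (Suc k) z = 0" for k by (simp add: a_def)
  \<comment> \<open>Each step away from z costs at least one unit of W, so the excursion has finite total mass.\<close>
  have step: "(\<integral>\<^sup>+y. a (Suc (Suc k)) y * W y \<partial>?C) + (\<integral>\<^sup>+y. a (Suc k) y \<partial>?C) \<le> (\<integral>\<^sup>+y. a (Suc k) y * W y \<partial>?C)" for k
  proof -
    have "(\<integral>\<^sup>+y. a (Suc (Suc k)) y * W y \<partial>?C) + (\<integral>\<^sup>+y. a (Suc k) y \<partial>?C)
       \<le> (\<integral>\<^sup>+x. a (Suc k) x * (\<integral>\<^sup>+y. W y \<partial>K x) \<partial>?C) + (\<integral>\<^sup>+y. a (Suc k) y \<partial>?C)"
      unfolding aS[of "Suc k" W]
      by (intro add_mono order_refl nn_integral_mono mult_left_mono) (auto simp: indicator_def)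
    also have "\<dots> = (\<integral>\<^sup>+x. a (Suc k) x * ((\<integral>\<^sup>+y. W y \<partial>K x) + 1) \<partial>?C)"
      by (subst nn_integral_add[symmetric]) (auto simp: distrib_left)
    also have "\<dots> \<le> (\<integral>\<^sup>+x. a (Suc k) x * W x \<partial>?C)"
    proof (intro nn_integral_mono)
      fix x
      show "a (Suc k) x * ((\<integral>\<^sup>+y. W y \<partial>K x) + 1) \<le> a (Suc k) x * W x"
        by (cases "x \<in> X"; cases "x = z") (simp_all add: a_supp a_z mult_left_mono drift)
    qed
    finally show ?thesis .
  qed
  have partial: "(\<integral>\<^sup>+y. a (Suc k) y * W y \<partial>?C) + (\<Sum>j<k. \<integral>\<^sup>+y. a (Suc j) y \<partial>?C) \<le> (\<integral>\<^sup>+y. a (Suc 0) y * W y \<partial>?C)" for k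
  proof (induction k)
    case (Suc k)
    have "(\<integral>\<^sup>+y. a (Suc (Suc k)) y * W y \<partial>?C) + (\<Sum>j<Suc k. \<integral>\<^sup>+y. a (Suc j) y \<partial>?C)
      = ((\<integral>\<^sup>+y. a (Suc (Suc k)) y * W y \<partial>?C) + (\<integral>\<^sup>+y. a (Suc k) y \<partial>?C))
        + (\<Sum>j<k. \<integral>\<^sup>+y. a (Suc j) y \<partial>?C)"
      by (simp only: sum.lessThan_Suc add_ac)
    also have "\<dots> \<le> (\<integral>\<^sup>+y. a (Suc k) y * W y \<partial>?C) + (\<Sum>j<k. \<integral>\<^sup>+y. a (Suc j) y \<partial>?C)"
      by (rule add_right_mono[OF step])
    finally show ?case using Suc.IH by (rule order_trans)
  qed simp
  have "(\<integral>\<^sup>+y. a (Suc 0) y * W y \<partial>?C) \<le> (\<integral>\<^sup>+x. a 0 x * (\<integral>\<^sup>+y. W y \<partial>K x) \<partial>?C)"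
    unfolding aS[of 0 W] by (intro nn_integral_mono mult_left_mono) (auto simp: indicator_def)
  also have "\<dots> = (\<integral>\<^sup>+x. (\<integral>\<^sup>+y. W y \<partial>K z) * indicator {z} x \<partial>?C)"
    by (intro nn_integral_cong) (auto simp: a_def indicator_def)
  also have "\<dots> = (\<integral>\<^sup>+y. W y \<partial>K z)" by (simp add: nn_integral_cmult_indicator)
  finally have W1: "(\<integral>\<^sup>+y. a (Suc 0) y * W y \<partial>?C) \<le> (\<integral>\<^sup>+y. W y \<partial>K z)" .
  have a0: "(\<integral>\<^sup>+y. a 0 y \<partial>?C) = 1" by (simp add: a_def)
  have "(\<Sum>k. \<integral>\<^sup>+y. a (Suc k) y \<partial>?C) \<le> (\<integral>\<^sup>+y. W y \<partial>K z)"
  proof (rule suminf_le_const)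
    fix k show "(\<Sum>j<k. \<integral>\<^sup>+y. a (Suc j) y \<partial>?C) \<le> (\<integral>\<^sup>+y. W y \<partial>K z)"
      by (rule order_trans[OF _ order_trans[OF partial[of k] W1]]) simp
  qed simp
  then have fin1: "(\<Sum>k. \<integral>\<^sup>+y. a (Suc k) y \<partial>?C) < \<infinity>" using start by (rule order_le_less_trans)
  have Gtot: "(\<integral>\<^sup>+y. G y \<partial>?C) = (\<Sum>k. \<integral>\<^sup>+y. a k y \<partial>?C)"
    unfolding G_def by (rule nn_integral_suminf) simp
  also have "\<dots> = 1 + (\<Sum>k. \<integral>\<^sup>+y. a (Suc k) y \<partial>?C)"
    using suminf_offset[of "\<lambda>k. \<integral>\<^sup>+y. a k y \<partial>?C" 1] a0 by simp
  finally have Gtot': "(\<integral>\<^sup>+y. G y \<partial>?C) = 1 + (\<Sum>k. \<integral>\<^sup>+y. a (Suc k) y \<partial>?C)" .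
  then have Gfin: "(\<integral>\<^sup>+y. G y \<partial>?C) < \<infinity>" using fin1 by simp
  have Gge: "(\<integral>\<^sup>+y. G y \<partial>?C) \<ge> 1" using Gtot' by simp
  have Gsplit: "G y = a 0 y + (\<Sum>k. a (Suc k) y)" for y
    unfolding G_def using suminf_offset[of "\<lambda>k. a k y" 1] by simp
  have Gz: "G z = 1" unfolding Gsplit a_z by (simp add: a_def)
  have GK_sum: "GK y = (\<Sum>k. \<integral>\<^sup>+x. a k x * ennreal (pmf (K x) y) \<partial>?C)" for y
  proof -
    have "GK y = (\<integral>\<^sup>+x. (\<Sum>k. a k x * ennreal (pmf (K x) y)) \<partial>?C)"
      unfolding GK_def G_def by (intro nn_integral_cong) simp
    also have "\<dots> = (\<Sum>k. \<integral>\<^sup>+x. a k x * ennreal (pmf (K x) y) \<partial>?C)"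
      by (rule nn_integral_suminf) simp
    finally show ?thesis .
  qed
  have off: "GK y = G y" if "y \<noteq> z" for y
    using that unfolding GK_sum Gsplit by (simp add: a_def)
  have tot: "(\<integral>\<^sup>+y. GK y \<partial>?C) = (\<integral>\<^sup>+y. G y \<partial>?C)"
    using nn_integral_kernel[of G K "\<lambda>_. 1"] by (simp add: GK_def)
  have split: "(\<integral>\<^sup>+y. F y \<partial>?C) = F z + (\<integral>\<^sup>+y. F y * indicator (- {z}) y \<partial>?C)" for F :: "'a \<Rightarrow> ennreal"
  proof -
    have "(\<integral>\<^sup>+y. F y \<partial>?C) = (\<integral>\<^sup>+y. F z * indicator {z} y + F y * indicator (- {z}) y \<partial>?C)"
      by (intro nn_integral_cong) (auto simp: indicator_def)
    then show ?thesis by (simp add: nn_integral_add nn_integral_cmult_indicator)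
  qed
  have offint: "(\<integral>\<^sup>+y. GK y * indicator (- {z}) y \<partial>?C) = (\<integral>\<^sup>+y. G y * indicator (- {z}) y \<partial>?C)"
    by (intro nn_integral_cong) (auto simp: indicator_def off)
  have "(\<integral>\<^sup>+y. G y * indicator (- {z}) y \<partial>?C) < \<infinity>" using Gfin split[of G] by (simp add: Gz)
  \<comment> \<open>Equality of the finite total masses, with agreement away from z, gives agreement at z.\<close>
  then have "GK z = G z"
    using tot split[of G] split[of GK] offint
    by (auto simp: add.commute[of _ "\<integral>\<^sup>+y. G y * indicator (- {z}) y \<partial>?C"] ennreal_add_left_cancel)
  then have GKG: "GK y = G y" for y using off by metis
  define c where "c = enn2real (\<integral>\<^sup>+y. G y \<partial>?C)"
  have c: "ennreal c = (\<integral>\<^sup>+y. G y \<partial>?C)" using Gfin unfolding c_def by simp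
  have c1: "c \<ge> 1" using Gge unfolding c[symmetric] by simp
  have Gy: "G y < \<infinity>" for y
  proof -
    have "G y = (\<integral>\<^sup>+x. G y * indicator {y} x \<partial>?C)" by (simp add: nn_integral_cmult_indicator)
    also have "\<dots> \<le> (\<integral>\<^sup>+x. G x \<partial>?C)" by (intro nn_integral_mono) (auto simp: indicator_def)
    finally show ?thesis using Gfin by (rule order_le_less_trans)
  qed
  have divG: "ennreal (enn2real (G y) / c) = G y / ennreal c" for y
    using c1 Gy[of y] by (simp add: divide_ennreal[symmetric])
  define \<mu> where "\<mu> = embed_pmf (\<lambda>y. enn2real (G y) / c)"
  have pmf\<mu>: "pmf \<mu> y = enn2real (G y) / c" for y
    unfolding \<mu>_def
  proof (rule pmf_embed_pmf)
    have "(\<integral>\<^sup>+y. ennreal (enn2real (G y) / c) \<partial>?C) = (\<integral>\<^sup>+y. G y \<partial>?C) / ennreal c"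
      unfolding divG by (rule nn_integral_divide) simp
    also have "\<dots> = 1" unfolding c[symmetric] using c1 by (simp add: divide_ennreal)
    finally show "(\<integral>\<^sup>+y. ennreal (enn2real (G y) / c) \<partial>?C) = 1" .
  qed (use c1 in simp)
  have "ennreal (pmf (bind_pmf \<mu> K) y) = ennreal (pmf \<mu> y)" for y
  proof -
    have "ennreal (pmf (bind_pmf \<mu> K) y) = (\<integral>\<^sup>+x. (G x / ennreal c) * ennreal (pmf (K x) y) \<partial>?C)"
      by (simp add: ennreal_pmf_bind nn_integral_measure_pmf pmf\<mu> divG)
    also have "\<dots> = (\<integral>\<^sup>+x. (G x * ennreal (pmf (K x) y)) / ennreal c \<partial>?C)"
      by (intro nn_integral_cong) (simp add: divide_ennreal_def mult_ac)
    also have "\<dots> = GK y / ennreal c" unfolding GK_def by (rule nn_integral_divide) simp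
    finally show ?thesis by (simp add: GKG pmf\<mu> divG)
  qed
  then have "invariant K \<mu>" unfolding invariant_def by (intro pmf_eqI) simp
  moreover have "set_pmf \<mu> \<subseteq> X"
  proof
    fix y assume "y \<in> set_pmf \<mu>"
    then have "G y \<noteq> 0" by (auto simp: set_pmf_iff pmf\<mu>)
    then show "y \<in> X" by (rule contrapos_np) (simp add: G_def a_supp)
  qed
  ultimately show ?thesis by blast
qed

text \<open>The probability that the path from \<open>x\<close> is outside \<open>A\<close> at all
  times \<open>0, \<dots>, m\<close>.\<close>

primrec avoid :: "('a \<Rightarrow> 'a pmf) \<Rightarrow> 'a set \<Rightarrow> nat \<Rightarrow> 'a \<Rightarrow> ennreal" where
  "avoid K A 0 x = indicator (- A) x"
| "avoid K A (Suc m) x = indicator (- A) x * (\<integral>\<^sup>+y. avoid K A m y \<partial>K x)"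

text \<open>Let \<open>r m\<close> be the stationary probability to avoid \<open>x\<close> at
  \<open>m + 1\<close> consecutive times. By stationarity it is the probability to avoid
  \<open>x\<close> at the times \<open>1, \<dots>, m + 1\<close>, so \<open>r m - r (m + 1)\<close>
  is the probability to be in \<open>x\<close> at time 0 and to stay away for at least \<open>m +
  1\<close> steps. These differences telescope. The series is one less than the mean return time to
  \<open>x\<close>.\<close>

lemma kac_inequality:
  assumes "invariant K \<mu>"
  shows "ennreal (pmf \<mu> x) * (\<Sum>m. \<integral>\<^sup>+y. avoid K {x} m y \<partial>K x) \<le> 1"
proof -
  define r where "r m = (\<integral>\<^sup>+y. avoid K {x} m y \<partial>\<mu>)" for m
  define H where "H m = (\<integral>\<^sup>+y. avoid K {x} m y \<partial>K x)" for m
  have r0: "r 0 \<le> 1"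
    using measure_pmf.emeasure_le_1[of \<mu> "- {x}"] by (simp add: r_def)
  have step: "r m = r (Suc m) + ennreal (pmf \<mu> x) * H m" for m
  proof -
    have "r m = (\<integral>\<^sup>+y. (\<integral>\<^sup>+y'. avoid K {x} m y' \<partial>K y) \<partial>\<mu>)"
      unfolding r_def by (rule invariant_nn_integral[OF assms, symmetric])
    also have "\<dots> = (\<integral>\<^sup>+y. avoid K {x} (Suc m) y + H m * indicator {x} y \<partial>\<mu>)"
      by (intro nn_integral_cong) (auto simp: indicator_def H_def)
    also have "\<dots> = r (Suc m) + H m * emeasure \<mu> {x}"
      unfolding r_def by (simp add: nn_integral_add nn_integral_cmult_indicator del: avoid.simps)
    finally show ?thesis by (simp add: emeasure_pmf_single mult.commute)
  qed
  have part: "r m + (\<Sum>j<m. ennreal (pmf \<mu> x) * H j) \<le> 1" for m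
  proof (induction m)
    case (Suc m)
    then show ?case using step[of m] by (simp add: add_ac)
  qed (use r0 in simp)
  have "(\<Sum>m. ennreal (pmf \<mu> x) * H m) \<le> 1"
  proof (rule suminf_le_const)
    fix k show "(\<Sum>j<k. ennreal (pmf \<mu> x) * H j) \<le> 1"
      by (rule order_trans[OF _ part[of k]]) simp
  qed simp
  then show ?thesis by (simp add: H_def)
qed

text \<open>If \<open>V\<close> were integrable, one would integrate the drift inequality against
  \<open>\<mu>\<close> and cancel the two integrals of \<open>V\<close>. In general \<open>V\<close>
  is first truncated at a level \<open>M\<close>: the truncation keeps the drift inequality where
  \<open>V \<le> M\<close>, and elsewhere it has no upward drift. Then \<open>M\<close> tends to
  infinity.\<close>

lemma invariant_drift_bound:
  fixes V :: "'a \<Rightarrow> real" and f g :: "'a \<Rightarrow> ennreal"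
  assumes inv: "invariant K \<mu>"
    and drift: "\<And>x. x \<in> set_pmf \<mu> \<Longrightarrow> (\<integral>\<^sup>+y. ennreal (V y) \<partial>K x) + f x \<le> ennreal (V x) + g x"
  shows "(\<integral>\<^sup>+x. f x \<partial>\<mu>) \<le> (\<integral>\<^sup>+x. g x \<partial>\<mu>)"
proof -
  have trunc: "(\<integral>\<^sup>+x. f x * indicator {x. V x \<le> real M} x \<partial>\<mu>) \<le> (\<integral>\<^sup>+x. g x \<partial>\<mu>)" for M :: nat
  proof -
    define h where "h x = min (ennreal (V x)) (of_nat M)" for x
    have "(\<integral>\<^sup>+x. h x \<partial>\<mu>) \<le> (\<integral>\<^sup>+x. of_nat M \<partial>\<mu>)" by (intro nn_integral_mono) (simp add: h_def)
    then have fin: "(\<integral>\<^sup>+x. h x \<partial>\<mu>) \<noteq> \<infinity>" by (auto simp: top_unique)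
    have pt: "(\<integral>\<^sup>+y. h y \<partial>K x) + f x * indicator {x. V x \<le> real M} x \<le> h x + g x" if "x \<in> set_pmf \<mu>" for x
    proof (cases "V x \<le> real M")
      case True
      then have "ennreal (V x) \<le> of_nat M" by (metis ennreal_leI ennreal_of_nat_eq_real_of_nat)
      then have "h x = ennreal (V x)" by (simp add: h_def min_def)
      moreover have "(\<integral>\<^sup>+y. h y \<partial>K x) \<le> (\<integral>\<^sup>+y. ennreal (V y) \<partial>K x)"
        by (intro nn_integral_mono) (simp add: h_def)
      ultimately show ?thesis using True drift[OF that] by (simp add: order_trans[OF add_right_mono])
    next
      case False
      then have "of_nat M \<le> ennreal (V x)" by (metis ennreal_leI ennreal_of_nat_eq_real_of_nat linear)
      then have "h x = of_nat M" by (simp add: h_def min_absorb2)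
      moreover have "(\<integral>\<^sup>+y. h y \<partial>K x) \<le> (\<integral>\<^sup>+y. of_nat M \<partial>K x)"
        by (intro nn_integral_mono) (simp add: h_def)
      ultimately show ?thesis using False by (simp add: add_increasing2)
    qed
    have "(\<integral>\<^sup>+x. h x \<partial>\<mu>) + (\<integral>\<^sup>+x. f x * indicator {x. V x \<le> real M} x \<partial>\<mu>)
        = (\<integral>\<^sup>+x. (\<integral>\<^sup>+y. h y \<partial>K x) + f x * indicator {x. V x \<le> real M} x \<partial>\<mu>)"
      by (simp add: nn_integral_add invariant_nn_integral[OF inv])
    also have "\<dots> \<le> (\<integral>\<^sup>+x. h x + g x \<partial>\<mu>)"
      by (intro nn_integral_mono_AE) (auto simp: AE_measure_pmf_iff pt)
    also have "\<dots> = (\<integral>\<^sup>+x. h x \<partial>\<mu>) + (\<integral>\<^sup>+x. g x \<partial>\<mu>)" by (simp add: nn_integral_add)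
    finally show ?thesis using fin by (simp add: ennreal_add_left_cancel_le)
  qed
  have "(\<integral>\<^sup>+x. f x \<partial>\<mu>) = (\<integral>\<^sup>+x. (SUP M. f x * indicator {x. V x \<le> real M} x) \<partial>\<mu>)"
  proof (intro nn_integral_cong antisym)
    fix x
    obtain M :: nat where "V x \<le> real M" using real_arch_simple by blast
    then show "f x \<le> (SUP M. f x * indicator {x. V x \<le> real M} x)"
      by (intro SUP_upper2[of M]) auto
  qed (auto intro!: SUP_least simp: indicator_def)
  also have "\<dots> = (SUP M. \<integral>\<^sup>+x. f x * indicator {x. V x \<le> real M} x \<partial>\<mu>)"
    by (rule nn_integral_monotone_convergence_SUP) (auto simp: incseq_def le_fun_def indicator_def)
  also have "\<dots> \<le> (\<integral>\<^sup>+x. g x \<partial>\<mu>)" by (intro SUP_least trunc)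
  finally show ?thesis .
qed

text \<open>Optional stopping at time \<open>m\<close>: the submartingale \<open>f\<close> vanishes
  on \<open>A\<close>, so its mean at time \<open>m\<close> is carried by the paths that have
  avoided \<open>A\<close>, where it is at most \<open>f x + m\<close>. A common bound
  \<open>C\<close> in place of \<open>f x + m\<close> lets the induction on \<open>m\<close> pass
  from \<open>x\<close> to its successors.\<close>

lemma avoid_lower_bound:
  fixes f :: "'a \<Rightarrow> ennreal"
  assumes closed: "\<And>x. x \<in> X \<Longrightarrow> set_pmf (K x) \<subseteq> X"
    and zero: "\<And>x. x \<in> X \<Longrightarrow> x \<in> A \<Longrightarrow> f x = 0"
    and sub: "\<And>x. x \<in> X \<Longrightarrow> x \<notin> A \<Longrightarrow> f x \<le> (\<integral>\<^sup>+y. f y \<partial>K x)"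
    and incr: "\<And>x y. x \<in> X \<Longrightarrow> y \<in> set_pmf (K x) \<Longrightarrow> f y \<le> f x + 1"
  shows "x \<in> X \<Longrightarrow> f x + of_nat m \<le> C \<Longrightarrow> f x \<le> C * avoid K A m x"
proof (induction m arbitrary: x)
  case 0
  then show ?case using zero by (cases "x \<in> A") auto
next
  case (Suc m)
  show ?case
  proof (cases "x \<in> A")
    case False
    have "f y \<le> C * avoid K A m y" if "y \<in> set_pmf (K x)" for y
    proof (rule Suc.IH)
      show "y \<in> X" using closed Suc.prems that by blast
      have "f y + of_nat m \<le> f x + 1 + of_nat m" using incr[OF Suc.prems(1) that] by (rule add_right_mono)
      also have "\<dots> = f x + of_nat (Suc m)" by (simp add: add_ac)
      finally show "f y + of_nat m \<le> C" using Suc.prems(2) by (rule order_trans)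
    qed
    then have "(\<integral>\<^sup>+y. f y \<partial>K x) \<le> (\<integral>\<^sup>+y. C * avoid K A m y \<partial>K x)"
      by (intro nn_integral_mono_AE) (auto simp: AE_measure_pmf_iff)
    also have "\<dots> = C * (\<integral>\<^sup>+y. avoid K A m y \<partial>K x)" by (simp add: nn_integral_cmult)
    finally show ?thesis using sub[OF Suc.prems(1) False] False by simp
  qed (use zero Suc.prems in simp)
qed

lemma suminf_harmonic_ennreal: "(\<Sum>m. ennreal (1 / real (Suc m))) = \<infinity>"
proof (rule ccontr)
  assume "\<not> ?thesis"
  then have "summable (\<lambda>m. 1 / real (Suc m))"
    by (intro summable_suminf_not_top) auto
  then have "summable (\<lambda>m. inverse (real (Suc m)))" by (simp add: field_simps)
  then have "summable (\<lambda>m. inverse (real m))" by (subst (asm) summable_Suc_iff)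
  then show False using not_summable_harmonic[where 'a = real] by simp
qed

lemma avoid_ge_harmonic:
  fixes f :: "'a \<Rightarrow> ennreal"
  assumes closed: "\<And>x. x \<in> X \<Longrightarrow> set_pmf (K x) \<subseteq> X"
    and zero: "\<And>x. x \<in> X \<Longrightarrow> x \<in> A \<Longrightarrow> f x = 0"
    and sub: "\<And>x. x \<in> X \<Longrightarrow> x \<notin> A \<Longrightarrow> f x \<le> (\<integral>\<^sup>+y. f y \<partial>K x)"
    and incr: "\<And>x y. x \<in> X \<Longrightarrow> y \<in> set_pmf (K x) \<Longrightarrow> f y \<le> f x + 1"
    and x: "x \<in> X" "f x = 1"
  shows "ennreal (1 / real (Suc m)) \<le> avoid K A m x"
proof -
  have "1 \<le> ennreal (real (Suc m)) * avoid K A m x"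
    using avoid_lower_bound[where f = f and K = K and X = X and A = A and m = m and C = "of_nat (Suc m)", OF closed zero sub incr x(1)] x(2)
    by (simp add: ennreal_of_nat_eq_real_of_nat[symmetric])
  then have "ennreal (1 / real (Suc m)) * 1 \<le> ennreal (1 / real (Suc m)) * (ennreal (real (Suc m)) * avoid K A m x)"
    by (rule mult_left_mono) simp
  also have "\<dots> = avoid K A m x"
    by (simp add: mult.assoc[symmetric] ennreal_mult[symmetric] del: of_nat_Suc)
  finally show ?thesis by simp
qed

primrec iterate :: "('a \<Rightarrow> 'a pmf) \<Rightarrow> nat \<Rightarrow> 'a \<Rightarrow> 'a pmf" where
  "iterate K 0 x = return_pmf x"
| "iterate K (Suc m) x = bind_pmf (K x) (iterate K m)"

lemma invariant_iterate: "invariant K \<mu> \<Longrightarrow> invariant (iterate K m) \<mu>"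
proof (induction m)
  case 0
  then show ?case by (simp add: invariant_def bind_return_pmf')
next
  case (Suc m)
  then show ?case by (simp add: invariant_def bind_assoc_pmf[symmetric])
qed

text \<open>The chain observed after a random number of steps. For Poisson numbers this is the
  transition kernel in continuous time.\<close>

definition subordinate :: "nat pmf \<Rightarrow> ('a \<Rightarrow> 'a pmf) \<Rightarrow> 'a \<Rightarrow> 'a pmf" where
  "subordinate c K x = bind_pmf c (\<lambda>m. iterate K m x)"

lemma invariant_subordinate: "invariant K \<mu> \<Longrightarrow> invariant (subordinate c K) \<mu>"
  using invariant_iterate[of K \<mu>]
  unfolding invariant_def subordinate_def by (subst bind_commute_pmf) simp

lemma iterate_closed:
  assumes "\<And>x. x \<in> X \<Longrightarrow> set_pmf (K x) \<subseteq> X" "x \<in> X"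
  shows "set_pmf (iterate K m x) \<subseteq> X"
  using assms(2)
proof (induction m arbitrary: x)
  case (Suc m)
  then show ?case using assms(1) by fastforce
qed simp

lemma invariant_iterate_closed:
  assumes "invariant K \<mu>" "x \<in> set_pmf \<mu>"
  shows "set_pmf (iterate K m x) \<subseteq> set_pmf \<mu>"
  using assms invariant_closed[OF assms(1)] by (intro iterate_closed) auto

section \<open>The marked Poisson clock\<close>

instance event :: countable by countable_datatype

definition marked_clock :: "real \<Rightarrow> 'e pmf \<Rightarrow> (real \<times> 'e) stream measure" where
  "marked_clock r p = stream_space (density lborel (exponential_density r) \<Otimes>\<^sub>M measure_pmf p)"

definition epoch :: "real stream \<Rightarrow> nat \<Rightarrow> real" where
  "epoch s m = (\<Sum>j<m. s !! j)"

lemma epoch_0 [simp]: "epoch s 0 = 0"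
  by (simp add: epoch_def)

lemma epoch_Suc: "epoch s (Suc m) = epoch s m + s !! m"
  by (simp add: epoch_def)

lemma epoch_Stream: "epoch (w ## s) (Suc m) = w + epoch s m"
  unfolding epoch_def by (subst sum.lessThan_Suc_shift) simp

text \<open>For positive waiting times: exactly \<open>m\<close> epochs occur up to time
  \<open>t\<close>. In contrast to a cardinality, this satisfies an exact recursion on streams,
  whatever the signs of the waiting times and of \<open>t\<close>.\<close>

definition in_step :: "real \<Rightarrow> nat \<Rightarrow> real stream \<Rightarrow> bool" where
  "in_step t m s \<longleftrightarrow> epoch s m \<le> t \<and> t < epoch s (Suc m)"

lemma in_step_Stream: "in_step t (Suc m) (w ## s) \<longleftrightarrow> in_step (t - w) m s"
  unfolding in_step_def epoch_Stream by linarith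

lemma measurable_epoch [measurable]: "(\<lambda>s. epoch s m) \<in> borel_measurable (stream_space borel)"
  unfolding epoch_def by measurable

lemma pred_in_step [measurable]: "Measurable.pred (stream_space borel) (in_step t m)"
  unfolding in_step_def by measurable

locale marked_poisson =
  fixes r :: real and p :: "'e::countable pmf"
  assumes r_pos: "0 < r"
begin

abbreviation "wait_law \<equiv> density lborel (exponential_density r)"
abbreviation "\<Omega> \<equiv> marked_clock r p"

lemma prob_wait: "prob_space wait_law"
  by (rule prob_space_exponential_density[OF r_pos])

lemma prob_mark: "prob_space (wait_law \<Otimes>\<^sub>M measure_pmf p)"
  by (intro prob_space_pair prob_wait measure_pmf.prob_space_axioms)

lemma prob_clock: "prob_space \<Omega>"
  unfolding marked_clock_def by (rule prob_space.prob_space_stream_space[OF prob_mark])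

lemma sets_clock [measurable_cong]: "sets \<Omega> = sets (stream_space (borel \<Otimes>\<^sub>M count_space UNIV))"
  unfolding marked_clock_def by (intro sets_stream_space_cong sets_pair_measure_cong) auto

lemma space_clock [simp]: "space \<Omega> = UNIV"
  by (simp add: marked_clock_def space_stream_space space_pair_measure)

lemma emeasure_clock_UNIV [simp]: "emeasure \<Omega> UNIV = 1"
  using prob_space.emeasure_space_1[OF prob_clock] by simp

lemma measurable_waits [measurable]: "smap fst \<in> \<Omega> \<rightarrow>\<^sub>M stream_space borel"
  unfolding measurable_cong_sets[OF sets_clock refl] by measurable

lemma measurable_marks [measurable]:
  "(\<lambda>\<omega>. stake m (smap snd \<omega>)) \<in> \<Omega> \<rightarrow>\<^sub>M count_space UNIV"
  unfolding measurable_cong_sets[OF sets_clock refl] by measurable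

lemma nn_integral_clock:
  assumes [measurable]: "f \<in> borel_measurable \<Omega>"
  shows "(\<integral>\<^sup>+\<omega>. f \<omega> \<partial>\<Omega>) = (\<integral>\<^sup>+w. (\<integral>\<^sup>+e. (\<integral>\<^sup>+\<omega>. f ((w, e) ## \<omega>) \<partial>\<Omega>) \<partial>p) \<partial>wait_law)"
proof -
  let ?M = "wait_law \<Otimes>\<^sub>M measure_pmf p"
  interpret M: prob_space ?M by (rule prob_mark)
  interpret S: prob_space "stream_space ?M" by (rule M.prob_space_stream_space)
  have [measurable]: "f \<in> borel_measurable (stream_space ?M)"
    using assms by (simp add: marked_clock_def)
  have [measurable]: "(\<lambda>(x, \<omega>). f (x ## \<omega>)) \<in> borel_measurable (?M \<Otimes>\<^sub>M stream_space ?M)"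
    by measurable
  have m: "(\<lambda>x. \<integral>\<^sup>+\<omega>. f (x ## \<omega>) \<partial>stream_space ?M) \<in> borel_measurable ?M"
    by measurable
  show ?thesis
    unfolding marked_clock_def M.nn_integral_stream_space[OF \<open>f \<in> borel_measurable (stream_space ?M)\<close>]
    by (subst measure_pmf.nn_integral_fst[symmetric, OF m]) simp
qed

lemma nn_integral_wait:
  "g \<in> borel_measurable borel \<Longrightarrow>
    (\<integral>\<^sup>+w. g w \<partial>wait_law) = (\<integral>\<^sup>+w. ennreal (exponential_density r w) * g w \<partial>lborel)"
  by (subst nn_integral_density) auto

lemma nn_integral_waits_step:
  assumes [measurable]: "\<psi> \<in> borel_measurable (stream_space borel)"
  shows "(\<integral>\<^sup>+\<omega>. \<psi> (smap fst \<omega>) \<partial>\<Omega>) = (\<integral>\<^sup>+w. (\<integral>\<^sup>+\<omega>. \<psi> (w ## smap fst \<omega>) \<partial>\<Omega>) \<partial>wait_law)"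
  by (subst nn_integral_clock) simp_all

text \<open>Waiting times and marks are drawn together, so their independence is proved by
  conditioning on the first pair; this is why the claim concerns arbitrary functions of the whole
  stream of waiting times.\<close>

lemma waits_indep_marks:
  assumes "\<psi> \<in> borel_measurable (stream_space borel)"
  shows "(\<integral>\<^sup>+\<omega>. \<psi> (smap fst \<omega>) * \<phi> (stake m (smap snd \<omega>)) \<partial>\<Omega>)
    = (\<integral>\<^sup>+\<omega>. \<psi> (smap fst \<omega>) \<partial>\<Omega>) * (\<integral>\<^sup>+es. \<phi> es \<partial>replicate_pmf m p)"
  using assms
proof (induction m arbitrary: \<psi> \<phi>)
  case 0
  note 0[measurable]
  show ?case by (simp add: nn_integral_multc)
next
  case (Suc m)
  note Suc.prems[measurable]
  interpret prob_space \<Omega> by (rule prob_clock)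
  have "(\<lambda>\<omega>. \<phi> (stake (Suc m) (smap snd \<omega>))) \<in> borel_measurable \<Omega>"
    by (rule measurable_compose[OF measurable_marks]) simp
  then have meas: "(\<lambda>\<omega>. \<psi> (smap fst \<omega>) * \<phi> (stake (Suc m) (smap snd \<omega>))) \<in> borel_measurable \<Omega>"
    by (rule borel_measurable_times_ennreal[rotated]) measurable
  have inner: "(\<integral>\<^sup>+\<omega>. \<psi> (w ## smap fst \<omega>) * \<phi> (e # stake m (smap snd \<omega>)) \<partial>\<Omega>)
      = (\<integral>\<^sup>+\<omega>. \<psi> (w ## smap fst \<omega>) \<partial>\<Omega>) * (\<integral>\<^sup>+es. \<phi> (e # es) \<partial>replicate_pmf m p)" for w e
    by (rule Suc.IH) measurable
  have "(\<integral>\<^sup>+\<omega>. \<psi> (smap fst \<omega>) * \<phi> (stake (Suc m) (smap snd \<omega>)) \<partial>\<Omega>)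
      = (\<integral>\<^sup>+w. (\<integral>\<^sup>+e. (\<integral>\<^sup>+\<omega>. \<psi> (w ## smap fst \<omega>) * \<phi> (e # stake m (smap snd \<omega>)) \<partial>\<Omega>) \<partial>p) \<partial>wait_law)"
    by (subst nn_integral_clock[OF meas]) simp
  also have "\<dots> = (\<integral>\<^sup>+w. (\<integral>\<^sup>+\<omega>. \<psi> (w ## smap fst \<omega>) \<partial>\<Omega>) * (\<integral>\<^sup>+e. \<integral>\<^sup>+es. \<phi> (e # es) \<partial>replicate_pmf m p \<partial>p) \<partial>wait_law)"
    unfolding inner by (simp add: nn_integral_cmult)
  also have "\<dots> = (\<integral>\<^sup>+w. (\<integral>\<^sup>+\<omega>. \<psi> (w ## smap fst \<omega>) \<partial>\<Omega>) \<partial>wait_law) * (\<integral>\<^sup>+e. \<integral>\<^sup>+es. \<phi> (e # es) \<partial>replicate_pmf m p \<partial>p)"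
    by (rule nn_integral_multc) measurable
  finally show ?case by (simp add: nn_integral_waits_step[OF Suc.prems] del: stake.simps)
qed

text \<open>The value 0 for negative times makes the convolution identity hold for every
  \<open>t\<close>, with no restriction on the first waiting time.\<close>

definition poisson_weight :: "real \<Rightarrow> nat \<Rightarrow> real" where
  "poisson_weight t m = (if t < 0 then 0 else (r * t) ^ m / fact m * exp (- (r * t)))"

lemma measurable_poisson_weight [measurable]: "(\<lambda>t. poisson_weight t m) \<in> borel_measurable borel"
  unfolding poisson_weight_def by measurable

lemma poisson_weight_convolution:
  "(\<integral>\<^sup>+w. ennreal (exponential_density r w) * ennreal (poisson_weight (t - w) m) \<partial>lborel)
     = ennreal (poisson_weight t (Suc m))"
proof (cases "t < 0")
  case True
  then have "ennreal (exponential_density r w) * ennreal (poisson_weight (t - w) m) = 0" for w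
    by (auto simp: exponential_density_def poisson_weight_def)
  then show ?thesis using True by (simp only: nn_integral_const) (simp add: poisson_weight_def)
next
  case False
  define f where "f w = r ^ Suc m * (t - w) ^ m / fact m * exp (- (r * t))" for w
  define F where "F w = - (r ^ Suc m * (t - w) ^ Suc m / fact (Suc m) * exp (- (r * t)))" for w
  have "ennreal (exponential_density r w) * ennreal (poisson_weight (t - w) m) = ennreal (f w) * indicator {0..t} w" for w
  proof (cases "0 \<le> w \<and> w \<le> t")
    case True
    have "r * exp (- (r * w)) * ((r * (t - w)) ^ m / fact m * exp (- (r * (t - w)))) =
       r ^ Suc m * (t - w) ^ m / fact m * (exp (- (r * w)) * exp (- (r * (t - w))))"
      by (simp add: power_mult_distrib)
    also have "exp (- (r * w)) * exp (- (r * (t - w))) = exp (- (r * t))"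
      by (simp add: exp_add[symmetric] algebra_simps)
    finally show ?thesis using True r_pos
      by (simp add: exponential_density_def poisson_weight_def f_def ennreal_mult[symmetric] mult.commute)
  qed (auto simp: exponential_density_def poisson_weight_def)
  then have "(\<integral>\<^sup>+w. ennreal (exponential_density r w) * ennreal (poisson_weight (t - w) m) \<partial>lborel)
     = (\<integral>\<^sup>+w. ennreal (f w) * indicator {0..t} w \<partial>lborel)" by simp
  also have "\<dots> = ennreal (F t - F 0)"
  proof (rule nn_integral_FTC_Icc)
    show "f \<in> borel_measurable borel" unfolding f_def by measurable
    fix w assume w: "w \<in> {0..t}"
    have "DERIV F w :> - (r ^ Suc m * (- (real (Suc m) * (t - w) ^ m)) / fact (Suc m) * exp (- (r * t)))"
      unfolding F_def by (auto intro!: derivative_eq_intros simp del: fact_Suc power_Suc of_nat_Suc)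
    also have "- (r ^ Suc m * (- (real (Suc m) * (t - w) ^ m)) / fact (Suc m) * exp (- (r * t))) = f w"
      unfolding f_def fact_Suc by (simp del: of_nat_Suc)
    finally show "DERIV F w :> f w" .
    show "0 \<le> f w" using w r_pos unfolding f_def by simp
  qed (use False in simp)
  also have "F t - F 0 = poisson_weight t (Suc m)"
    using False by (simp add: F_def poisson_weight_def power_mult_distrib)
  finally show ?thesis .
qed

text \<open>The number of epochs up to time \<open>t\<close> has the Poisson law of mean \<open>r
  t\<close>, by conditioning on the first waiting time.\<close>

lemma poisson_count:
  "(\<integral>\<^sup>+\<omega>. indicator (Collect (in_step t m)) (smap fst \<omega>) \<partial>\<Omega>) = ennreal (poisson_weight t m)"
proof (induction m arbitrary: t)
  case 0
  interpret W: prob_space wait_law by (rule prob_wait)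
  interpret prob_space \<Omega> by (rule prob_clock)
  have "(\<integral>\<^sup>+\<omega>. indicator (Collect (in_step t 0)) (smap fst \<omega>) \<partial>\<Omega>)
      = (\<integral>\<^sup>+w. (\<integral>\<^sup>+\<omega>. indicator (Collect (in_step t 0)) (w ## smap fst \<omega>) \<partial>\<Omega>) \<partial>wait_law)"
    by (rule nn_integral_waits_step) measurable
  also have "\<dots> = (\<integral>\<^sup>+w. (if t < 0 then 0 else indicator {t<..} w) \<partial>wait_law)"
    by (intro nn_integral_cong) (auto simp: in_step_def epoch_def indicator_def emeasure_space_1)
  also have "\<dots> = (if t < 0 then 0 else emeasure wait_law {t<..})"
    by simp
  also have "\<dots> = ennreal (poisson_weight t 0)"
  proof (cases "t < 0")
    case False
    have "{t<..} = space wait_law - {..t}" by auto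
    then have "emeasure wait_law {t<..} = emeasure wait_law (space wait_law) - emeasure wait_law {..t}"
      by (simp only:) (intro emeasure_compl; simp)
    also have "\<dots> = 1 - ennreal (erlang_CDF 0 r t)"
      using W.emeasure_space_1 emeasure_erlang_density[OF r_pos, of 0 t] by simp
    also have "\<dots> = ennreal (exp (- (r * t)))"
      using False r_pos by (simp add: erlang_CDF_def ennreal_1[symmetric] ennreal_minus del: ennreal_1)
    finally show ?thesis using False by (simp add: poisson_weight_def)
  qed (simp add: poisson_weight_def)
  finally show ?case .
next
  case (Suc m)
  have "(\<integral>\<^sup>+\<omega>. indicator (Collect (in_step t (Suc m))) (smap fst \<omega>) \<partial>\<Omega>)
      = (\<integral>\<^sup>+w. (\<integral>\<^sup>+\<omega>. indicator (Collect (in_step t (Suc m))) (w ## smap fst \<omega>) \<partial>\<Omega>) \<partial>wait_law)"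
    by (rule nn_integral_waits_step) measurable
  also have "\<dots> = (\<integral>\<^sup>+w. ennreal (poisson_weight (t - w) m) \<partial>wait_law)"
    by (simp add: indicator_def in_step_Stream Suc.IH[unfolded indicator_def, simplified])
  also have "\<dots> = ennreal (poisson_weight t (Suc m))"
    by (subst nn_integral_wait) (measurable, rule poisson_weight_convolution)
  finally show ?case .
qed

lemma mean_wait: "(\<integral>\<^sup>+\<omega>. ennreal (smap fst \<omega> !! m) \<partial>\<Omega>) = ennreal (1 / r)"
proof (induction m)
  case 0
  interpret prob_space \<Omega> by (rule prob_clock)
  have "(\<integral>\<^sup>+\<omega>. ennreal (smap fst \<omega> !! 0) \<partial>\<Omega>) = (\<integral>\<^sup>+w. (\<integral>\<^sup>+\<omega>. ennreal ((w ## smap fst \<omega>) !! 0) \<partial>\<Omega>) \<partial>wait_law)"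
    by (rule nn_integral_waits_step[of "\<lambda>s. ennreal (s !! 0)"]) measurable
  also have "\<dots> = (\<integral>\<^sup>+w. ennreal (exponential_density r w) * ennreal w \<partial>lborel)"
    by (simp add: emeasure_space_1 nn_integral_wait)
  also have "\<dots> = (\<integral>\<^sup>+w. ennreal (exponential_density r w * w ^ 1) \<partial>lborel)"
    using r_pos by (intro nn_integral_cong) (auto simp: exponential_density_def ennreal_mult[symmetric])
  also have "\<dots> = ennreal (1 / r)"
    using nn_integral_erlang_ith_moment[OF r_pos, of 0 1] by simp
  finally show ?case .
next
  case (Suc m)
  interpret prob_space wait_law by (rule prob_wait)
  have "(\<integral>\<^sup>+\<omega>. ennreal (smap fst \<omega> !! Suc m) \<partial>\<Omega>) = (\<integral>\<^sup>+w. (\<integral>\<^sup>+\<omega>. ennreal ((w ## smap fst \<omega>) !! Suc m) \<partial>\<Omega>) \<partial>wait_law)"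
    by (rule nn_integral_waits_step[of "\<lambda>s. ennreal (s !! Suc m)"]) measurable
  also have "\<dots> = (\<integral>\<^sup>+w. ennreal (1 / r) \<partial>wait_law)" using Suc by simp
  also have "\<dots> = ennreal (1 / r)" by (simp only: nn_integral_const emeasure_space_1) simp
  finally show ?case .
qed

lemma AE_waits_pos: "AE \<omega> in \<Omega>. \<forall>j. 0 < smap fst \<omega> !! j"
proof -
  interpret M: prob_space "wait_law \<Otimes>\<^sub>M measure_pmf p" by (rule prob_mark)
  interpret W: prob_space wait_law by (rule prob_wait)
  interpret P: pair_sigma_finite wait_law "measure_pmf p" ..
  have "AE x in wait_law \<Otimes>\<^sub>M measure_pmf p. 0 < fst x"
  proof (rule P.AE_pair_measure)
    have "AE w in wait_law. 0 < w"
    proof (subst AE_density)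
      have "AE w in lborel. w \<noteq> (0::real)" by (rule AE_lborel_singleton)
      then show "AE w in lborel. 0 < ennreal (exponential_density r w) \<longrightarrow> 0 < w"
        by eventually_elim (auto simp: exponential_density_def split: if_splits)
    qed simp
    then show "AE w in wait_law. AE e in measure_pmf p. 0 < fst (w, e)" by simp
  qed measurable
  then have "AE \<omega> in \<Omega>. stream_all (\<lambda>x. 0 < fst x) \<omega>"
    unfolding marked_clock_def by (intro M.AE_stream_all) measurable
  then show ?thesis by (simp add: stream_all_def del: stream_all_iff)
qed

text \<open>At time 0 the Poisson law degenerates to a point mass.\<close>

definition count_pmf :: "real \<Rightarrow> nat pmf" where
  "count_pmf t = (if t = 0 then return_pmf 0 else poisson_pmf (r * t))"

lemma pmf_count: "0 \<le> t \<Longrightarrow> pmf (count_pmf t) m = poisson_weight t m"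
  using r_pos by (cases "m = 0") (auto simp: count_pmf_def poisson_weight_def)

lemma set_count_pmf: "0 < t \<Longrightarrow> set_pmf (count_pmf t) = UNIV"
  using r_pos by (simp add: count_pmf_def)

end

lemma epoch_mono:
  assumes "\<forall>j. 0 < s !! j" "m \<le> m'"
  shows "epoch s m \<le> epoch s m'"
  unfolding epoch_def using assms by (intro sum_mono2) (auto intro: less_imp_le)

lemma in_step_unique:
  assumes pos: "\<forall>j. 0 < s !! j" and "in_step t m s" "in_step t m' s"
  shows "m = m'"
proof (rule ccontr)
  assume "m \<noteq> m'"
  then consider "Suc m \<le> m'" | "Suc m' \<le> m" by linarith
  then show False
    using epoch_mono[OF pos, of "Suc m" m'] epoch_mono[OF pos, of "Suc m'" m] assms(2,3)
    by cases (auto simp: in_step_def)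
qed

context marked_poisson
begin

text \<open>The Poisson weights sum to 1, so almost surely some number of epochs is reached by time
  \<open>t\<close>: the clock does not explode.\<close>

lemma AE_in_step:
  assumes "0 \<le> t"
  shows "AE \<omega> in \<Omega>. \<exists>m. in_step t m (smap fst \<omega>)"
proof -
  interpret prob_space \<Omega> by (rule prob_clock)
  let ?A = "{\<omega> \<in> space \<Omega>. \<exists>m. in_step t m (smap fst \<omega>)}"
  have "1 = (\<integral>\<^sup>+m. ennreal (pmf (count_pmf t) m) \<partial>count_space UNIV)" by (simp add: nn_integral_pmf)
  also have "\<dots> = (\<Sum>m. \<integral>\<^sup>+\<omega>. indicator (Collect (in_step t m)) (smap fst \<omega>) \<partial>\<Omega>)"
    by (simp add: nn_integral_count_space_nat pmf_count[OF assms] poisson_count)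
  also have "\<dots> = (\<integral>\<^sup>+\<omega>. (\<Sum>m. indicator (Collect (in_step t m)) (smap fst \<omega>)) \<partial>\<Omega>)"
    by (rule nn_integral_suminf[symmetric]) measurable
  also have "\<dots> \<le> (\<integral>\<^sup>+\<omega>. indicator ?A \<omega> \<partial>\<Omega>)"
  proof (rule nn_integral_mono_AE, use AE_waits_pos in eventually_elim)
    case (elim \<omega>)
    show ?case
    proof (cases "\<exists>m. in_step t m (smap fst \<omega>)")
      case True
      then obtain m where m: "in_step t m (smap fst \<omega>)" by blast
      have iff: "in_step t m' (smap fst \<omega>) \<longleftrightarrow> m' = m" for m'
        using in_step_unique[OF elim _ m] m by blast
      have "(\<lambda>m'. indicator (Collect (in_step t m')) (smap fst \<omega>)) = (\<lambda>m'. if m' = m then 1 else (0::ennreal))"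
        by (simp add: fun_eq_iff indicator_def iff)
      then have "(\<Sum>m'. indicator (Collect (in_step t m')) (smap fst \<omega>)) = (1::ennreal)"
        using sums_single[of m "\<lambda>_. 1::ennreal"] by (simp add: sums_iff)
      then show ?thesis using m by (auto simp: indicator_def)
    qed simp
  qed
  also have "\<dots> = emeasure \<Omega> ?A" by (rule nn_integral_indicator) measurable
  finally have "emeasure \<Omega> ?A = 1" using emeasure_le_1[of ?A] by (rule antisym[rotated])
  then have "AE \<omega> in \<Omega>. \<omega> \<in> ?A" by (intro AE_prob_1) (simp add: measure_def)
  then show ?thesis by simp
qed

text \<open>One exceptional null set serves all times, as it suffices to reach every natural
  number.\<close>

lemma AE_clock:
  "AE \<omega> in \<Omega>. (\<forall>j. 0 < smap fst \<omega> !! j) \<and> (\<forall>t\<ge>0. \<exists>m. in_step t m (smap fst \<omega>))"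
proof -
  have "AE \<omega> in \<Omega>. \<forall>k::nat. \<exists>m. in_step (real k) m (smap fst \<omega>)"
    by (simp add: AE_all_countable AE_in_step)
  with AE_waits_pos show ?thesis
  proof eventually_elim
    case (elim \<omega>)
    let ?s = "smap fst \<omega>"
    have "\<exists>m. in_step t m ?s" if t: "0 \<le> t" for t
    proof -
      obtain k :: nat where k: "t \<le> real k" using real_arch_simple by blast
      obtain m where "in_step (real k) m ?s" using elim by blast
      then have ex: "t < epoch ?s (Suc m)" using k by (simp add: in_step_def)
      define m0 where "m0 = (LEAST m. t < epoch ?s m)"
      have m0: "t < epoch ?s m0" unfolding m0_def using ex by (rule LeastI)
      then have "m0 \<noteq> 0" using t by (auto intro: ccontr)
      then obtain m1 where m1: "m0 = Suc m1" by (cases m0) auto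
      have "\<not> t < epoch ?s m1" using not_less_Least[of m1 "\<lambda>m. t < epoch ?s m"] m1 unfolding m0_def by simp
      then show ?thesis using m0 m1 by (auto simp: in_step_def not_less)
    qed
    then show ?case using elim by blast
  qed
qed

end

lemma num_events_in_step:
  assumes pos: "\<forall>j. 0 < smap fst \<omega> !! j" and m: "in_step t m (smap fst \<omega>)"
  shows "num_events \<omega> t = m"
proof -
  have "(\<Sum>j\<le>k. fst (\<omega> !! j)) = epoch (smap fst \<omega>) (Suc k)" for k
    by (simp add: epoch_def lessThan_Suc_atMost)
  moreover have "epoch (smap fst \<omega>) (Suc k) \<le> t \<longleftrightarrow> k < m" for k
    using epoch_mono[OF pos, of "Suc k" m] epoch_mono[OF pos, of "Suc m" "Suc k"] m
    by (cases "k < m") (auto simp: in_step_def)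
  ultimately have "{k. (\<Sum>j\<le>k. fst (\<omega> !! j)) \<le> t} = {..<m}" by auto
  then show ?thesis by (simp add: num_events_def)
qed

locale event_clock = marked_poisson r p for r :: real and p :: "event pmf"
begin

definition events_pmf :: "real \<Rightarrow> event list pmf" where
  "events_pmf t = bind_pmf (count_pmf t) (\<lambda>m. replicate_pmf m p)"

lemma measurable_num_events [measurable]: "(\<lambda>\<omega>. num_events \<omega> t) \<in> \<Omega> \<rightarrow>\<^sub>M count_space UNIV"
proof -
  have eq: "num_events \<omega> t = card {m. epoch (smap fst \<omega>) (Suc m) \<le> t}" for \<omega>
    by (simp add: num_events_def epoch_def lessThan_Suc_atMost)
  show ?thesis unfolding eq by measurable
qed

lemma measurable_events_until [measurable]:
  "(\<lambda>\<omega>. map snd (stake (num_events \<omega> t) \<omega>)) \<in> \<Omega> \<rightarrow>\<^sub>M count_space UNIV"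
proof -
  have "(\<lambda>\<omega>. stake (num_events \<omega> t) (smap snd \<omega>)) \<in> \<Omega> \<rightarrow>\<^sub>M count_space UNIV"
    by (rule measurable_compose_countable[where f = "\<lambda>m \<omega>. stake m (smap snd \<omega>)"]) measurable
  then show ?thesis by simp
qed

text \<open>Almost surely \<open>in_step t m\<close> holds for exactly one \<open>m\<close>, a
  condition on the waiting times alone, and the first \<open>m\<close> events are independent of
  it.\<close>

lemma events_law:
  assumes t: "0 \<le> t"
  shows "measure \<Omega> {\<omega> \<in> space \<Omega>. Q (map snd (stake (num_events \<omega> t) \<omega>))}
    = measure_pmf.prob (events_pmf t) {es. Q es}"
proof -
  interpret prob_space \<Omega> by (rule prob_clock)
  let ?B = "{\<omega> \<in> space \<Omega>. Q (map snd (stake (num_events \<omega> t) \<omega>))}"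
  let ?I = "\<lambda>m. indicator (Collect (in_step t m)) :: real stream \<Rightarrow> ennreal"
  let ?J = "indicator {es. Q es} :: event list \<Rightarrow> ennreal"
  have B: "?B = (\<lambda>\<omega>. map snd (stake (num_events \<omega> t) \<omega>)) -` {es. Q es} \<inter> space \<Omega>" by auto
  have [measurable]: "?B \<in> sets \<Omega>"
    unfolding B by (rule measurable_sets[OF measurable_events_until]) simp
  have [measurable]: "(\<lambda>\<omega>. ?J (stake m (smap snd \<omega>))) \<in> borel_measurable \<Omega>" for m
    by (rule measurable_compose[OF measurable_marks]) simp
  have "emeasure \<Omega> ?B = (\<integral>\<^sup>+\<omega>. indicator ?B \<omega> \<partial>\<Omega>)"
    by (rule nn_integral_indicator[symmetric]) fact
  also have "\<dots> = (\<integral>\<^sup>+\<omega>. (\<Sum>m. ?I m (smap fst \<omega>) * ?J (stake m (smap snd \<omega>))) \<partial>\<Omega>)"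
  proof (rule nn_integral_cong_AE, use AE_clock in eventually_elim)
    case (elim \<omega>)
    then obtain m where m: "in_step t m (smap fst \<omega>)" using t by blast
    have iff: "in_step t m' (smap fst \<omega>) \<longleftrightarrow> m' = m" for m'
      using in_step_unique[OF _ _ m] elim m by blast
    have "(\<lambda>m'. ?I m' (smap fst \<omega>) * ?J (stake m' (smap snd \<omega>))) = (\<lambda>m'. if m' = m then ?J (stake m' (smap snd \<omega>)) else 0)"
      by (simp add: fun_eq_iff indicator_def iff)
    then have "(\<Sum>m'. ?I m' (smap fst \<omega>) * ?J (stake m' (smap snd \<omega>))) = ?J (stake m (smap snd \<omega>))"
      using sums_single[of m "\<lambda>m'. ?J (stake m' (smap snd \<omega>))"] by (simp add: sums_iff)
    also have "\<dots> = indicator ?B \<omega>"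
      using num_events_in_step[OF _ m] elim by (auto simp: indicator_def)
    finally show ?case by simp
  qed
  also have "\<dots> = (\<Sum>m. \<integral>\<^sup>+\<omega>. ?I m (smap fst \<omega>) * ?J (stake m (smap snd \<omega>)) \<partial>\<Omega>)"
    by (rule nn_integral_suminf) measurable
  also have "\<dots> = (\<Sum>m. ennreal (pmf (count_pmf t) m) * emeasure (replicate_pmf m p) {es. Q es})"
    by (subst waits_indep_marks) (measurable, simp add: poisson_count pmf_count[OF t])
  also have "\<dots> = emeasure (events_pmf t) {es. Q es}"
    by (simp add: events_pmf_def nn_integral_measure_pmf nn_integral_count_space_nat)
  finally show ?thesis by (simp add: measure_def)
qed

end

section \<open>Occupancy and the relabelling of servers\<close>

text \<open>The set \<open>G\<close> contains the differences of queue lengths at which the coin may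
  send the job to the longer queue: an initial segment for the scheme with threshold, everything for
  the scheme without.\<close>

definition po2_rule :: "real set \<Rightarrow> dispatcher" where
  "po2_rule G q a b coin =
     (if q a = q b then min a b
      else if \<bar>real (q a) - real (q b)\<bar> \<in> G \<and> coin then longer q a b
      else shorter q a b)"

lemma po2_g_eps_eq: "po2_g_eps g = po2_rule {..g}"
  by (simp add: fun_eq_iff po2_g_eps_def po2_rule_def)

lemma po2_eps_eq: "po2_eps = po2_rule UNIV"
  by (simp add: fun_eq_iff po2_eps_def po2_rule_def)

lemma po2_rule_cases: "po2_rule G q a b coin = a \<or> po2_rule G q a b coin = b"
  by (auto simp: po2_rule_def longer_def shorter_def min_def)

lemma po2_rule_swap: "po2_rule G q a b coin = po2_rule G q b a coin"
  by (auto simp: po2_rule_def longer_def shorter_def min_def abs_minus_commute)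

text \<open>Away from ties the rule only looks at queue lengths, so it commutes with relabellings of
  the servers.\<close>

lemma po2_rule_comp:
  "q (\<sigma> a) \<noteq> q (\<sigma> b) \<Longrightarrow> po2_rule G q (\<sigma> a) (\<sigma> b) coin = \<sigma> (po2_rule G (q \<circ> \<sigma>) a b coin)"
  by (auto simp: po2_rule_def longer_def shorter_def)

definition server_pairs :: "nat \<Rightarrow> (nat \<times> nat) set" where
  "server_pairs n = {(a, b). 1 \<le> a \<and> a < b \<and> b \<le> n}"

lemma finite_server_pairs [simp]: "finite (server_pairs n)"
  by (rule finite_subset[of _ "{1..n} \<times> {1..n}"]) (auto simp: server_pairs_def)

lemma server_pairs_nonempty: "2 \<le> n \<Longrightarrow> server_pairs n \<noteq> {}"
proof -
  assume "2 \<le> n"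
  then have "(1, 2) \<in> server_pairs n" by (simp add: server_pairs_def)
  then show ?thesis by blast
qed

definition total_jobs :: "nat \<Rightarrow> (nat \<Rightarrow> nat) \<Rightarrow> nat" where
  "total_jobs n q = (\<Sum>k=1..n. q k)"

lemma occupancy_permute:
  assumes "\<sigma> permutes {1..n}"
  shows "occupancy n (q \<circ> \<sigma>) = occupancy n q"
proof
  fix i
  have "bij_betw \<sigma> {k \<in> {1..n}. i \<le> (q \<circ> \<sigma>) k} {k \<in> {1..n}. i \<le> q k}"
  proof (rule bij_betwI')
    fix y assume y: "y \<in> {k \<in> {1..n}. i \<le> q k}"
    then obtain x where "x \<in> {1..n}" "y = \<sigma> x" using permutes_image[OF assms] by blast
    then show "\<exists>x\<in>{k \<in> {1..n}. i \<le> (q \<circ> \<sigma>) k}. y = \<sigma> x" using y by auto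
  qed (use permutes_in_image[OF assms] permutes_inj[OF assms] in \<open>auto simp: inj_eq\<close>)
  then show "occupancy n (q \<circ> \<sigma>) i = occupancy n q i"
    using bij_betw_same_card unfolding occupancy_def by fastforce
qed

text \<open>The occupancy determines how many servers have each queue length, that is, the multiset
  of queue lengths.\<close>

lemma occupancy_eq_imp_permutation:
  assumes n: "0 < n" and q: "q \<in> queue_states n" "q' \<in> queue_states n"
    and eq: "occupancy n q = occupancy n q'"
  obtains \<sigma> where "\<sigma> permutes {1..n}" "q = q' \<circ> \<sigma>"
proof -
  have ge: "card {k \<in> {1..n}. i \<le> q k} = card {k \<in> {1..n}. i \<le> q' k}" for i
    using fun_cong[OF eq, of i] n by (simp add: occupancy_def)
  have split: "card {k \<in> {1..n}. p k = i} = card {k \<in> {1..n}. i \<le> p k} - card {k \<in> {1..n}. Suc i \<le> p k}"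
    for p :: "nat \<Rightarrow> nat" and i
  proof -
    have "{k \<in> {1..n}. p k = i} = {k \<in> {1..n}. i \<le> p k} - {k \<in> {1..n}. Suc i \<le> p k}" by auto
    then have "card {k \<in> {1..n}. p k = i} = card ({k \<in> {1..n}. i \<le> p k} - {k \<in> {1..n}. Suc i \<le> p k})"
      by (rule arg_cong)
    also have "\<dots> = card {k \<in> {1..n}. i \<le> p k} - card {k \<in> {1..n}. Suc i \<le> p k}"
      by (rule card_Diff_subset) auto
    finally show ?thesis .
  qed
  have cnt: "count (image_mset p (mset_set {1..n})) i = card {k \<in> {1..n}. p k = i}" for p :: "nat \<Rightarrow> nat" and i
  proof -
    have "count (image_mset p (mset_set {1..n})) i = (\<Sum>x | x \<in> {1..n} \<and> i = p x. count (mset_set {1..n}) x)"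
      unfolding count_image_mset' by simp
    also have "\<dots> = (\<Sum>x | x \<in> {1..n} \<and> i = p x. 1)" by (intro sum.cong) auto
    also have "\<dots> = card {x. x \<in> {1..n} \<and> i = p x}" by simp
    also have "{x. x \<in> {1..n} \<and> i = p x} = {k \<in> {1..n}. p k = i}" by auto
    finally show ?thesis .
  qed
  have "image_mset q (mset_set {1..n}) = image_mset q' (mset_set {1..n})"
    by (rule multiset_eqI) (simp only: cnt split ge)
  then obtain \<sigma> where \<sigma>: "\<sigma> permutes {1..n}" "\<forall>x\<in>{1..n}. q x = q' (\<sigma> x)"
    by (rule image_mset_eq_implies_permutes[rotated]) auto
  moreover have "q x = q' (\<sigma> x)" if "x \<notin> {1..n}" for x
    using that q \<sigma>(1) by (simp add: queue_states_def permutes_not_in)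
  ultimately show thesis using that by (metis comp_apply ext)
qed

text \<open>This is what makes the tie-breaking rule invisible in the occupancy.\<close>

lemma occupancy_update_tie:
  assumes "q k = q l" "k \<in> {1..n}" "l \<in> {1..n}"
  shows "occupancy n (q(k := v)) = occupancy n (q(l := v))"
proof -
  have "q(k := v) = q(l := v) \<circ> Transposition.transpose k l"
    using assms(1) by (auto simp: fun_eq_iff Transposition.transpose_def)
  then show ?thesis
    using occupancy_permute[OF permutes_swap_id[OF assms(2,3)]] by simp
qed

lemma sum_occupancy:
  "(\<Sum>i. ennreal (occupancy n q (Suc i))) = ennreal (real (total_jobs n q) / real n)"
proof -
  define B where "B = (\<Sum>k=1..n. q k)"
  have le: "q k \<le> B" if "k \<in> {1..n}" for k
    unfolding B_def using that by (intro member_le_sum) auto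
  have zero: "occupancy n q (Suc i) = 0" if "i \<notin> {..<B}" for i
  proof -
    have "{k \<in> {1..n}. Suc i \<le> q k} = {}" using le that by force
    then show ?thesis unfolding occupancy_def by (simp only: card.empty)
  qed
  have "(\<Sum>i. ennreal (occupancy n q (Suc i))) = (\<Sum>i<B. ennreal (occupancy n q (Suc i)))"
    by (rule suminf_finite) (auto simp: zero)
  also have "\<dots> = ennreal (\<Sum>i<B. occupancy n q (Suc i))"
    by (rule sum_ennreal) (simp add: occupancy_def)
  also have "(\<Sum>i<B. occupancy n q (Suc i)) = (\<Sum>i<B. \<Sum>k=1..n. of_bool (Suc i \<le> q k)) / real n"
    by (simp add: occupancy_def sum_divide_distrib of_bool_def sum.If_cases Int_def)
  also have "(\<Sum>i<B. \<Sum>k=1..n. of_bool (Suc i \<le> q k)) = (\<Sum>k=1..n. \<Sum>i<B. of_bool (Suc i \<le> q k) :: real)"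
    by (rule sum.swap)
  also have "\<dots> = (\<Sum>k=1..n. real (q k))"
  proof (rule sum.cong)
    fix k assume "k \<in> {1..n}"
    then have "{i. i < B \<and> Suc i \<le> q k} = {..<q k}" using le[of k] by auto
    then show "(\<Sum>i<B. of_bool (Suc i \<le> q k)) = real (q k)"
      by (simp add: of_bool_def sum.If_cases Int_def)
  qed simp
  finally show ?thesis by (simp add: total_jobs_def)
qed

lemma total_jobs_eq_of_occupancy:
  assumes "0 < n" "occupancy n q = occupancy n q'"
  shows "total_jobs n q = total_jobs n q'"
  using sum_occupancy[of n q] sum_occupancy[of n q'] assms by (simp add: ennreal_inj)

section \<open>The jump chain and its projection to the occupancy\<close>

locale po2 =
  fixes G :: "real set" and n :: nat and lam \<epsilon> :: real
  assumes n2: "2 \<le> n" and lam_pos: "0 < lam" and eps0: "0 \<le> \<epsilon>" and eps1: "\<epsilon> \<le> 1"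
begin

abbreviation "D \<equiv> po2_rule G"
abbreviation "E \<equiv> event_pmf n lam \<epsilon>"
abbreviation "X \<equiv> queue_states n"
abbreviation "occ \<equiv> occupancy n"
abbreviation "idle \<equiv> (\<lambda>_. 0 :: nat)"

definition jump :: "(nat \<Rightarrow> nat) \<Rightarrow> (nat \<Rightarrow> nat) pmf" where
  "jump q = map_pmf (\<lambda>e. apply_event D e q) E"

lemma arrival_prob: "0 < lam / (1 + lam)" "lam / (1 + lam) < 1"
  using lam_pos by auto

lemma set_events:
  "set_pmf E \<subseteq> {Arrival a b c | a b c. (a, b) \<in> server_pairs n} \<union> Completion ` {1..n}"
proof
  fix e assume "e \<in> set_pmf E"
  moreover have "set_pmf (pmf_of_set (server_pairs n)) = server_pairs n"
    by (rule set_pmf_of_set[OF server_pairs_nonempty[OF n2] finite_server_pairs])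
  moreover have "set_pmf (pmf_of_set {1..n}) = {1..n}"
    using n2 by (intro set_pmf_of_set) auto
  ultimately show "e \<in> {Arrival a b c | a b c. (a, b) \<in> server_pairs n} \<union> Completion ` {1..n}"
    unfolding event_pmf_def server_pairs_def[symmetric] set_bind_pmf by (auto split: if_splits)
qed

lemma completion_in_events: "k \<in> {1..n} \<Longrightarrow> Completion k \<in> set_pmf E"
  using n2 arrival_prob
  by (auto simp: event_pmf_def server_pairs_def[symmetric] set_pmf_bernoulli intro!: bexI[of _ False])

lemma idle_state [simp]: "idle \<in> X"
  by (simp add: queue_states_def)

lemma event_closed:
  assumes "q \<in> X" "e \<in> set_pmf E"
  shows "apply_event D e q \<in> X"
proof -
  have "e \<in> {Arrival a b c | a b c. (a, b) \<in> server_pairs n} \<union> Completion ` {1..n}"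
    by (rule subsetD[OF set_events assms(2)])
  then show ?thesis
  proof safe
    fix a b c assume "(a, b) \<in> server_pairs n"
    then show "apply_event D (Arrival a b c) q \<in> X"
      using assms(1) po2_rule_cases[of G q a b c] by (auto simp: queue_states_def server_pairs_def Let_def)
  qed (use assms(1) in \<open>auto simp: queue_states_def\<close>)
qed

lemma jump_closed: "q \<in> X \<Longrightarrow> set_pmf (jump q) \<subseteq> X"
  using event_closed by (auto simp: jump_def)

lemma total_jobs_eq_0_iff: "q \<in> X \<Longrightarrow> total_jobs n q = 0 \<longleftrightarrow> q = idle"
  by (auto simp: total_jobs_def queue_states_def fun_eq_iff)

lemma occ_eq_idle_iff: "q \<in> X \<Longrightarrow> occ q = occ idle \<longleftrightarrow> q = idle"
  using total_jobs_eq_of_occupancy[of n q idle] total_jobs_eq_0_iff n2 by (auto simp: total_jobs_def)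

text \<open>Serve the jobs one by one, with no arrival in between.\<close>

lemma idle_reachable: "q \<in> X \<Longrightarrow> idle \<in> set_pmf (iterate jump (total_jobs n q) q)"
proof (induction "total_jobs n q" arbitrary: q)
  case 0
  then have "q = idle" using total_jobs_eq_0_iff[of q] by simp
  then show ?case by (simp add: total_jobs_def)
next
  case (Suc m)
  then have "q \<noteq> idle" by (auto simp: total_jobs_def)
  then obtain k where k0: "q k \<noteq> 0" by (auto simp: fun_eq_iff)
  then have "k \<in> {1..n}" using Suc.prems by (rule_tac ccontr) (simp add: queue_states_def)
  note k = k0 this
  let ?q = "apply_event D (Completion k) q"
  have "total_jobs n q = q k + (\<Sum>j\<in>{1..n}-{k}. q j)"
    unfolding total_jobs_def using k(2) by (intro sum.remove) simp_all
  moreover have "total_jobs n ?q = q k - 1 + (\<Sum>j\<in>{1..n}-{k}. q j)"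
  proof -
    have "total_jobs n ?q = ?q k + (\<Sum>j\<in>{1..n}-{k}. ?q j)"
      unfolding total_jobs_def using k(2) by (intro sum.remove) simp_all
    also have "(\<Sum>j\<in>{1..n}-{k}. ?q j) = (\<Sum>j\<in>{1..n}-{k}. q j)" by (intro sum.cong) auto
    also have "?q k = q k - 1" by simp
    finally show ?thesis .
  qed
  ultimately have "m = total_jobs n ?q" using Suc.hyps(2) k by simp
  moreover have "?q \<in> X" by (rule event_closed[OF Suc.prems completion_in_events[OF k(2)]])
  ultimately have "idle \<in> set_pmf (iterate jump m ?q)" using Suc.hyps(1) by metis
  moreover have "?q \<in> set_pmf (jump q)"
    unfolding jump_def set_map_pmf by (rule imageI[OF completion_in_events[OF k(2)]])
  ultimately show ?case unfolding Suc.hyps(2)[symmetric] by auto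
qed

text \<open>Arrivals carry the sampled pair in increasing order, hence the minimum and the
  maximum.\<close>

fun relabel :: "(nat \<Rightarrow> nat) \<Rightarrow> event \<Rightarrow> event" where
  "relabel \<sigma> (Arrival a b coin) = Arrival (min (\<sigma> a) (\<sigma> b)) (max (\<sigma> a) (\<sigma> b)) coin"
| "relabel \<sigma> (Completion k) = Completion (\<sigma> k)"

lemma relabel_events:
  assumes \<sigma>: "\<sigma> permutes {1..n}"
  shows "map_pmf (relabel \<sigma>) E = E"
proof -
  let ?f = "\<lambda>(a, b). (min (\<sigma> a) (\<sigma> b), max (\<sigma> a) (\<sigma> b))"
  have inj: "inj_on ?f (server_pairs n)"
  proof (rule inj_onI, clarify)
    fix a b a' b'
    assume ab: "(a, b) \<in> server_pairs n" "(a', b') \<in> server_pairs n"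
      and eq: "min (\<sigma> a) (\<sigma> b) = min (\<sigma> a') (\<sigma> b')" "max (\<sigma> a) (\<sigma> b) = max (\<sigma> a') (\<sigma> b')"
    have "(\<sigma> a = \<sigma> a' \<and> \<sigma> b = \<sigma> b') \<or> (\<sigma> a = \<sigma> b' \<and> \<sigma> b = \<sigma> a')"
      using eq by (auto simp: min_def max_def split: if_splits)
    then have "(a = a' \<and> b = b') \<or> (a = b' \<and> b = a')" using permutes_inj[OF \<sigma>] by (auto simp: inj_eq)
    then show "a = a' \<and> b = b'" using ab by (auto simp: server_pairs_def)
  qed
  have sub: "?f ` server_pairs n \<subseteq> server_pairs n"
  proof clarify
    fix a b assume ab: "(a, b) \<in> server_pairs n"
    then have "\<sigma> a \<in> {1..n}" "\<sigma> b \<in> {1..n}" "\<sigma> a \<noteq> \<sigma> b"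
      using permutes_in_image[OF \<sigma>] permutes_inj[OF \<sigma>] by (auto simp: server_pairs_def inj_eq)
    then show "(min (\<sigma> a) (\<sigma> b), max (\<sigma> a) (\<sigma> b)) \<in> server_pairs n"
      by (auto simp: server_pairs_def min_def max_def)
  qed
  have "bij_betw ?f (server_pairs n) (server_pairs n)"
    unfolding bij_betw_def using inj endo_inj_surj[OF finite_server_pairs sub inj] by blast
  then have pairs: "map_pmf ?f (pmf_of_set (server_pairs n)) = pmf_of_set (server_pairs n)"
    using server_pairs_nonempty[OF n2] by (intro map_pmf_of_set_bij_betw) auto
  have servers: "map_pmf \<sigma> (pmf_of_set {1..n}) = pmf_of_set {1..n}"
    using n2 permutes_imp_bij[OF \<sigma>] by (intro map_pmf_of_set_bij_betw) auto
  have arr: "map_pmf (relabel \<sigma>) (bind_pmf (pmf_of_set (server_pairs n)) (\<lambda>(a, b). map_pmf (Arrival a b) (bernoulli_pmf \<epsilon>)))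
      = bind_pmf (map_pmf ?f (pmf_of_set (server_pairs n))) (\<lambda>(a, b). map_pmf (Arrival a b) (bernoulli_pmf \<epsilon>))"
    by (simp add: map_bind_pmf bind_map_pmf case_prod_unfold pmf.map_comp comp_def)
  have compl: "map_pmf (relabel \<sigma>) (map_pmf Completion (pmf_of_set {1..n})) = map_pmf Completion (map_pmf \<sigma> (pmf_of_set {1..n}))"
    by (simp add: pmf.map_comp comp_def)
  have "map_pmf (relabel \<sigma>) (if is_arrival
        then bind_pmf (pmf_of_set (server_pairs n)) (\<lambda>(a, b). map_pmf (Arrival a b) (bernoulli_pmf \<epsilon>))
        else map_pmf Completion (pmf_of_set {1..n}))
    = (if is_arrival
        then bind_pmf (pmf_of_set (server_pairs n)) (\<lambda>(a, b). map_pmf (Arrival a b) (bernoulli_pmf \<epsilon>))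
        else map_pmf Completion (pmf_of_set {1..n}))" for is_arrival
    using arr compl unfolding pairs servers by (cases is_arrival) (simp_all only: if_True if_False)
  then show ?thesis
    unfolding event_pmf_def server_pairs_def[symmetric] map_bind_pmf[of _ "bernoulli_pmf (lam / (1 + lam))"]
    by (intro bind_pmf_cong refl)
qed

lemma occ_relabel_event:
  assumes \<sigma>: "\<sigma> permutes {1..n}" and e: "e \<in> set_pmf E"
  shows "occ (apply_event D e (q \<circ> \<sigma>)) = occ (apply_event D (relabel \<sigma> e) q)"
proof -
  have upd: "(q \<circ> \<sigma>)(k := v) = q(\<sigma> k := v) \<circ> \<sigma>" for k v
    using permutes_inj[OF \<sigma>] by (auto simp: fun_eq_iff inj_eq)
  have "e \<in> {Arrival a b c | a b c. (a, b) \<in> server_pairs n} \<union> Completion ` {1..n}"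
    by (rule subsetD[OF set_events e])
  then show ?thesis
  proof safe
    fix k
    show "occ (apply_event D (Completion k) (q \<circ> \<sigma>)) = occ (apply_event D (relabel \<sigma> (Completion k)) q)"
      unfolding apply_event.simps upd occupancy_permute[OF \<sigma>] by simp
  next
    fix a b c assume ab: "(a, b) \<in> server_pairs n"
    let ?d = "D (q \<circ> \<sigma>) a b c" and ?d' = "D q (\<sigma> a) (\<sigma> b) c"
    have d': "D q (min (\<sigma> a) (\<sigma> b)) (max (\<sigma> a) (\<sigma> b)) c = ?d'"
      by (auto simp: min_def max_def po2_rule_swap)
    have "occ (q(\<sigma> ?d := q (\<sigma> ?d) + 1)) = occ (q(?d' := q ?d' + 1))"
    proof (cases "q (\<sigma> a) = q (\<sigma> b)")
      case True
      have d: "?d = a \<or> ?d = b" "?d' = \<sigma> a \<or> ?d' = \<sigma> b" by (rule po2_rule_cases)+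
      have tie: "q (\<sigma> ?d) = q (\<sigma> a)" "q ?d' = q (\<sigma> a)" using True d by metis+
      have "a \<in> {1..n}" "b \<in> {1..n}" using ab by (auto simp: server_pairs_def)
      then have "\<sigma> ?d \<in> {1..n}" "?d' \<in> {1..n}" using d permutes_in_image[OF \<sigma>] by metis+
      then have "occ (q(\<sigma> ?d := v)) = occ (q(?d' := v))" for v
        using tie by (intro occupancy_update_tie) simp_all
      then show ?thesis by (simp only: tie)
    next
      case False
      have "?d' = \<sigma> ?d" by (rule po2_rule_comp[where q = q and \<sigma> = \<sigma> and a = a and b = b, OF False])
      then show ?thesis by (simp only:)
    qed
    then show "occ (apply_event D (Arrival a b c) (q \<circ> \<sigma>)) = occ (apply_event D (relabel \<sigma> (Arrival a b c)) q)"
      unfolding apply_event.simps relabel.simps Let_def d' upd occupancy_permute[OF \<sigma>] by simp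
  qed
qed

text \<open>The occupancy is a Markov function of the queue lengths: one step from \<open>q' \<circ>
  \<sigma>\<close> with event \<open>e\<close> gives the occupancy of one step from
  \<open>q'\<close> with the relabelled event, and relabelling preserves the law of events.\<close>

lemma occ_jump_cong:
  assumes "q \<in> X" "q' \<in> X" "occ q = occ q'"
  shows "map_pmf occ (jump q) = map_pmf occ (jump q')"
proof -
  obtain \<sigma> where \<sigma>: "\<sigma> permutes {1..n}" "q = q' \<circ> \<sigma>"
    using occupancy_eq_imp_permutation[of n q q'] assms n2 by auto
  have "map_pmf occ (jump q) = map_pmf (\<lambda>e. occ (apply_event D e (q' \<circ> \<sigma>))) E"
    by (simp add: jump_def pmf.map_comp comp_def \<sigma>(2)[unfolded comp_def])
  also have "\<dots> = map_pmf (\<lambda>e. occ (apply_event D (relabel \<sigma> e) q')) E"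
    by (intro map_pmf_cong refl occ_relabel_event[OF \<sigma>(1)])
  also have "\<dots> = map_pmf (\<lambda>e. occ (apply_event D e q')) (map_pmf (relabel \<sigma>) E)"
    by (simp add: pmf.map_comp comp_def)
  also have "\<dots> = map_pmf occ (jump q')"
    by (simp add: relabel_events[OF \<sigma>(1)] jump_def pmf.map_comp comp_def)
  finally show ?thesis .
qed

definition representative :: "(nat \<Rightarrow> real) \<Rightarrow> nat \<Rightarrow> nat" where
  "representative x = (SOME q. q \<in> X \<and> occ q = x)"

lemma representative:
  assumes "x \<in> occ ` X"
  shows "representative x \<in> X" "occ (representative x) = x"
  using someI_ex[of "\<lambda>q. q \<in> X \<and> occ q = x"] assms unfolding representative_def by auto

text \<open>The kernel of the occupancy chain; by \<open>occ_jump_cong\<close> the choice of the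
  representative is immaterial.\<close>

definition occ_jump :: "(nat \<Rightarrow> real) \<Rightarrow> (nat \<Rightarrow> real) pmf" where
  "occ_jump x = map_pmf occ (jump (representative x))"

lemma occ_jump: "q \<in> X \<Longrightarrow> occ_jump (occ q) = map_pmf occ (jump q)"
  unfolding occ_jump_def by (intro occ_jump_cong representative) auto

lemma iterate_occ_jump: "q \<in> X \<Longrightarrow> iterate occ_jump m (occ q) = map_pmf occ (iterate jump m q)"
proof (induction m arbitrary: q)
  case (Suc m)
  have "iterate occ_jump (Suc m) (occ q) = bind_pmf (jump q) (\<lambda>q'. iterate occ_jump m (occ q'))"
    by (simp add: occ_jump[OF Suc.prems] bind_map_pmf)
  also have "\<dots> = bind_pmf (jump q) (\<lambda>q'. map_pmf occ (iterate jump m q'))"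
    using jump_closed[OF Suc.prems] by (intro bind_pmf_cong refl Suc.IH) auto
  finally show ?case by (simp add: map_bind_pmf)
qed simp

lemma subordinate_occ_jump:
  "q \<in> X \<Longrightarrow> subordinate c occ_jump (occ q) = map_pmf occ (subordinate c jump q)"
  by (simp add: subordinate_def iterate_occ_jump map_bind_pmf)

lemma invariant_occ_jump:
  assumes "invariant jump \<mu>" "set_pmf \<mu> \<subseteq> X"
  shows "invariant occ_jump (map_pmf occ \<mu>)"
proof -
  have "bind_pmf (map_pmf occ \<mu>) occ_jump = bind_pmf \<mu> (\<lambda>q. map_pmf occ (jump q))"
    unfolding bind_map_pmf using assms(2) by (intro bind_pmf_cong refl occ_jump) auto
  also have "\<dots> = map_pmf occ (bind_pmf \<mu> jump)" by (simp add: map_bind_pmf)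
  finally show ?thesis using assms(1) by (simp add: invariant_def)
qed

lemma avoid_occ_jump: "q \<in> X \<Longrightarrow> avoid occ_jump A m (occ q) = avoid jump (occ -` A) m q"
proof (induction m arbitrary: q)
  case (Suc m)
  have "(\<integral>\<^sup>+y. avoid occ_jump A m y \<partial>occ_jump (occ q)) = (\<integral>\<^sup>+q'. avoid occ_jump A m (occ q') \<partial>jump q)"
    by (simp add: occ_jump[OF Suc.prems])
  also have "\<dots> = (\<integral>\<^sup>+q'. avoid jump (occ -` A) m q' \<partial>jump q)"
    using jump_closed[OF Suc.prems] Suc.IH by (intro nn_integral_cong_AE) (auto simp: AE_measure_pmf_iff)
  finally show ?case by (simp add: indicator_def)
qed (simp add: indicator_def)

lemma run_events: "map_pmf (\<lambda>es. fold (apply_event D) es q) (replicate_pmf m E) = iterate jump m q"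
proof (induction m arbitrary: q)
  case (Suc m)
  have "map_pmf (\<lambda>es. fold (apply_event D) es q) (replicate_pmf (Suc m) E)
      = bind_pmf E (\<lambda>e. map_pmf (\<lambda>es. fold (apply_event D) es (apply_event D e q)) (replicate_pmf m E))"
    by (simp add: map_bind_pmf) (simp add: map_pmf_def)
  also have "\<dots> = bind_pmf (jump q) (iterate jump m)"
    unfolding Suc.IH by (simp add: jump_def[of q] bind_map_pmf)
  also have "\<dots> = iterate jump (Suc m) q" by simp
  finally show ?case .
qed simp

sublocale event_clock "real n * lam + real n" E
  by unfold_locales (use n2 lam_pos in \<open>simp add: add_pos_pos\<close>)

lemma driver_eq: "driver n lam \<epsilon> = \<Omega>"
  by (simp add: driver_def marked_clock_def)

abbreviation "flow t \<equiv> subordinate (count_pmf t) jump"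
abbreviation "occ_flow t \<equiv> subordinate (count_pmf t) occ_jump"

lemma run_events_pmf: "map_pmf (\<lambda>es. fold (apply_event D) es q) (events_pmf t) = flow t q"
  by (simp add: events_pmf_def subordinate_def map_bind_pmf run_events)

lemma queue_trans_eq: "0 \<le> t \<Longrightarrow> queue_trans D n lam \<epsilon> t q q' = pmf (flow t q) q'"
  unfolding queue_trans_def queue_at_def driver_eq
  by (subst events_law[where Q = "\<lambda>es. fold (apply_event D) es q = q'"])
    (auto simp: run_events_pmf[symmetric] pmf_map vimage_def)

lemma occupancy_trans_eq:
  "0 \<le> t \<Longrightarrow> occupancy_trans D n lam \<epsilon> t q y = pmf (map_pmf occ (flow t q)) y"
  unfolding occupancy_trans_def occupancy_at_def queue_at_def driver_eq
  by (subst events_law[where Q = "\<lambda>es. occ (fold (apply_event D) es q) = y"])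
    (auto simp: run_events_pmf[symmetric] pmf_map vimage_def)

lemma queue_invariant_iff:
  "queue_invariant D n lam \<epsilon> \<mu> \<longleftrightarrow> set_pmf \<mu> \<subseteq> X \<and> (\<forall>t\<ge>0. invariant (flow t) \<mu>)"
  by (auto simp: queue_invariant_def invariant_def pmf_eq_iff pmf_bind queue_trans_eq)

text \<open>The quantification over all laws of \<open>Q(0)\<close> that realise
  \<open>\<pi>\<close> collapses: some such law exists, and the evolution of the occupancy is the
  same for all of them.\<close>

lemma occupancy_invariant_iff:
  "occupancy_invariant D n lam \<epsilon> \<pi> \<longleftrightarrow> set_pmf \<pi> \<subseteq> occ ` X \<and> (\<forall>t\<ge>0. invariant (occ_flow t) \<pi>)"
proof -
  have main: "(\<forall>y. measure_pmf.expectation \<mu> (\<lambda>q. occupancy_trans D n lam \<epsilon> t q y) = pmf \<pi> y)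
      \<longleftrightarrow> invariant (occ_flow t) \<pi>"
    if \<mu>: "set_pmf \<mu> \<subseteq> X" "map_pmf occ \<mu> = \<pi>" and t: "0 \<le> t" for \<mu> t
  proof -
    have "bind_pmf \<pi> (occ_flow t) = bind_pmf \<mu> (\<lambda>q. map_pmf occ (flow t q))"
      unfolding \<mu>(2)[symmetric] bind_map_pmf
      using \<mu>(1) by (intro bind_pmf_cong refl subordinate_occ_jump) auto
    then have "pmf (bind_pmf \<pi> (occ_flow t)) y = measure_pmf.expectation \<mu> (\<lambda>q. occupancy_trans D n lam \<epsilon> t q y)" for y
      by (simp only: pmf_bind occupancy_trans_eq[OF t])
    then show ?thesis unfolding invariant_def pmf_eq_iff by simp
  qed
  have lift: "\<exists>\<mu>. set_pmf \<mu> \<subseteq> X \<and> map_pmf occ \<mu> = \<pi>" if "set_pmf \<pi> \<subseteq> occ ` X"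
  proof (intro exI conjI)
    show "set_pmf (map_pmf representative \<pi>) \<subseteq> X" using representative(1) that by auto
    have "map_pmf occ (map_pmf representative \<pi>) = map_pmf id \<pi>"
      unfolding pmf.map_comp using that representative(2) by (intro map_pmf_cong) auto
    then show "map_pmf occ (map_pmf representative \<pi>) = \<pi>" by simp
  qed
  show ?thesis
  proof (cases "set_pmf \<pi> \<subseteq> occ ` X")
    case True
    obtain \<mu> where \<mu>: "set_pmf \<mu> \<subseteq> X" "map_pmf occ \<mu> = \<pi>" using lift[OF True] by blast
    show ?thesis unfolding occupancy_invariant_def
    proof (intro conj_cong refl iffI allI impI)
      fix t :: real
      assume all: "\<forall>\<mu>. set_pmf \<mu> \<subseteq> X \<and> map_pmf occ \<mu> = \<pi> \<longrightarrow>
          (\<forall>t\<ge>0. \<forall>y. measure_pmf.expectation \<mu> (\<lambda>q. occupancy_trans D n lam \<epsilon> t q y) = pmf \<pi> y)" and t: "0 \<le> t"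
      have "\<forall>y. measure_pmf.expectation \<mu> (\<lambda>q. occupancy_trans D n lam \<epsilon> t q y) = pmf \<pi> y"
        using all \<mu> t by simp
      then show "invariant (occ_flow t) \<pi>" using main[OF \<mu> t] by simp
    next
      fix \<mu>' y and t :: real
      assume "\<forall>t\<ge>0. invariant (occ_flow t) \<pi>" "set_pmf \<mu>' \<subseteq> X \<and> map_pmf occ \<mu>' = \<pi>" "0 \<le> t"
      then show "measure_pmf.expectation \<mu>' (\<lambda>q. occupancy_trans D n lam \<epsilon> t q y) = pmf \<pi> y"
        using main[of \<mu>' t] by simp
    qed
  qed (simp add: occupancy_invariant_def)
qed

text \<open>The Poisson number of steps takes every value with positive probability, which removes
  any question of periodicity: the skeleton at time 1 reaches the idle state in one step.\<close>

lemma idle_in_flow: "q \<in> X \<Longrightarrow> idle \<in> set_pmf (flow 1 q)"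
  using idle_reachable[of q] set_count_pmf[of 1] by (auto simp: subordinate_def)

lemma queue_invariant_unique:
  assumes "queue_invariant D n lam \<epsilon> \<mu>" "queue_invariant D n lam \<epsilon> \<nu>"
  shows "\<mu> = \<nu>"
  using assms unfolding queue_invariant_iff
  by (intro invariant_unique[of "flow 1" \<mu> \<nu> idle] idle_in_flow) auto

lemma occupancy_invariant_unique:
  assumes "occupancy_invariant D n lam \<epsilon> \<pi>" "occupancy_invariant D n lam \<epsilon> \<pi>'"
  shows "\<pi> = \<pi>'"
proof (rule invariant_unique[of "occ_flow 1" \<pi> \<pi>' "occ idle"])
  fix x assume "x \<in> set_pmf \<pi> \<union> set_pmf \<pi>'"
  then obtain q where "q \<in> X" "x = occ q" using assms unfolding occupancy_invariant_iff by auto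
  then show "occ idle \<in> set_pmf (occ_flow 1 x)"
    using idle_in_flow[of q] by (simp add: subordinate_occ_jump)
qed (use assms in \<open>auto simp: occupancy_invariant_iff\<close>)

lemma stationary_laws:
  assumes inv: "invariant jump \<mu>" "set_pmf \<mu> \<subseteq> X"
  shows "queue_invariant D n lam \<epsilon> \<mu>" "occupancy_invariant D n lam \<epsilon> (map_pmf occ \<mu>)"
  using inv invariant_subordinate[OF inv(1)] invariant_subordinate[OF invariant_occ_jump[OF inv]]
  unfolding queue_invariant_iff occupancy_invariant_iff by auto

end

section \<open>Drift of the jump chain\<close>

text \<open>Each server belongs to \<open>n - 1\<close> pairs.\<close>

lemma sum_server_pairs:
  fixes f :: "nat \<Rightarrow> real"
  assumes "1 \<le> n"
  shows "(\<Sum>(a, b)\<in>server_pairs n. f a + f b) = (real n - 1) * (\<Sum>k=1..n. f k)"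
  using assms
proof (induction n rule: nat_induct_at_least)
  case base
  have "server_pairs 1 = {}" by (auto simp: server_pairs_def)
  then show ?case by simp
next
  case (Suc n)
  have split: "server_pairs (Suc n) = server_pairs n \<union> (\<lambda>a. (a, Suc n)) ` {1..n}"
    by (auto simp: server_pairs_def)
  have "(\<Sum>(a, b)\<in>server_pairs (Suc n). f a + f b)
      = (\<Sum>(a, b)\<in>server_pairs n. f a + f b) + (\<Sum>(a, b)\<in>(\<lambda>a. (a, Suc n)) ` {1..n}. f a + f b)"
    unfolding split
    by (intro sum.union_disjoint finite_server_pairs finite_imageI finite_atLeastAtMost) (auto simp: server_pairs_def)
  also have "(\<Sum>(a, b)\<in>(\<lambda>a. (a, Suc n)) ` {1..n}. f a + f b) = (\<Sum>a=1..n. f a + f (Suc n))"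
    by (subst sum.reindex) (auto simp: inj_on_def)
  finally show ?case using Suc.IH by (simp add: sum.distrib algebra_simps)
qed

lemma card_server_pairs: "1 \<le> n \<Longrightarrow> real (card (server_pairs n)) = real n * (real n - 1) / 2"
  using sum_server_pairs[of n "\<lambda>_. 1 / 2"] by (simp add: case_prod_unfold algebra_simps)

context po2
begin

abbreviation "rate \<equiv> real n * lam + real n"

lemma rate_pos: "0 < rate"
  using r_pos by simp

lemma rate_eq: "rate = real n * (1 + lam)"
  by (simp add: algebra_simps)

lemma finite_events [simp]: "finite (set_pmf E)"
proof (rule finite_subset[OF set_events])
  have "{Arrival a b c | a b c. (a, b) \<in> server_pairs n} \<subseteq> (\<lambda>(x, c). Arrival (fst x) (snd x) c) ` (server_pairs n \<times> UNIV)"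
  proof clarify
    fix a b c assume "(a, b) \<in> server_pairs n"
    then show "Arrival a b c \<in> (\<lambda>(x, c). Arrival (fst x) (snd x) c) ` (server_pairs n \<times> UNIV)"
      by (intro image_eqI[of _ _ "((a, b), c)"]) auto
  qed
  then have "finite {Arrival a b c | a b c. (a, b) \<in> server_pairs n}"
    by (rule finite_subset) simp
  then show "finite ({Arrival a b c | a b c. (a, b) \<in> server_pairs n} \<union> Completion ` {1..n})"
    by simp
qed

text \<open>Written with the total rate as the common denominator, so that the numerator is the
  generator of the process in continuous time.\<close>

lemma expectation_events:
  fixes F :: "event \<Rightarrow> real"
  shows "measure_pmf.expectation E F =
    (2 * lam / (real n - 1) * (\<Sum>(a, b)\<in>server_pairs n. \<epsilon> * F (Arrival a b True) + (1 - \<epsilon>) * F (Arrival a b False))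
      + (\<Sum>k=1..n. F (Completion k))) / rate"
proof -
  let ?P = "bind_pmf (pmf_of_set (server_pairs n)) (\<lambda>(a, b). map_pmf (Arrival a b) (bernoulli_pmf \<epsilon>))"
  let ?Q = "map_pmf Completion (pmf_of_set {1..n})"
  let ?A = "\<Sum>(a, b)\<in>server_pairs n. \<epsilon> * F (Arrival a b True) + (1 - \<epsilon>) * F (Arrival a b False)"
  let ?C = "\<Sum>k=1..n. F (Completion k)"
  have ne: "server_pairs n \<noteq> {}" by (rule server_pairs_nonempty[OF n2])
  have finP: "finite (set_pmf ?P)" by (auto simp: ne set_pmf_of_set)
  have finQ: "finite (set_pmf ?Q)" using n2 by (simp add: set_pmf_of_set)
  have "measure_pmf.expectation ?P F = (\<Sum>(a, b)\<in>server_pairs n. (\<epsilon> * F (Arrival a b True) + (1 - \<epsilon>) * F (Arrival a b False)) /\<^sub>R real (card (server_pairs n)))"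
    by (subst pmf_expectation_bind_pmf_of_set)
      (auto simp: ne case_prod_unfold eps0 eps1 mult.commute)
  also have "\<dots> = ?A / real (card (server_pairs n))"
    by (simp add: case_prod_unfold sum_divide_distrib field_simps)
  finally have P: "measure_pmf.expectation ?P F = ?A / real (card (server_pairs n))" .
  have Q: "measure_pmf.expectation ?Q F = ?C / real n"
    using n2 by (simp add: integral_pmf_of_set)
  have "measure_pmf.expectation E F =
     (\<Sum>b\<in>UNIV. pmf (bernoulli_pmf (lam / (1 + lam))) b *\<^sub>R measure_pmf.expectation (if b then ?P else ?Q) F)"
    unfolding event_pmf_def server_pairs_def[symmetric]
    by (rule pmf_expectation_bind) (use finP finQ in auto)
  also have "\<dots> = lam / (1 + lam) * (?A / real (card (server_pairs n))) + (1 - lam / (1 + lam)) * (?C / real n)"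
    unfolding P[symmetric] Q[symmetric]
    using arrival_prob by (simp add: UNIV_bool del: integral_map_pmf)
  also have "\<dots> = (2 * lam / (real n - 1) * ?A + ?C) / rate"
  proof -
    have "lam / (1 + lam) * (?A / (real n * (real n - 1) / 2)) = 2 * lam / (real n - 1) * ?A / rate"
      unfolding rate_eq by (simp add: field_simps)
    moreover have "1 - lam / (1 + lam) = 1 / (1 + lam)" using lam_pos by (simp add: field_simps)
    moreover have "1 / (1 + lam) * (?C / real n) = ?C / rate" unfolding rate_eq by (simp add: field_simps)
    moreover have "real (card (server_pairs n)) = real n * (real n - 1) / 2" using n2 by (intro card_server_pairs) simp
    ultimately show ?thesis by (simp only: add_divide_distrib)
  qed
  finally show ?thesis .
qed

lemma nn_integral_jump:
  assumes "\<And>q. 0 \<le> V q"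
  shows "(\<integral>\<^sup>+q'. ennreal (V q') \<partial>jump q) = ennreal (measure_pmf.expectation E (\<lambda>e. V (apply_event D e q)))"
  unfolding jump_def
  by (simp add: nn_integral_eq_integral integrable_measure_pmf_finite assms)

lemma expectation_mono:
  fixes F F' :: "event \<Rightarrow> real"
  assumes "\<And>e. e \<in> set_pmf E \<Longrightarrow> F e \<le> F' e"
  shows "measure_pmf.expectation E F \<le> measure_pmf.expectation E F'"
  by (rule integral_mono_AE) (auto intro: integrable_measure_pmf_finite simp: AE_measure_pmf_iff assms)

lemma server_pairs_servers: "(a, b) \<in> server_pairs n \<Longrightarrow> a \<in> {1..n} \<and> b \<in> {1..n} \<and> a \<noteq> b"
  by (auto simp: server_pairs_def)

lemma dispatch_server: "(a, b) \<in> server_pairs n \<Longrightarrow> D q a b c \<in> {1..n}"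
  using server_pairs_servers[of a b] po2_rule_cases[of G q a b c] by metis

lemma sum_update:
  fixes f :: "nat \<Rightarrow> real"
  assumes "k \<in> {1..n}"
  shows "(\<Sum>j=1..n. f ((q(k := v)) j)) = (\<Sum>j=1..n. f (q j)) - f (q k) + f v"
proof -
  have "(\<Sum>j=1..n. f ((q(k := v)) j)) = f v + (\<Sum>j\<in>{1..n} - {k}. f (q j))"
    using assms by (subst sum.remove[of _ k]) (auto intro!: sum.cong)
  moreover have "(\<Sum>j=1..n. f (q j)) = f (q k) + (\<Sum>j\<in>{1..n} - {k}. f (q j))"
    using assms by (intro sum.remove) auto
  ultimately show ?thesis by simp
qed

lemma real_total: "real (total_jobs n q) = (\<Sum>j=1..n. real (q j))"
  by (simp add: total_jobs_def)

definition busy :: "(nat \<Rightarrow> nat) \<Rightarrow> real" where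
  "busy q = (\<Sum>k=1..n. of_bool (0 < q k))"

lemma busy_nonneg: "0 \<le> busy q"
  by (simp add: busy_def sum_nonneg)

lemma busy_le: "busy q \<le> real n"
proof -
  have "busy q \<le> (\<Sum>k=1..n. 1)" unfolding busy_def by (intro sum_mono) auto
  then show ?thesis by simp
qed

lemma busy_ge_1: "q \<in> X \<Longrightarrow> q \<noteq> idle \<Longrightarrow> 1 \<le> busy q"
proof -
  assume q: "q \<in> X" "q \<noteq> idle"
  then obtain k where k: "q k \<noteq> 0" by (auto simp: fun_eq_iff)
  then have "k \<in> {1..n}" using q(1) by (rule_tac ccontr) (simp add: queue_states_def)
  then have "(of_bool (0 < q k) :: real) \<le> busy q"
    unfolding busy_def by (intro member_le_sum) auto
  then show ?thesis using k by simp
qed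

lemma total_arrival:
  assumes "(a, b) \<in> server_pairs n"
  shows "total_jobs n (apply_event D (Arrival a b c) q) = total_jobs n q + 1"
proof -
  have "real (total_jobs n (apply_event D (Arrival a b c) q))
      = real (total_jobs n q) - real (q (D q a b c)) + real (q (D q a b c) + 1)"
    unfolding real_total apply_event.simps Let_def by (rule sum_update[OF dispatch_server[OF assms]])
  also have "\<dots> = real (total_jobs n q + 1)" by simp
  finally show ?thesis by (simp only: of_nat_eq_iff)
qed

lemma total_completion:
  assumes "k \<in> {1..n}"
  shows "total_jobs n (apply_event D (Completion k) q) = total_jobs n q - of_bool (0 < q k)"
    "0 < q k \<Longrightarrow> 0 < total_jobs n q"
proof -
  have "q k \<le> total_jobs n q" unfolding total_jobs_def using assms by (intro member_le_sum) auto
  then show "0 < q k \<Longrightarrow> 0 < total_jobs n q" by simp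
  have "real (total_jobs n (apply_event D (Completion k) q)) = real (total_jobs n q) - real (q k) + real (q k - 1)"
    unfolding real_total apply_event.simps by (rule sum_update[OF assms])
  then show "total_jobs n (apply_event D (Completion k) q) = total_jobs n q - of_bool (0 < q k)"
    using \<open>q k \<le> total_jobs n q\<close> by (cases "q k = 0") (auto simp: of_nat_diff)
qed

text \<open>The number of jobs is a birth-and-death process whose death rate is the number of busy
  servers.\<close>

lemma expectation_total:
  fixes \<phi> :: "nat \<Rightarrow> real"
  shows "measure_pmf.expectation E (\<lambda>e. \<phi> (total_jobs n (apply_event D e q)))
    = \<phi> (total_jobs n q) + (real n * lam * (\<phi> (total_jobs n q + 1) - \<phi> (total_jobs n q))
        + busy q * (\<phi> (total_jobs n q - 1) - \<phi> (total_jobs n q))) / rate"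
proof -
  let ?s = "total_jobs n q"
  have arr: "(\<Sum>(a, b)\<in>server_pairs n. \<epsilon> * \<phi> (total_jobs n (apply_event D (Arrival a b True) q))
        + (1 - \<epsilon>) * \<phi> (total_jobs n (apply_event D (Arrival a b False) q)))
      = (\<Sum>(a, b)\<in>server_pairs n. \<phi> (?s + 1))"
    by (intro sum.cong refl, clarify) (simp only: total_arrival, simp add: algebra_simps)
  have com: "(\<Sum>k=1..n. \<phi> (total_jobs n (apply_event D (Completion k) q)))
      = (\<Sum>k=1..n. \<phi> ?s + of_bool (0 < q k) * (\<phi> (?s - 1) - \<phi> ?s))"
    by (intro sum.cong refl) (subst total_completion, auto)
  have "measure_pmf.expectation E (\<lambda>e. \<phi> (total_jobs n (apply_event D e q)))
     = (2 * lam / (real n - 1) * (real (card (server_pairs n)) * \<phi> (?s + 1))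
        + (real n * \<phi> ?s + busy q * (\<phi> (?s - 1) - \<phi> ?s))) / rate"
    unfolding expectation_events arr com
    by (simp add: sum.distrib sum_distrib_right[symmetric] busy_def case_prod_unfold)
  also have "2 * lam / (real n - 1) * (real (card (server_pairs n)) * \<phi> (?s + 1)) = real n * lam * \<phi> (?s + 1)"
    using n2 by (simp add: card_server_pairs)
  also have "(real n * lam * \<phi> (?s + 1) + (real n * \<phi> ?s + busy q * (\<phi> (?s - 1) - \<phi> ?s))) / rate
     = (rate * \<phi> ?s + (real n * lam * (\<phi> (?s + 1) - \<phi> ?s) + busy q * (\<phi> (?s - 1) - \<phi> ?s))) / rate"
    by (simp add: algebra_simps)
  also have "\<dots> = \<phi> ?s + (real n * lam * (\<phi> (?s + 1) - \<phi> ?s) + busy q * (\<phi> (?s - 1) - \<phi> ?s)) / rate"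
    using rate_pos by (simp add: add_divide_distrib)
  finally show ?thesis .
qed

lemma drift_total:
  "measure_pmf.expectation E (\<lambda>e. real (total_jobs n (apply_event D e q)))
    = real (total_jobs n q) + (real n * lam - busy q) / rate"
proof -
  have "busy q * (real (total_jobs n q - 1) - real (total_jobs n q)) = - busy q"
  proof (cases "total_jobs n q = 0")
    case True
    then have "busy q = 0" by (auto simp: busy_def total_jobs_def)
    then show ?thesis by simp
  qed (simp add: of_nat_diff)
  then show ?thesis using expectation_total[of real q] by simp
qed

definition sum_squares :: "(nat \<Rightarrow> nat) \<Rightarrow> real" where
  "sum_squares q = (\<Sum>k=1..n. (real (q k))\<^sup>2)"

lemma sum_squares_nonneg: "0 \<le> sum_squares q"
  by (simp add: sum_squares_def sum_nonneg)

text \<open>A job that joins a queue of length \<open>x\<close> adds \<open>2 x + 1\<close> to the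
  sum of squares; a completion at a busy server with \<open>x\<close> jobs subtracts \<open>2 x -
  1\<close>. The mean of the two sampled queue lengths, averaged over all pairs, is the mean queue
  length.\<close>

lemma drift_sum_squares:
  assumes dispatch: "\<And>a b. (a, b) \<in> server_pairs n \<Longrightarrow>
      \<epsilon> * real (q (D q a b True)) + (1 - \<epsilon>) * real (q (D q a b False)) \<le> \<alpha> * (real (q a) + real (q b)) / 2 + \<beta>"
  shows "measure_pmf.expectation E (\<lambda>e. sum_squares (apply_event D e q))
    \<le> sum_squares q + (real n * lam * (2 * \<beta> + 1) + busy q - 2 * (1 - \<alpha> * lam) * real (total_jobs n q)) / rate"
proof -
  let ?V = "sum_squares q" and ?s = "real (total_jobs n q)"
  have sq: "(x + 1)\<^sup>2 = x\<^sup>2 + 2 * x + 1" for x :: real by (simp add: power2_eq_square algebra_simps)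
  have arr1: "sum_squares (apply_event D (Arrival a b c) q) = ?V + 2 * real (q (D q a b c)) + 1"
    if "(a, b) \<in> server_pairs n" for a b c
    using sum_update[OF dispatch_server[OF that], of "\<lambda>x. (real x)\<^sup>2" q q c "q (D q a b c) + 1"]
    by (simp only: apply_event.simps Let_def sum_squares_def of_nat_add of_nat_1 sq)
  have com1: "sum_squares (apply_event D (Completion k) q) = ?V - 2 * real (q k) + of_bool (0 < q k)"
    if "k \<in> {1..n}" for k
    using sum_update[OF that, of "\<lambda>x. (real x)\<^sup>2" q "q k - 1"]
    by (cases "q k = 0") (auto simp: sum_squares_def of_nat_diff power2_diff)
  have "(\<Sum>(a, b)\<in>server_pairs n. \<epsilon> * sum_squares (apply_event D (Arrival a b True) q)
        + (1 - \<epsilon>) * sum_squares (apply_event D (Arrival a b False) q))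
      \<le> (\<Sum>(a, b)\<in>server_pairs n. (?V + 2 * \<beta> + 1) + (\<alpha> * real (q a) + \<alpha> * real (q b)))"
  proof (intro sum_mono, clarify)
    fix a b assume ab: "(a, b) \<in> server_pairs n"
    show "\<epsilon> * sum_squares (apply_event D (Arrival a b True) q)
        + (1 - \<epsilon>) * sum_squares (apply_event D (Arrival a b False) q)
        \<le> (?V + 2 * \<beta> + 1) + (\<alpha> * real (q a) + \<alpha> * real (q b))"
      unfolding arr1[OF ab] using dispatch[OF ab] by (simp add: field_simps)
  qed
  also have "\<dots> = real (card (server_pairs n)) * (?V + 2 * \<beta> + 1) + (real n - 1) * (\<alpha> * ?s)"
    using sum_server_pairs[of n "\<lambda>a. \<alpha> * real (q a)"] n2
    by (simp add: case_prod_unfold sum.distrib real_total sum_distrib_left)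
  finally have "2 * lam / (real n - 1) * (\<Sum>(a, b)\<in>server_pairs n. \<epsilon> * sum_squares (apply_event D (Arrival a b True) q)
        + (1 - \<epsilon>) * sum_squares (apply_event D (Arrival a b False) q))
      \<le> 2 * lam / (real n - 1) * (real (card (server_pairs n)) * (?V + 2 * \<beta> + 1) + (real n - 1) * (\<alpha> * ?s))"
    using n2 lam_pos by (intro mult_left_mono) auto
  also have "\<dots> = real n * lam * (?V + 2 * \<beta> + 1) + 2 * lam * (\<alpha> * ?s)"
    using n2 by (simp add: card_server_pairs field_simps)
  finally have arr: "2 * lam / (real n - 1) * (\<Sum>(a, b)\<in>server_pairs n. \<epsilon> * sum_squares (apply_event D (Arrival a b True) q)
        + (1 - \<epsilon>) * sum_squares (apply_event D (Arrival a b False) q))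
      \<le> real n * lam * (?V + 2 * \<beta> + 1) + 2 * lam * (\<alpha> * ?s)" .
  have com: "(\<Sum>k=1..n. sum_squares (apply_event D (Completion k) q)) = real n * ?V - 2 * ?s + busy q"
  proof -
    have "(\<Sum>k=1..n. sum_squares (apply_event D (Completion k) q)) = (\<Sum>k=1..n. ?V - 2 * real (q k) + of_bool (0 < q k))"
      by (intro sum.cong refl com1)
    then show ?thesis by (simp add: sum.distrib sum_subtractf real_total sum_distrib_left busy_def)
  qed
  have "measure_pmf.expectation E (\<lambda>e. sum_squares (apply_event D e q))
     \<le> (real n * lam * (?V + 2 * \<beta> + 1) + 2 * lam * (\<alpha> * ?s) + (real n * ?V - 2 * ?s + busy q)) / rate"
    unfolding expectation_events com using arr rate_pos by (intro divide_right_mono add_right_mono) auto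
  also have "\<dots> = (rate * ?V + (real n * lam * (2 * \<beta> + 1) + busy q - 2 * (1 - \<alpha> * lam) * ?s)) / rate"
    by (simp add: algebra_simps)
  also have "\<dots> = ?V + (real n * lam * (2 * \<beta> + 1) + busy q - 2 * (1 - \<alpha> * lam) * ?s) / rate"
    using rate_pos by (simp add: add_divide_distrib)
  finally show ?thesis .
qed

text \<open>The drift of the sum of squares is negative only where many jobs are present. The
  bounded function \<open>1 - r ^ total_jobs n q\<close>, with \<open>r\<close> small, has negative
  drift in every state but the idle one, because a completion of rate at least 1 outweighs the
  arrivals. A large multiple of it takes care of the finitely many remaining numbers of
  jobs.\<close>

lemma stable_invariant_exists:
  assumes dispatch: "\<And>q a b. (a, b) \<in> server_pairs n \<Longrightarrow>
      \<epsilon> * real (q (D q a b True)) + (1 - \<epsilon>) * real (q (D q a b False)) \<le> \<alpha> * (real (q a) + real (q b)) / 2 + \<beta>"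
    and stable: "\<alpha> * lam < 1" and \<beta>: "0 \<le> \<beta>"
  shows "\<exists>\<mu>. invariant jump \<mu> \<and> set_pmf \<mu> \<subseteq> X"
proof -
  define \<delta> where "\<delta> = 1 - \<alpha> * lam"
  define C where "C = real n * lam * (2 * \<beta> + 1) + real n"
  \<comment> \<open>This choice gives \<open>n lam r \<le> 1/2\<close>: after weighting by powers of \<open>r\<close>, arrivals offset at most half of one completion.\<close>
  define r where "r = 1 / (1 + 2 * (real n * lam))"
  \<comment> \<open>With at least \<open>s0\<close> jobs the sum of squares alone has drift at most \<open>-1\<close>; with fewer jobs the factor \<open>A\<close> makes the geometric part pay for it.\<close>
  define s0 where "s0 = nat \<lceil>(C + 1) / (2 * \<delta>)\<rceil>"
  define A where "A = 2 * (C + 1) * rate / ((1 - r) * r ^ s0)"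
  define W where "W q = rate * sum_squares q + A * (1 - r ^ total_jobs n q)" for q
  have \<delta>: "0 < \<delta>" using stable by (simp add: \<delta>_def)
  have C: "0 < C" unfolding C_def using n2 lam_pos \<beta> by (intro add_nonneg_pos) auto
  have nl: "0 < real n * lam" using n2 lam_pos by simp
  have r: "0 < r" "r < 1" "real n * lam * r \<le> 1 / 2"
    unfolding r_def using nl by (auto simp: field_simps)
  have A: "0 < A" unfolding A_def using r C rate_pos by simp
  have W0: "0 \<le> W q" for q
    unfolding W_def using A r rate_pos by (simp add: sum_squares_nonneg power_le_one)
  have geo: "measure_pmf.expectation E (\<lambda>e. 1 - r ^ total_jobs n (apply_event D e q))
      \<le> 1 - r ^ total_jobs n q - (1 - r) * r ^ total_jobs n q / (2 * rate)" if q: "q \<in> X" "q \<noteq> idle" for q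
  proof -
    obtain s where s: "total_jobs n q = Suc s" using total_jobs_eq_0_iff[OF q(1)] q(2) by (cases "total_jobs n q") auto
    define u where "u = r ^ s - r ^ Suc s"
    have u: "0 \<le> u" unfolding u_def using r by (simp add: mult_left_le_one_le)
    have arith: "T1 + T2 \<le> - (T3 / 2)" if "T1 \<le> 1 / 2 * u" "T2 \<le> - u" "T3 \<le> u" for T1 T2 T3 :: real
      using that by linarith
    have "real n * lam * (r ^ Suc s - r ^ Suc (Suc s)) + busy q * (r ^ Suc s - r ^ s) \<le> - ((1 - r) * r ^ Suc s / 2)"
    proof (rule arith)
      have "real n * lam * (r ^ Suc s - r ^ Suc (Suc s)) = (real n * lam * r) * u"
        by (simp add: u_def algebra_simps)
      also have "\<dots> \<le> 1 / 2 * u" using r(3) u by (rule mult_right_mono)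
      finally show "real n * lam * (r ^ Suc s - r ^ Suc (Suc s)) \<le> 1 / 2 * u" .
      have "1 * u \<le> busy q * u" using busy_ge_1[OF q] u by (rule mult_right_mono)
      then show "busy q * (r ^ Suc s - r ^ s) \<le> - u" by (simp add: u_def algebra_simps)
      have "(1 - r) * r ^ Suc s = r * u" by (simp add: u_def algebra_simps)
      also have "\<dots> \<le> 1 * u" using r u by (intro mult_right_mono) auto
      finally show "(1 - r) * r ^ Suc s \<le> u" by simp
    qed
    then have "(real n * lam * (r ^ Suc s - r ^ Suc (Suc s)) + busy q * (r ^ Suc s - r ^ s)) / rate \<le> - ((1 - r) * r ^ Suc s / 2) / rate"
      using rate_pos by (intro divide_right_mono) auto
    then show ?thesis using expectation_total[of "\<lambda>s. 1 - r ^ s" q] by (simp add: s)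
  qed
  have EW: "measure_pmf.expectation E (\<lambda>e. W (apply_event D e q))
      = rate * measure_pmf.expectation E (\<lambda>e. sum_squares (apply_event D e q))
        + A * measure_pmf.expectation E (\<lambda>e. 1 - r ^ total_jobs n (apply_event D e q))" for q
    unfolding W_def by (subst Bochner_Integration.integral_add) (auto intro: integrable_measure_pmf_finite)
  have drift: "measure_pmf.expectation E (\<lambda>e. W (apply_event D e q)) + 1 \<le> W q" if q: "q \<in> X" "q \<noteq> idle" for q
  proof -
    let ?s = "total_jobs n q"
    have "rate * measure_pmf.expectation E (\<lambda>e. sum_squares (apply_event D e q))
       \<le> rate * (sum_squares q + (real n * lam * (2 * \<beta> + 1) + busy q - 2 * (1 - \<alpha> * lam) * real ?s) / rate)"
      using rate_pos by (intro mult_left_mono drift_sum_squares dispatch) auto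
    also have "\<dots> = rate * sum_squares q + (real n * lam * (2 * \<beta> + 1) + busy q - 2 * \<delta> * real ?s)"
      using rate_pos by (simp add: distrib_left \<delta>_def)
    also have "\<dots> \<le> rate * sum_squares q + C - 2 * \<delta> * real ?s"
      using busy_le[of q] by (simp add: C_def)
    finally have V: "rate * measure_pmf.expectation E (\<lambda>e. sum_squares (apply_event D e q)) \<le> rate * sum_squares q + C - 2 * \<delta> * real ?s" .
    have "A * measure_pmf.expectation E (\<lambda>e. 1 - r ^ total_jobs n (apply_event D e q))
       \<le> A * (1 - r ^ ?s - (1 - r) * r ^ ?s / (2 * rate))"
      using A by (intro mult_left_mono geo[OF q]) auto
    also have "\<dots> = A * (1 - r ^ ?s) - A * ((1 - r) * r ^ ?s / (2 * rate))" by (simp add: right_diff_distrib)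
    finally have H: "A * measure_pmf.expectation E (\<lambda>e. 1 - r ^ total_jobs n (apply_event D e q))
       \<le> A * (1 - r ^ ?s) - A * ((1 - r) * r ^ ?s / (2 * rate))" .
    have "C + 1 \<le> 2 * \<delta> * real ?s + A * ((1 - r) * r ^ ?s / (2 * rate))"
    proof (cases "s0 \<le> ?s")
      case True
      have "(C + 1) / (2 * \<delta>) \<le> real s0" unfolding s0_def by (rule real_nat_ceiling_ge)
      also have "\<dots> \<le> real ?s" using True by simp
      finally have "C + 1 \<le> 2 * \<delta> * real ?s" using \<delta> by (simp add: field_simps)
      moreover have "0 \<le> A * ((1 - r) * r ^ ?s / (2 * rate))" using A r rate_pos by simp
      ultimately show ?thesis by linarith
    next
      case False
      have cancel: "c = 2 * c * x / y * (y / (2 * x))" if "x \<noteq> 0" "y \<noteq> 0" for c x y :: real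
        using that by simp
      have "C + 1 = A * ((1 - r) * r ^ s0 / (2 * rate))"
        unfolding A_def by (rule cancel) (use r rate_pos in auto)
      also have "\<dots> \<le> A * ((1 - r) * r ^ ?s / (2 * rate))"
        using False A r rate_pos by (intro mult_left_mono divide_right_mono power_decreasing) auto
      finally show ?thesis using \<delta> by (simp add: add_increasing)
    qed
    with V H show ?thesis unfolding EW unfolding W_def by linarith
  qed
  show ?thesis
  proof (rule invariant_exists_if_drift[of idle X jump "\<lambda>q. ennreal (W q)"])
    fix q assume q: "q \<in> X" "q \<noteq> idle"
    have "0 \<le> measure_pmf.expectation E (\<lambda>e. W (apply_event D e q))" by (simp add: W0)
    then have "(\<integral>\<^sup>+q'. ennreal (W q') \<partial>jump q) + 1 = ennreal (measure_pmf.expectation E (\<lambda>e. W (apply_event D e q)) + 1)"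
      unfolding nn_integral_jump[of W, OF W0] by (simp add: ennreal_plus)
    also have "\<dots> \<le> ennreal (W q)" by (rule ennreal_leI[OF drift[OF q]])
    finally show "(\<integral>\<^sup>+q'. ennreal (W q') \<partial>jump q) + 1 \<le> ennreal (W q)" .
  qed (use jump_closed in \<open>auto simp: nn_integral_jump[of W, OF W0]\<close>)
qed

text \<open>Balance of flow: in the stationary state jobs leave at most as fast as they
  arrive.\<close>

lemma mean_busy_le:
  assumes "invariant jump \<mu>"
  shows "(\<integral>\<^sup>+q. ennreal (busy q) \<partial>\<mu>) \<le> ennreal (real n * lam)"
proof -
  have "(\<integral>\<^sup>+q. ennreal (busy q) \<partial>\<mu>) \<le> (\<integral>\<^sup>+q. ennreal (real n * lam) \<partial>\<mu>)"
  proof (rule invariant_drift_bound[OF assms, of "\<lambda>q. rate * real (total_jobs n q)"])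
    fix q
    have "(\<integral>\<^sup>+q'. ennreal (rate * real (total_jobs n q')) \<partial>jump q) = ennreal (rate * (real (total_jobs n q) + (real n * lam - busy q) / rate))"
      using rate_pos by (subst nn_integral_jump) (auto simp: drift_total)
    also have "rate * (real (total_jobs n q) + (real n * lam - busy q) / rate) = rate * real (total_jobs n q) + real n * lam - busy q"
      using rate_pos by (simp add: distrib_left)
    finally have *: "(\<integral>\<^sup>+q'. ennreal (rate * real (total_jobs n q')) \<partial>jump q) = ennreal (rate * real (total_jobs n q) + real n * lam - busy q)" .
    have "0 \<le> rate * real (total_jobs n q) + real n * lam - busy q"
    proof -
      have "0 \<le> measure_pmf.expectation E (\<lambda>e. real (total_jobs n (apply_event D e q)))" by simp
      then have "0 \<le> rate * (real (total_jobs n q) + (real n * lam - busy q) / rate)"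
        using rate_pos by (simp only: drift_total mult_nonneg_nonneg less_imp_le)
      then show ?thesis using rate_pos by (simp add: distrib_left)
    qed
    then show "(\<integral>\<^sup>+q'. ennreal (rate * real (total_jobs n q')) \<partial>jump q) + ennreal (busy q) \<le> ennreal (rate * real (total_jobs n q)) + ennreal (real n * lam)"
      unfolding * using rate_pos lam_pos busy_nonneg[of q] by (simp add: ennreal_plus[symmetric] del: ennreal_plus)
  qed
  then show ?thesis by simp
qed

text \<open>The busy servers contribute at most \<open>n lam\<close> to the drift of the sum of
  squares, by \<open>mean_busy_le\<close>; the crude bound \<open>n\<close> would give a weaker
  constant.\<close>

lemma mean_total_le:
  assumes inv: "invariant jump \<mu>"
    and dispatch: "\<And>q a b. (a, b) \<in> server_pairs n \<Longrightarrow>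
      \<epsilon> * real (q (D q a b True)) + (1 - \<epsilon>) * real (q (D q a b False)) \<le> \<alpha> * (real (q a) + real (q b)) / 2 + \<beta>"
    and stable: "\<alpha> * lam < 1" and \<beta>: "0 \<le> \<beta>"
  shows "(\<integral>\<^sup>+q. ennreal (real (total_jobs n q) / real n) \<partial>\<mu>) \<le> ennreal ((1 + \<beta>) * lam / (1 - \<alpha> * lam))"
proof -
  define \<delta> where "\<delta> = 1 - \<alpha> * lam"
  have \<delta>: "0 < \<delta>" using stable by (simp add: \<delta>_def)
  define c where "c = real n * lam * (2 * \<beta> + 1)"
  have c: "0 \<le> c" unfolding c_def using n2 lam_pos \<beta> by auto
  have "(\<integral>\<^sup>+q. ennreal (2 * \<delta> * real (total_jobs n q)) \<partial>\<mu>) \<le> (\<integral>\<^sup>+q. ennreal c + ennreal (busy q) \<partial>\<mu>)"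
  proof (rule invariant_drift_bound[OF inv, of "\<lambda>q. rate * sum_squares q"])
    fix q
    let ?EV = "measure_pmf.expectation E (\<lambda>e. sum_squares (apply_event D e q))"
    have "rate * ?EV \<le> rate * (sum_squares q + (c + busy q - 2 * \<delta> * real (total_jobs n q)) / rate)"
      unfolding c_def \<delta>_def using rate_pos by (intro mult_left_mono drift_sum_squares dispatch) auto
    also have "\<dots> = rate * sum_squares q + c + busy q - 2 * \<delta> * real (total_jobs n q)"
      using rate_pos by (simp add: distrib_left)
    finally have le: "rate * ?EV + 2 * \<delta> * real (total_jobs n q) \<le> rate * sum_squares q + c + busy q" by simp
    have "(\<integral>\<^sup>+q'. ennreal (rate * sum_squares q') \<partial>jump q) = ennreal (rate * ?EV)"
      using rate_pos by (subst nn_integral_jump) (auto simp: sum_squares_nonneg)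
    then have "(\<integral>\<^sup>+q'. ennreal (rate * sum_squares q') \<partial>jump q) + ennreal (2 * \<delta> * real (total_jobs n q))
       = ennreal (rate * ?EV + 2 * \<delta> * real (total_jobs n q))"
      using rate_pos \<delta> by (simp add: ennreal_plus sum_squares_nonneg)
    also have "\<dots> \<le> ennreal (rate * sum_squares q + c + busy q)" by (rule ennreal_leI[OF le])
    also have "\<dots> = ennreal (rate * sum_squares q) + (ennreal c + ennreal (busy q))"
      using rate_pos c by (simp add: ennreal_plus sum_squares_nonneg busy_nonneg add.assoc)
    finally show "(\<integral>\<^sup>+q'. ennreal (rate * sum_squares q') \<partial>jump q) + ennreal (2 * \<delta> * real (total_jobs n q))
       \<le> ennreal (rate * sum_squares q) + (ennreal c + ennreal (busy q))" .
  qed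
  also have "\<dots> \<le> ennreal c + ennreal (real n * lam)"
    using mean_busy_le[OF inv] by (simp add: nn_integral_add add_left_mono)
  also have "\<dots> = ennreal (2 * real n * lam * (1 + \<beta>))"
    unfolding c_def using n2 lam_pos \<beta> by (simp add: ennreal_plus[symmetric] algebra_simps del: ennreal_plus)
  finally have main: "(\<integral>\<^sup>+q. ennreal (2 * \<delta> * real (total_jobs n q)) \<partial>\<mu>) \<le> ennreal (2 * real n * lam * (1 + \<beta>))" .
  define k where "k = 1 / (2 * \<delta> * real n)"
  have k: "0 \<le> k" unfolding k_def using \<delta> by simp
  have "(\<integral>\<^sup>+q. ennreal (real (total_jobs n q) / real n) \<partial>\<mu>) = (\<integral>\<^sup>+q. ennreal k * ennreal (2 * \<delta> * real (total_jobs n q)) \<partial>\<mu>)"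
    using \<delta> n2 k by (intro nn_integral_cong) (simp add: ennreal_mult[symmetric] k_def)
  also have "\<dots> = ennreal k * (\<integral>\<^sup>+q. ennreal (2 * \<delta> * real (total_jobs n q)) \<partial>\<mu>)" by (rule nn_integral_cmult) simp
  also have "\<dots> \<le> ennreal k * ennreal (2 * real n * lam * (1 + \<beta>))" by (intro mult_left_mono main) simp
  also have "\<dots> = ennreal (k * (2 * real n * lam * (1 + \<beta>)))"
    using k n2 lam_pos \<beta> by (intro ennreal_mult[symmetric]) auto
  also have "k * (2 * real n * lam * (1 + \<beta>)) = (1 + \<beta>) * lam / \<delta>"
    unfolding k_def using \<delta> n2 by (simp add: field_simps)
  finally show ?thesis by (simp only: \<delta>_def)
qed

lemma total_submartingale:
  assumes "1 \<le> lam"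
  shows "ennreal (real (total_jobs n q)) \<le> (\<integral>\<^sup>+q'. ennreal (real (total_jobs n q')) \<partial>jump q)"
proof -
  have "real n \<le> real n * lam" using mult_left_mono[OF assms, of "real n"] by simp
  then have "0 \<le> (real n * lam - busy q) / rate" using busy_le[of q] rate_pos by simp
  then show ?thesis by (subst nn_integral_jump) (auto simp: drift_total intro!: ennreal_leI)
qed

lemma event_cases:
  assumes "e \<in> set_pmf E"
  obtains a b c where "e = Arrival a b c" "(a, b) \<in> server_pairs n"
  | k where "e = Completion k" "k \<in> {1..n}"
  using subsetD[OF set_events assms] by auto

lemma event_total_cases:
  assumes "e \<in> set_pmf E"
  shows "apply_event D e q = q \<or> total_jobs n (apply_event D e q) \<noteq> total_jobs n q"
    "total_jobs n (apply_event D e q) \<le> total_jobs n q + 1"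
proof -
  from assms have "(apply_event D e q = q \<or> total_jobs n (apply_event D e q) \<noteq> total_jobs n q)
     \<and> total_jobs n (apply_event D e q) \<le> total_jobs n q + 1"
  proof (cases rule: event_cases)
    case (1 a b c)
    then show ?thesis using total_arrival[OF 1(2), of c q] by (simp del: apply_event.simps)
  next
    case (2 k)
    show ?thesis
    proof (cases "q k = 0")
      case True
      then have "q(k := q k - 1) = q" by (simp add: fun_eq_iff)
      then show ?thesis using 2 by simp
    next
      case False
      then show ?thesis using total_completion[OF 2(2), of q] 2 by (simp del: apply_event.simps) linarith
    qed
  qed
  then show "apply_event D e q = q \<or> total_jobs n (apply_event D e q) \<noteq> total_jobs n q"
    "total_jobs n (apply_event D e q) \<le> total_jobs n q + 1" by auto
qed

definition longest :: "(nat \<Rightarrow> nat) \<Rightarrow> nat" where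
  "longest q = Max (q ` {1..n})"

lemma longest_ge: "k \<in> {1..n} \<Longrightarrow> q k \<le> longest q"
  by (simp add: longest_def)

lemma longest_attained: "\<exists>k\<in>{1..n}. q k = longest q"
proof -
  have "longest q \<in> q ` {1..n}" unfolding longest_def using n2 by (intro Max_in) auto
  then show ?thesis by auto
qed

lemma longest_event_le:
  assumes "e \<in> set_pmf E"
  shows "longest (apply_event D e q) \<le> longest q + 1"
proof -
  obtain k where k: "k \<in> {1..n}" "apply_event D e q k = longest (apply_event D e q)"
    using longest_attained by metis
  from assms have "apply_event D e q k \<le> q k + 1"
    by (cases rule: event_cases) (auto simp: Let_def)
  then show ?thesis using k(2) longest_ge[OF k(1), of q] by simp
qed

text \<open>If two queues are longest, no completion lowers the maximum. If server \<open>k\<close>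
  alone is longest, the \<open>n - 1\<close> pairs that contain \<open>k\<close> raise it at rate
  \<open>2 \<epsilon> lam\<close>, against completions of rate 1.\<close>

lemma longest_submartingale:
  assumes G: "G = UNIV" and lam: "1 \<le> 2 * \<epsilon> * lam"
  shows "ennreal (real (longest q)) \<le> (\<integral>\<^sup>+q'. ennreal (real (longest q')) \<partial>jump q)"
proof -
  obtain k where k: "k \<in> {1..n}" "q k = longest q" using longest_attained by blast
  define F where "F e = real (longest q) + (case e of
      Arrival a b c \<Rightarrow> of_bool (c \<and> a = k) + of_bool (c \<and> b = k)
    | Completion j \<Rightarrow> - of_bool (j = k))" for e
  have "real (longest q) \<le> measure_pmf.expectation E (\<lambda>e. real (longest (apply_event D e q)))"
  proof (cases "\<exists>l\<in>{1..n}. l \<noteq> k \<and> q l = longest q")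
    case True
    then obtain l where l: "l \<in> {1..n}" "l \<noteq> k" "q l = longest q" by blast
    have "longest q \<le> longest (apply_event D e q)" if "e \<in> set_pmf E" for e
    proof -
      have "longest q \<le> apply_event D e q k \<or> longest q \<le> apply_event D e q l"
        using k(2) l(2,3) by (cases e) (auto simp: Let_def)
      then show ?thesis using longest_ge[OF k(1), of "apply_event D e q"] longest_ge[OF l(1), of "apply_event D e q"] by linarith
    qed
    then have "measure_pmf.expectation E (\<lambda>e. real (longest q)) \<le> measure_pmf.expectation E (\<lambda>e. real (longest (apply_event D e q)))"
      by (intro expectation_mono) simp
    then show ?thesis by simp
  next
    case False
    have "F e \<le> real (longest (apply_event D e q))" if "e \<in> set_pmf E" for e
      using that
    proof (cases rule: event_cases)
      case (1 a b c)
      have ab: "a \<in> {1..n}" "b \<in> {1..n}" "a \<noteq> b" using server_pairs_servers[OF 1(2)] by auto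
      have ge: "real (apply_event D e q k) \<le> real (longest (apply_event D e q))"
        using longest_ge[OF k(1)] by simp
      show ?thesis
      proof (cases "c \<and> (a = k \<or> b = k)")
        case True
        have "q a \<noteq> q b" using True False ab k(2) by metis
        then have "D q a b c = k"
          using True k(2) longest_ge[OF ab(1), of q] longest_ge[OF ab(2), of q]
          by (auto simp: po2_rule_def G longer_def)
        then have "real (apply_event D e q k) = real (longest q) + 1" using 1 k(2) by simp
        moreover have "F e = real (longest q) + 1" using 1 True ab by (auto simp: F_def)
        ultimately show ?thesis using ge by simp
      next
        case False
        then have "F e = real (longest q)" using 1 by (auto simp: F_def)
        moreover have "q k \<le> apply_event D e q k" using 1 by (simp add: Let_def)
        ultimately show ?thesis using ge k(2) by simp
      qed
    next
      case (2 j)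
      have "real (longest q) - of_bool (j = k) \<le> real (apply_event D e q k)" using 2 k(2) by auto
      then show ?thesis using longest_ge[OF k(1), of "apply_event D e q"] 2 by (simp add: F_def)
    qed
    then have "measure_pmf.expectation E F \<le> measure_pmf.expectation E (\<lambda>e. real (longest (apply_event D e q)))"
      by (rule expectation_mono)
    moreover have "real (longest q) \<le> measure_pmf.expectation E F"
    proof -
      let ?M = "real (longest q)"
      have "(\<Sum>(a, b)\<in>server_pairs n. \<epsilon> * F (Arrival a b True) + (1 - \<epsilon>) * F (Arrival a b False))
         = (\<Sum>(a, b)\<in>server_pairs n. ?M + \<epsilon> * (of_bool (a = k) + of_bool (b = k)))"
        by (intro sum.cong refl) (auto simp: F_def algebra_simps)
      also have "\<dots> = real (card (server_pairs n)) * ?M + \<epsilon> * (real n - 1)"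
      proof -
        have "(\<Sum>(a, b)\<in>server_pairs n. of_bool (a = k) + of_bool (b = k)) = (real n - 1) * 1"
          using sum_server_pairs[of n "\<lambda>a. of_bool (a = k)"] k(1) n2 by (simp add: of_bool_def)
        then show ?thesis by (simp add: case_prod_unfold sum.distrib sum_distrib_left[symmetric])
      qed
      finally have arr: "(\<Sum>(a, b)\<in>server_pairs n. \<epsilon> * F (Arrival a b True) + (1 - \<epsilon>) * F (Arrival a b False))
         = real (card (server_pairs n)) * ?M + \<epsilon> * (real n - 1)" .
      have com: "(\<Sum>j=1..n. F (Completion j)) = real n * ?M - 1"
        using k(1) by (simp add: F_def sum_subtractf of_bool_def)
      have "2 * lam / (real n - 1) * (real (card (server_pairs n)) * ?M + \<epsilon> * (real n - 1)) = real n * lam * ?M + 2 * \<epsilon> * lam"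
        using n2 by (simp add: card_server_pairs field_simps)
      then have "measure_pmf.expectation E F = (rate * ?M + (2 * \<epsilon> * lam - 1)) / rate"
        unfolding expectation_events arr com by (simp add: algebra_simps)
      also have "\<dots> = ?M + (2 * \<epsilon> * lam - 1) / rate" using rate_pos by (simp add: add_divide_distrib)
      finally show ?thesis using lam rate_pos by simp
    qed
    ultimately show ?thesis by simp
  qed
  then show ?thesis by (subst nn_integral_jump) (auto intro: ennreal_leI)
qed

end

section \<open>Return times\<close>

lemma all_atMost_Suc_conv: "(\<forall>i\<le>Suc m. P i) \<longleftrightarrow> P 0 \<and> (\<forall>i\<le>m. P (Suc i))"
  by (metis Suc_le_mono le0 not0_implies_Suc)

lemma ex_atMost_Suc_conv: "(\<exists>i\<le>Suc m. P i) \<longleftrightarrow> P 0 \<or> (\<exists>i\<le>m. P (Suc i))"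
  by (metis Suc_le_mono le0 not0_implies_Suc)

context po2
begin

abbreviation "run es q \<equiv> fold (apply_event D) es q"

primrec avoids :: "(nat \<Rightarrow> real) \<Rightarrow> (nat \<Rightarrow> nat) \<Rightarrow> event list \<Rightarrow> bool" where
  "avoids x q [] \<longleftrightarrow> occ q \<noteq> x"
| "avoids x q (e # es) \<longleftrightarrow> occ q \<noteq> x \<and> avoids x (apply_event D e q) es"

text \<open>The initial state \<open>q\<close> is meant to have occupancy \<open>x\<close>; the path
  has not yet left \<open>x\<close> and come back. Once the occupancy differs from \<open>x\<close>,
  a return is a first visit, which is why \<open>avoids\<close> takes over.\<close>

primrec unreturned :: "(nat \<Rightarrow> real) \<Rightarrow> (nat \<Rightarrow> nat) \<Rightarrow> event list \<Rightarrow> bool" where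
  "unreturned x q [] \<longleftrightarrow> True"
| "unreturned x q (e # es) \<longleftrightarrow>
     (let q' = apply_event D e q in if occ q' = x then unreturned x q' es else avoids x q' es)"

lemma avoids_iff: "avoids x q es \<longleftrightarrow> (\<forall>i\<le>length es. occ (run (take i es) q) \<noteq> x)"
  by (induction es arbitrary: q) (simp_all add: all_atMost_Suc_conv)

lemma unreturned_iff:
  assumes "occ q = x"
  shows "unreturned x q es \<longleftrightarrow>
    (\<forall>i\<le>length es. \<not> (occ (run (take i es) q) = x \<and> (\<exists>j\<le>i. occ (run (take j es) q) \<noteq> x)))"
  using assms
proof (induction es arbitrary: q)
  case (Cons e es)
  let ?q = "apply_event D e q"
  have shift: "(\<forall>i\<le>length (e # es). \<not> (occ (run (take i (e # es)) q) = x \<and> (\<exists>j\<le>i. occ (run (take j (e # es)) q) \<noteq> x)))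
    \<longleftrightarrow> (\<forall>i\<le>length es. \<not> (occ (run (take i es) ?q) = x \<and> (\<exists>j\<le>i. occ (run (take j es) ?q) \<noteq> x)))"
    by (simp add: all_atMost_Suc_conv ex_atMost_Suc_conv Cons.prems)
  show ?case
  proof (cases "occ ?q = x")
    case True
    then show ?thesis unfolding shift using Cons.IH[of ?q] by (simp add: Let_def)
  next
    case False
    then have "\<exists>j\<le>i. occ (run (take j es) ?q) \<noteq> x" for i by (intro exI[of _ 0]) simp
    then show ?thesis unfolding shift using False by (simp add: Let_def avoids_iff)
  qed
qed simp

lemma emeasure_avoids:
  "emeasure (replicate_pmf m E) {es. avoids x q es} = avoid jump (occ -` {x}) m q"
proof (induction m arbitrary: q)
  case 0
  then show ?case by (auto simp: indicator_def)
next
  case (Suc m)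
  have "emeasure (replicate_pmf (Suc m) E) {es. avoids x q es}
     = (\<integral>\<^sup>+e. emeasure (replicate_pmf m E) {es. avoids x q (e # es)} \<partial>E)"
    by (simp add: emeasure_bind_pmf indicator_def flip: nn_integral_indicator)
  also have "\<dots> = (\<integral>\<^sup>+e. indicator (- (occ -` {x})) q * avoid jump (occ -` {x}) m (apply_event D e q) \<partial>E)"
    using Suc.IH by (intro nn_integral_cong) (auto simp: indicator_def)
  also have "\<dots> = avoid jump (occ -` {x}) (Suc m) q"
    by (simp add: nn_integral_cmult jump_def)
  finally show ?case .
qed

definition survival :: "(nat \<Rightarrow> nat) \<Rightarrow> nat \<Rightarrow> ennreal" where
  "survival q m = emeasure (replicate_pmf m E) {es. unreturned (occ q) q es}"

text \<open>The probability that the first step leaves the initial occupancy and that it is not met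
  again in the \<open>m\<close> steps that follow: \<open>avoid\<close> vanishes on states with the
  initial occupancy.\<close>

definition excursion_survival :: "(nat \<Rightarrow> nat) \<Rightarrow> nat \<Rightarrow> ennreal" where
  "excursion_survival q m = (\<integral>\<^sup>+q'. avoid jump (occ -` {occ q}) m q' \<partial>jump q)"

text \<open>An event that changes the state changes the number of jobs.\<close>

lemma event_same_occ:
  assumes "e \<in> set_pmf E" "occ (apply_event D e q) = occ q"
  shows "apply_event D e q = q"
  using event_total_cases(1)[OF assms(1), of q] total_jobs_eq_of_occupancy[OF _ assms(2)] n2 by auto

lemma survival_0: "survival q 0 = 1"
  by (simp add: survival_def)

text \<open>The first event either has no effect, and everything starts afresh, or begins an
  excursion.\<close>

lemma survival_Suc:
  "survival q (Suc m) = ennreal (pmf (jump q) q) * survival q m + excursion_survival q m"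
proof -
  let ?A = "occ -` {occ q}"
  have "survival q (Suc m) = (\<integral>\<^sup>+e. emeasure (replicate_pmf m E) {es. unreturned (occ q) q (e # es)} \<partial>E)"
    unfolding survival_def
    by (simp add: emeasure_bind_pmf indicator_def flip: nn_integral_indicator)
  also have "\<dots> = (\<integral>\<^sup>+e. survival q m * indicator {q} (apply_event D e q) + avoid jump ?A m (apply_event D e q) \<partial>E)"
  proof (intro nn_integral_cong_AE, unfold AE_measure_pmf_iff, intro ballI)
    fix e assume e: "e \<in> set_pmf E"
    show "emeasure (replicate_pmf m E) {es. unreturned (occ q) q (e # es)}
      = survival q m * indicator {q} (apply_event D e q) + avoid jump ?A m (apply_event D e q)"
    proof (cases "occ (apply_event D e q) = occ q")
      case True
      then have same: "apply_event D e q = q" by (rule event_same_occ[OF e])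
      have "avoid jump ?A m q = 0" by (cases m) auto
      then show ?thesis by (simp add: same survival_def Let_def)
    next
      case False
      then have "apply_event D e q \<noteq> q" by auto
      then show ?thesis using False by (simp add: Let_def emeasure_avoids)
    qed
  qed
  also have "\<dots> = survival q m * (\<integral>\<^sup>+e. indicator {q} (apply_event D e q) \<partial>E) + excursion_survival q m"
    by (simp add: nn_integral_add nn_integral_cmult excursion_survival_def jump_def)
  also have "(\<integral>\<^sup>+e. indicator {q} (apply_event D e q) \<partial>E) = (\<integral>\<^sup>+q'. indicator {q} q' \<partial>jump q)"
    by (simp add: jump_def)
  also have "\<dots> = ennreal (pmf (jump q) q)" by (simp add: emeasure_pmf_single)
  finally show ?thesis by (simp add: mult.commute)
qed

lemma survival_le_1: "survival q m \<le> 1"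
  unfolding survival_def by (rule measure_pmf.emeasure_le_1)

text \<open>The occupancy is constant between epochs, so the return happens at an epoch, and the
  return time is the sum of the waiting times before it. If there is no return, the sum of all
  waiting times is infinite, as is the infimum over the empty set.\<close>

lemma return_time_eq:
  assumes pos: "\<forall>j. 0 < smap fst \<omega> !! j" and steps: "\<forall>t\<ge>0. \<exists>m. in_step t m (smap fst \<omega>)"
  shows "return_time D n q \<omega> =
    (\<Sum>m. ennreal (smap fst \<omega> !! m) * indicator {es. unreturned (occ q) q es} (stake m (smap snd \<omega>)))"
    (is "_ = (\<Sum>m. ?f m)")
proof -
  let ?s = "smap fst \<omega>"
  let ?al = "\<lambda>m. unreturned (occ q) q (stake m (smap snd \<omega>))"
  define x where "x m = occ (run (stake m (smap snd \<omega>)) q)" for m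
  define T where "T = {t. 0 \<le> t \<and> occupancy_at D n q \<omega> t = occ q \<and>
     (\<exists>s\<in>{0..t}. occupancy_at D n q \<omega> s \<noteq> occ q)}"
  have at: "occupancy_at D n q \<omega> t = x m" if "in_step t m ?s" for t m
    using num_events_in_step[OF pos that] by (simp add: occupancy_at_def queue_at_def x_def)
  have al: "?al m \<longleftrightarrow> (\<forall>i\<le>m. \<not> (x i = occ q \<and> (\<exists>j\<le>i. x j \<noteq> occ q)))" for m
  proof -
    define y where "y i = occ (run (take i (stake m (smap snd \<omega>))) q)" for i
    have y: "y i = x i" if "i \<le> m" for i
      using that by (simp add: x_def y_def take_stake min_absorb1 del: stake_smap)
    have "?al m \<longleftrightarrow> (\<forall>i\<le>m. \<not> (y i = occ q \<and> (\<exists>j\<le>i. y j \<noteq> occ q)))"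
      unfolding unreturned_iff[OF refl, of q] length_stake y_def ..
    also have "\<dots> \<longleftrightarrow> (\<forall>i\<le>m. \<not> (x i = occ q \<and> (\<exists>j\<le>i. x j \<noteq> occ q)))"
    proof (intro all_cong1 imp_cong refl)
      fix i assume i: "i \<le> m"
      have "(\<exists>j\<le>i. y j \<noteq> occ q) \<longleftrightarrow> (\<exists>j\<le>i. x j \<noteq> occ q)"
        by (intro ex_cong1 conj_cong refl) (simp add: y[OF order_trans[OF _ i]])
      then show "(\<not> (y i = occ q \<and> (\<exists>j\<le>i. y j \<noteq> occ q))) = (\<not> (x i = occ q \<and> (\<exists>j\<le>i. x j \<noteq> occ q)))"
        by (simp only: y[OF i])
    qed
    finally show ?thesis .
  qed
  have in_epoch: "in_step (epoch ?s m) m ?s" for m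
    using pos by (simp add: in_step_def epoch_Suc del: snth_smap)
  have epoch_nonneg: "0 \<le> epoch ?s m" for m
    using epoch_mono[OF pos, of 0 m] by simp
  have partial: "(\<Sum>i<m. ennreal (?s !! i)) = ennreal (epoch ?s m)" for m
    unfolding epoch_def using pos by (intro sum_ennreal) (auto intro: less_imp_le)
  have ret: "return_time D n q \<omega> = (INF t\<in>T. ennreal t)"
    by (simp add: return_time_def T_def)
  show ?thesis
  proof (rule antisym)
    show "(\<Sum>m. ?f m) \<le> return_time D n q \<omega>"
      unfolding ret
    proof (rule INF_greatest)
      fix t assume t: "t \<in> T"
      then obtain s where s: "s \<in> {0..t}" "occupancy_at D n q \<omega> s \<noteq> occ q" by (auto simp: T_def)
      obtain m where m: "in_step t m ?s" using steps t by (auto simp: T_def)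
      obtain j where j: "in_step s j ?s" using steps s by auto
      have jm: "j \<le> m"
        using epoch_mono[OF pos, of "Suc m" j] m j s(1) by (force simp: in_step_def not_le[symmetric])
      have "\<not> ?al m" unfolding al using t s(2) jm at[OF m] at[OF j] by (auto simp: T_def)
      then have "\<not> ?al i" if "m \<le> i" for i
        using that unfolding al by (meson order_trans)
      then have zero: "?f i = 0" if "i \<notin> {..<m}" for i
        using that by (simp add: indicator_def not_less del: stake_smap)
      have "(\<Sum>i. ?f i) = (\<Sum>i<m. ?f i)" by (rule suminf_finite) (use zero in auto)
      also have "\<dots> \<le> (\<Sum>i<m. ennreal (?s !! i))" by (intro sum_mono) (auto simp: indicator_def)
      also have "\<dots> = ennreal (epoch ?s m)" by (rule partial)
      also have "\<dots> \<le> ennreal t" using m by (intro ennreal_leI) (simp add: in_step_def)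
      finally show "(\<Sum>i. ?f i) \<le> ennreal t" .
    qed
    show "return_time D n q \<omega> \<le> (\<Sum>m. ?f m)"
    proof (cases "\<exists>m. \<not> ?al m")
      case True
      define R where "R = (LEAST m. \<not> ?al m)"
      have R: "\<not> ?al R" unfolding R_def using True by (rule LeastI_ex)
      have before: "?al i" if "i < R" for i using not_less_Least[of i "\<lambda>m. \<not> ?al m"] that unfolding R_def by blast
      obtain i j where ij: "i \<le> R" "x i = occ q" "j \<le> i" "x j \<noteq> occ q" using R unfolding al by blast
      have "i = R"
      proof (rule ccontr)
        assume "i \<noteq> R"
        then have "?al i" using ij(1) by (intro before) simp
        then show False unfolding al using ij by blast
      qed
      have "epoch ?s R \<in> T"
        unfolding T_def using ij \<open>i = R\<close> at[OF in_epoch[of R]] at[OF in_epoch[of j]] epoch_nonneg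
          epoch_mono[OF pos, of j R]
        by (auto intro!: bexI[of _ "epoch ?s j"])
      then have "return_time D n q \<omega> \<le> ennreal (epoch ?s R)" unfolding ret by (rule INF_lower)
      also have "\<dots> = (\<Sum>i<R. ?f i)" unfolding partial[symmetric] using before by (intro sum.cong) auto
      also have "\<dots> \<le> (\<Sum>m. ?f m)" by (rule sum_le_suminf) auto
      finally show ?thesis .
    next
      case False
      have "ennreal (real k) \<le> (\<Sum>m. ?f m)" for k :: nat
      proof -
        obtain m where m: "in_step (real k) m ?s" using steps by (meson of_nat_0_le_iff)
        have "ennreal (real k) \<le> ennreal (epoch ?s (Suc m))" using m by (intro ennreal_leI) (simp add: in_step_def)
        also have "\<dots> = (\<Sum>i<Suc m. ?f i)" unfolding partial[symmetric] using False by (intro sum.cong) auto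
        also have "\<dots> \<le> (\<Sum>m. ?f m)" by (rule sum_le_suminf) auto
        finally show ?thesis .
      qed
      then have "(\<Sum>m. ?f m) = \<infinity>"
        by (metis ennreal_of_nat_eq_real_of_nat ennreal_Ex_less_of_nat infinity_ennreal_def linorder_not_less order_less_irrefl top.not_eq_extremum)
      then show ?thesis by simp
    qed
  qed
qed

text \<open>Whether the \<open>m\<close>-th waiting time counts is decided by the first
  \<open>m\<close> events, which are independent of it.\<close>

lemma mean_return_time:
  "(\<integral>\<^sup>+\<omega>. return_time D n q \<omega> \<partial>driver n lam \<epsilon>) = ennreal (1 / rate) * (\<Sum>m. survival q m)"
proof -
  let ?I = "indicator {es. unreturned (occ q) q es} :: event list \<Rightarrow> ennreal"
  have [measurable]: "(\<lambda>\<omega>. ?I (stake m (smap snd \<omega>))) \<in> borel_measurable \<Omega>" for m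
    by (rule measurable_compose[OF measurable_marks]) simp
  have "(\<integral>\<^sup>+\<omega>. return_time D n q \<omega> \<partial>driver n lam \<epsilon>)
     = (\<integral>\<^sup>+\<omega>. (\<Sum>m. ennreal (smap fst \<omega> !! m) * ?I (stake m (smap snd \<omega>))) \<partial>\<Omega>)"
    unfolding driver_eq by (rule nn_integral_cong_AE, use AE_clock in eventually_elim) (rule return_time_eq, auto)
  also have "\<dots> = (\<Sum>m. \<integral>\<^sup>+\<omega>. ennreal (smap fst \<omega> !! m) * ?I (stake m (smap snd \<omega>)) \<partial>\<Omega>)"
    by (rule nn_integral_suminf) measurable
  also have "\<dots> = (\<Sum>m. ennreal (1 / rate) * survival q m)"
  proof (rule suminf_cong)
    fix m
    have "(\<integral>\<^sup>+\<omega>. ennreal (smap fst \<omega> !! m) * ?I (stake m (smap snd \<omega>)) \<partial>\<Omega>)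
       = (\<integral>\<^sup>+\<omega>. ennreal (smap fst \<omega> !! m) \<partial>\<Omega>) * (\<integral>\<^sup>+es. ?I es \<partial>replicate_pmf m E)"
      by (rule waits_indep_marks[of "\<lambda>s. ennreal (s !! m)"]) measurable
    also have "(\<integral>\<^sup>+es. ?I es \<partial>replicate_pmf m E) = survival q m" by (simp add: survival_def)
    finally show "(\<integral>\<^sup>+\<omega>. ennreal (smap fst \<omega> !! m) * ?I (stake m (smap snd \<omega>)) \<partial>\<Omega>) = ennreal (1 / rate) * survival q m"
      by (simp only: mean_wait)
  qed
  finally show ?thesis by simp
qed

lemma arrival_in_events:
  obtains c where "Arrival 1 2 c \<in> set_pmf E"
proof -
  obtain c where c: "c \<in> set_pmf (bernoulli_pmf \<epsilon>)" using set_pmf_not_empty[of "bernoulli_pmf \<epsilon>"] by blast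
  have "(1, 2) \<in> server_pairs n" using n2 by (simp add: server_pairs_def)
  then have "(1, 2) \<in> set_pmf (pmf_of_set (server_pairs n))"
    using server_pairs_nonempty[OF n2] by (simp add: set_pmf_of_set)
  moreover have "True \<in> set_pmf (bernoulli_pmf (lam / (1 + lam)))" using arrival_prob by (simp add: set_pmf_bernoulli)
  ultimately have "Arrival 1 2 c \<in> set_pmf E"
    unfolding event_pmf_def server_pairs_def[symmetric] set_bind_pmf using c
    by (intro UN_I[of True]) (auto intro!: bexI[of _ "(1, 2)"])
  then show thesis by (rule that)
qed

lemma pmf_jump_self: "pmf (jump q) q < 1"
proof -
  obtain c where c: "Arrival 1 2 c \<in> set_pmf E" by (rule arrival_in_events)
  let ?q = "apply_event D (Arrival 1 2 c) q"
  have "(1, 2) \<in> server_pairs n" using n2 by (simp add: server_pairs_def)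
  then have "total_jobs n ?q \<noteq> total_jobs n q" using total_arrival[of 1 2 c q] by simp
  then have ne: "?q \<noteq> q" by metis
  have "?q \<in> set_pmf (jump q)" unfolding jump_def set_map_pmf using c by (rule imageI)
  then have pos: "0 < pmf (jump q) ?q" by (rule pmf_positive)
  have "pmf (jump q) q + pmf (jump q) ?q = measure (jump q) {q, ?q}"
    using ne by (subst measure_measure_pmf_finite) auto
  also have "\<dots> \<le> 1" by (rule measure_pmf.prob_le_1)
  finally show ?thesis using pos by linarith
qed

text \<open>The number of steps before the initial state is left is geometric, because an arrival
  always changes the state. The partial sums of \<open>survival\<close> are finite, which allows to
  solve the recursive inequality for them.\<close>

lemma sum_survival_finite:
  assumes "(\<Sum>m. excursion_survival q m) < \<infinity>"
  shows "(\<Sum>m. survival q m) < \<infinity>"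
proof -
  define \<kappa> where "\<kappa> = pmf (jump q) q"
  define H where "H = enn2real (\<Sum>m. excursion_survival q m)"
  have H: "(\<Sum>m. excursion_survival q m) = ennreal H" "0 \<le> H" using assms unfolding H_def by auto
  have \<kappa>: "0 \<le> \<kappa>" "\<kappa> < 1" using pmf_jump_self by (auto simp: \<kappa>_def)
  have bound: "(\<Sum>m<M. survival q m) \<le> ennreal ((1 + H) / (1 - \<kappa>))" for M
  proof -
    define L where "L = enn2real (\<Sum>m<M. survival q m)"
    have "(\<Sum>m<M. survival q m) \<le> (\<Sum>m<M. 1)" by (intro sum_mono survival_le_1)
    also have "\<dots> < \<infinity>" by (simp add: of_nat_less_top)
    finally have L: "(\<Sum>m<M. survival q m) = ennreal L" "0 \<le> L" unfolding L_def by auto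
    have "(\<Sum>m<Suc M. survival q m) = survival q 0 + (\<Sum>m<M. survival q (Suc m))"
      by (rule sum.lessThan_Suc_shift)
    also have "\<dots> = 1 + (ennreal \<kappa> * (\<Sum>m<M. survival q m) + (\<Sum>m<M. excursion_survival q m))"
      by (simp add: survival_0 survival_Suc sum.distrib sum_distrib_left \<kappa>_def)
    also have "\<dots> \<le> 1 + (ennreal \<kappa> * ennreal L + ennreal H)"
      unfolding L(1) H(1)[symmetric] by (intro add_left_mono sum_le_suminf) auto
    also have "\<dots> = ennreal (1 + (\<kappa> * L + H))"
      using \<kappa> L H by (simp add: ennreal_mult ennreal_plus)
    finally have "(\<Sum>m<Suc M. survival q m) \<le> ennreal (1 + (\<kappa> * L + H))" .
    moreover have "(\<Sum>m<M. survival q m) \<le> (\<Sum>m<Suc M. survival q m)" by simp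
    ultimately have "ennreal L \<le> ennreal (1 + (\<kappa> * L + H))" unfolding L(1) by (rule order_trans[rotated])
    then have "L \<le> 1 + (\<kappa> * L + H)" using \<kappa> L H by (subst (asm) ennreal_le_iff) auto
    then have "L \<le> (1 + H) / (1 - \<kappa>)" using \<kappa> by (simp add: field_simps)
    then show ?thesis unfolding L(1) by (rule ennreal_leI)
  qed
  have "(\<Sum>m. survival q m) \<le> ennreal ((1 + H) / (1 - \<kappa>))"
    by (rule suminf_le_const) (auto intro: bound)
  then show ?thesis by (rule order_le_less_trans) simp
qed

text \<open>Kac's inequality is applied to the occupancy chain and not to the queue lengths: a state
  \<open>q\<close> whose occupancy is accessible may itself be out of reach, since ties are broken
  by index.\<close>

lemma positive_recurrent_if_invariant:
  assumes inv: "invariant jump \<mu>" "set_pmf \<mu> \<subseteq> X"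
  shows "positive_recurrent D n lam \<epsilon>"
  unfolding positive_recurrent_def
proof (intro ballI impI)
  fix q assume q: "q \<in> X" and "accessible_from_empty D n lam \<epsilon> (occ q)"
  then obtain t where t: "0 \<le> t" "0 < pmf (map_pmf occ (flow t idle)) (occ q)"
    unfolding accessible_from_empty_def by (auto simp: occupancy_trans_eq)
  let ?\<pi> = "map_pmf occ \<mu>"
  have idle: "idle \<in> set_pmf \<mu>"
  proof -
    obtain q0 where q0: "q0 \<in> set_pmf \<mu>" using set_pmf_not_empty[of \<mu>] by blast
    then have "q0 \<in> X" by (rule subsetD[OF inv(2)])
    then have "idle \<in> set_pmf (iterate jump (total_jobs n q0) q0)" by (rule idle_reachable)
    then show ?thesis by (rule subsetD[OF invariant_iterate_closed[OF inv(1) q0]])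
  qed
  have "occ q \<in> set_pmf (map_pmf occ (flow t idle))" using t(2) by (subst set_pmf_iff) simp
  then obtain q' where q': "q' \<in> set_pmf (flow t idle)" "occ q' = occ q" by auto
  have "q' \<in> set_pmf \<mu>"
    by (rule invariant_closed[where K = "flow t", OF invariant_subordinate[OF inv(1)] idle q'(1)])
  then have "occ q' \<in> set_pmf ?\<pi>" unfolding set_map_pmf by (rule imageI)
  then have "occ q \<in> set_pmf ?\<pi>" by (simp only: q'(2))
  then have pos: "0 < pmf ?\<pi> (occ q)" by (rule pmf_positive)
  have "excursion_survival q m = (\<integral>\<^sup>+y. avoid occ_jump {occ q} m y \<partial>occ_jump (occ q))" for m
    unfolding excursion_survival_def occ_jump[OF q] nn_integral_map_pmf
    using jump_closed[OF q] avoid_occ_jump by (intro nn_integral_cong_AE) (auto simp: AE_measure_pmf_iff)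
  then have "ennreal (pmf ?\<pi> (occ q)) * (\<Sum>m. excursion_survival q m) \<le> 1"
    using kac_inequality[OF invariant_occ_jump[OF inv], of "occ q"] by simp
  then have "(\<Sum>m. excursion_survival q m) < \<infinity>"
    using pos by (auto simp: ennreal_mult_top top_unique less_top[symmetric])
  then have "(\<Sum>m. survival q m) < \<infinity>" by (rule sum_survival_finite)
  then show "(\<integral>\<^sup>+\<omega>. return_time D n q \<omega> \<partial>driver n lam \<epsilon>) < \<infinity>"
    unfolding mean_return_time by (simp add: ennreal_mult_less_top)
qed

text \<open>From the idle state, the first arrival leads to the state with one job at server 1; from
  there the idle state is avoided for \<open>m\<close> steps with probability at least \<open>1 / (m
  + 1)\<close>.\<close>

lemma not_positive_recurrent:
  fixes f :: "(nat \<Rightarrow> nat) \<Rightarrow> nat"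
  assumes idle: "f idle = 0" and one: "f (idle(1 := 1)) = 1"
    and sub: "\<And>q. ennreal (real (f q)) \<le> (\<integral>\<^sup>+q'. ennreal (real (f q')) \<partial>jump q)"
    and incr: "\<And>q e. e \<in> set_pmf E \<Longrightarrow> f (apply_event D e q) \<le> f q + 1"
  shows "\<not> positive_recurrent D n lam \<epsilon>"
proof -
  let ?A = "occ -` {occ idle}"
  let ?q = "idle(1 := 1)"
  obtain c where c: "Arrival 1 2 c \<in> set_pmf E" by (rule arrival_in_events)
  have "apply_event D (Arrival 1 2 c) idle = ?q" by (simp add: po2_rule_def Let_def)
  then have q_jump: "?q \<in> set_pmf (jump idle)" unfolding jump_def set_map_pmf using c by (metis imageI)
  then have qX: "?q \<in> X" using jump_closed[OF idle_state] by blast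
  have low: "ennreal (1 / real (Suc m)) \<le> avoid jump ?A m ?q" for m
  proof (rule avoid_ge_harmonic[of X jump ?A "\<lambda>q. ennreal (real (f q))"])
    show "ennreal (real (f q)) = 0" if "q \<in> X" "q \<in> ?A" for q
      using that occ_eq_idle_iff idle by auto
    fix q q' assume "q' \<in> set_pmf (jump q)"
    then have "f q' \<le> f q + 1" using incr by (auto simp: jump_def)
    then have "real (f q') \<le> real (f q) + 1" by simp
    then have "ennreal (real (f q')) \<le> ennreal (real (f q) + 1)" by (rule ennreal_leI)
    also have "\<dots> = ennreal (real (f q)) + 1" by (simp add: ennreal_plus)
    finally show "ennreal (real (f q')) \<le> ennreal (real (f q)) + 1" .
  qed (use jump_closed sub qX one in auto)
  define p where "p = pmf (jump idle) ?q"
  have p: "0 < p" unfolding p_def using q_jump by (rule pmf_positive)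
  have surv: "ennreal p * ennreal (1 / real (Suc m)) \<le> survival idle (Suc m)" for m
  proof -
    have "ennreal p * ennreal (1 / real (Suc m)) \<le> ennreal p * avoid jump ?A m ?q" by (intro mult_left_mono low) simp
    also have "\<dots> = (\<integral>\<^sup>+q'. avoid jump ?A m ?q * indicator {?q} q' \<partial>jump idle)"
      by (subst nn_integral_cmult_indicator, simp, simp only: emeasure_pmf_single p_def mult.commute)
    also have "\<dots> \<le> excursion_survival idle m"
      unfolding excursion_survival_def by (intro nn_integral_mono) (auto simp: indicator_def)
    also have "\<dots> \<le> survival idle (Suc m)" unfolding survival_Suc by simp
    finally show ?thesis .
  qed
  have "\<infinity> = ennreal p * (\<Sum>m. ennreal (1 / real (Suc m)))"
    using p by (simp add: suminf_harmonic_ennreal ennreal_mult_top del: of_nat_Suc)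
  also have "\<dots> = (\<Sum>m. ennreal p * ennreal (1 / real (Suc m)))" by simp
  also have "\<dots> \<le> (\<Sum>m. survival idle (Suc m))" by (intro suminf_le surv) auto
  also have "\<dots> \<le> (\<Sum>m. survival idle m)"
    using suminf_offset[of "survival idle" 1] by simp
  finally have "(\<Sum>m. survival idle m) = \<infinity>" by (simp add: top_unique)
  then have "(\<integral>\<^sup>+\<omega>. return_time D n idle \<omega> \<partial>driver n lam \<epsilon>) = \<infinity>"
    unfolding mean_return_time using rate_pos by (simp add: ennreal_mult_top)
  moreover have "accessible_from_empty D n lam \<epsilon> (occ idle)"
    unfolding accessible_from_empty_def
    by (rule exI[of _ 0]) (simp add: occupancy_trans_eq count_pmf_def subordinate_def bind_return_pmf)
  ultimately show ?thesis unfolding positive_recurrent_def by (metis idle_state less_irrefl)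
qed

end

section \<open>Stability and mean queue lengths\<close>

lemma mean_total_occupancy_map:
  "mean_total_occupancy (map_pmf (occupancy n) \<mu>) = (\<integral>\<^sup>+q. ennreal (real (total_jobs n q) / real n) \<partial>\<mu>)"
  by (simp add: mean_total_occupancy_def sum_occupancy)

lemma average_mean_queue:
  assumes "0 < n"
  shows "(\<Sum>i=1..n. mean_queue \<mu> i) / of_nat n = mean_total_occupancy (map_pmf (occupancy n) \<mu>)"
proof -
  have "(\<Sum>i=1..n. mean_queue \<mu> i) / of_nat n = (\<integral>\<^sup>+q. (\<Sum>i=1..n. of_nat (q i)) \<partial>\<mu>) / of_nat n"
    by (simp add: mean_queue_def nn_integral_sum)
  also have "\<dots> = (\<integral>\<^sup>+q. (\<Sum>i=1..n. of_nat (q i)) / of_nat n \<partial>\<mu>)"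
    by (rule nn_integral_divide[symmetric]) simp
  also have "\<dots> = (\<integral>\<^sup>+q. ennreal (real (total_jobs n q) / real n) \<partial>\<mu>)"
    using assms by (intro nn_integral_cong)
      (simp add: total_jobs_def ennreal_of_nat_eq_real_of_nat divide_ennreal flip: of_nat_sum)
  finally show ?thesis by (simp only: mean_total_occupancy_map)
qed

lemma nat_eq_sum_indicator: "(of_nat m :: ennreal) = (\<Sum>k. indicator {k. Suc k \<le> m} k)"
proof -
  have "(\<Sum>k. indicator {k. Suc k \<le> m} k :: ennreal) = (\<Sum>k<m. indicator {k. Suc k \<le> m} k)"
    by (rule suminf_finite) auto
  also have "\<dots> = (\<Sum>k<m. 1)" by (intro sum.cong) auto
  finally show ?thesis by simp
qed

lemma mean_queue_tail: "mean_queue \<mu> i = (\<Sum>k. emeasure \<mu> {q. Suc k \<le> q i})"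
proof -
  have "mean_queue \<mu> i = (\<integral>\<^sup>+q. (\<Sum>k. indicator {q. Suc k \<le> q i} q) \<partial>\<mu>)"
    unfolding mean_queue_def
  proof (intro nn_integral_cong)
    fix q :: "nat \<Rightarrow> nat"
    show "(of_nat (q i) :: ennreal) = (\<Sum>k. indicator {q. Suc k \<le> q i} q)"
      using nat_eq_sum_indicator[of "q i"] by (simp add: indicator_def)
  qed
  also have "\<dots> = (\<Sum>k. \<integral>\<^sup>+q. indicator {q. Suc k \<le> q i} q \<partial>\<mu>)" by (rule nn_integral_suminf) simp
  finally show ?thesis by simp
qed

text \<open>Both sides are the sum of the same tail probabilities.\<close>

lemma mean_queue_indistinguishable:
  assumes "indistinguishable_version n \<pi> \<mu>" "i \<in> {1..n}"
  shows "mean_queue \<mu> i = mean_total_occupancy \<pi>"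
proof -
  have supp: "map_pmf (occupancy n) \<mu> = \<pi>" and
    tail: "\<And>k. 1 \<le> k \<Longrightarrow> measure_pmf.prob \<mu> {q. k \<le> q i} = measure_pmf.expectation \<pi> (\<lambda>x. x k)"
    using assms by (auto simp: indistinguishable_version_def)
  have "emeasure \<mu> {q. Suc k \<le> q i} = (\<integral>\<^sup>+x. ennreal (x (Suc k)) \<partial>\<pi>)" for k
  proof -
    have bounds: "0 \<le> occupancy n q (Suc k)" "occupancy n q (Suc k) \<le> 1" for q
    proof -
      have "card {j \<in> {1..n}. Suc k \<le> q j} \<le> card {1..n}" by (intro card_mono) auto
      then show "occupancy n q (Suc k) \<le> 1" using assms(2) by (simp add: occupancy_def)
    qed (simp add: occupancy_def)
    have "emeasure \<mu> {q. Suc k \<le> q i} = ennreal (measure_pmf.expectation \<pi> (\<lambda>x. x (Suc k)))"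
      using tail[of "Suc k"] by (simp add: measure_pmf.emeasure_eq_measure)
    also have "\<dots> = ennreal (measure_pmf.expectation \<mu> (\<lambda>q. occupancy n q (Suc k)))"
      by (simp flip: supp)
    also have "\<dots> = (\<integral>\<^sup>+q. ennreal (occupancy n q (Suc k)) \<partial>\<mu>)"
      by (intro nn_integral_eq_integral[symmetric] measure_pmf.integrable_const_bound[where B = 1])
        (auto simp: bounds)
    finally show ?thesis by (simp flip: supp)
  qed
  then show ?thesis
    unfolding mean_queue_tail mean_total_occupancy_def by (simp add: nn_integral_suminf)
qed

context po2
begin

text \<open>The hypothesis bounds the mean length of the queue that a job joins, given the sampled
  pair, by a multiple of the mean length of the pair plus a constant.\<close>

lemma stable_system:
  assumes dispatch: "\<And>q a b. (a, b) \<in> server_pairs n \<Longrightarrow>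
      \<epsilon> * real (q (D q a b True)) + (1 - \<epsilon>) * real (q (D q a b False)) \<le> \<alpha> * (real (q a) + real (q b)) / 2 + \<beta>"
    and stable: "\<alpha> * lam < 1" and \<beta>: "0 \<le> \<beta>"
  shows "positive_recurrent D n lam \<epsilon> \<and>
    (\<exists>!\<pi>. occupancy_invariant D n lam \<epsilon> \<pi>) \<and> (\<exists>!\<mu>. queue_invariant D n lam \<epsilon> \<mu>) \<and>
    (\<forall>\<pi>. occupancy_invariant D n lam \<epsilon> \<pi> \<longrightarrow>
       (\<forall>\<mu>. queue_invariant D n lam \<epsilon> \<mu> \<longrightarrow>
          map_pmf (occupancy n) \<mu> = \<pi> \<and>
          (\<Sum>i=1..n. mean_queue \<mu> i) / of_nat n = mean_total_occupancy \<pi>) \<and>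
       (\<forall>\<mu>. indistinguishable_version n \<pi> \<mu> \<longrightarrow>
          (\<forall>i\<in>{1..n}. mean_queue \<mu> i = mean_total_occupancy \<pi>)) \<and>
       mean_total_occupancy \<pi> \<le> ennreal ((1 + \<beta>) * lam / (1 - \<alpha> * lam)))"
proof -
  obtain \<mu> where inv: "invariant jump \<mu>" "set_pmf \<mu> \<subseteq> X"
    using stable_invariant_exists[OF dispatch stable \<beta>] by blast
  let ?\<pi> = "map_pmf occ \<mu>"
  note laws = stationary_laws[OF inv]
  have eq_\<mu>: "\<mu>' = \<mu>" if "queue_invariant D n lam \<epsilon> \<mu>'" for \<mu>'
    using queue_invariant_unique[OF that laws(1)] .
  have eq_\<pi>: "\<pi> = ?\<pi>" if "occupancy_invariant D n lam \<epsilon> \<pi>" for \<pi>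
    using occupancy_invariant_unique[OF that laws(2)] .
  show ?thesis
  proof (intro conjI allI impI ballI)
    show "positive_recurrent D n lam \<epsilon>" by (rule positive_recurrent_if_invariant[OF inv])
    show "\<exists>!\<pi>. occupancy_invariant D n lam \<epsilon> \<pi>" by (rule ex1I, rule laws(2), rule eq_\<pi>)
    show "\<exists>!\<mu>. queue_invariant D n lam \<epsilon> \<mu>" by (rule ex1I, rule laws(1), rule eq_\<mu>)
    fix \<pi> assume "occupancy_invariant D n lam \<epsilon> \<pi>"
    then have \<pi>: "\<pi> = ?\<pi>" by (rule eq_\<pi>)
    show "mean_total_occupancy \<pi> \<le> ennreal ((1 + \<beta>) * lam / (1 - \<alpha> * lam))"
      unfolding \<pi> mean_total_occupancy_map by (rule mean_total_le[OF inv(1) dispatch stable \<beta>])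
    fix \<mu>'
    show "mean_queue \<mu>' i = mean_total_occupancy \<pi>"
      if "indistinguishable_version n \<pi> \<mu>'" "i \<in> {1..n}" for i
      using that by (rule mean_queue_indistinguishable)
    assume "queue_invariant D n lam \<epsilon> \<mu>'"
    then have "\<mu>' = \<mu>" by (rule eq_\<mu>)
    then show occ: "map_pmf occ \<mu>' = \<pi>" by (simp only: \<pi>)
    show "(\<Sum>i=1..n. mean_queue \<mu>' i) / of_nat n = mean_total_occupancy \<pi>"
      unfolding occ[symmetric] using n2 by (intro average_mean_queue) simp
  qed
qed

lemma unstable_arrival_rate:
  assumes "1 \<le> lam"
  shows "\<not> positive_recurrent D n lam \<epsilon>"
proof (rule not_positive_recurrent[of "total_jobs n"])
  show "total_jobs n (idle(1 := 1)) = 1"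
    using n2 by (simp add: total_jobs_def sum.delta fun_upd_def)
qed (use total_submartingale[OF assms] event_total_cases(2) in \<open>auto simp: total_jobs_def\<close>)

lemma unstable_longest_queue:
  assumes "G = UNIV" "1 \<le> 2 * \<epsilon> * lam"
  shows "\<not> positive_recurrent D n lam \<epsilon>"
proof (rule not_positive_recurrent[of longest])
  show "longest idle = 0" using longest_attained[of idle] by auto
  have "longest (idle(1 := 1)) \<ge> 1" using longest_ge[of 1 "idle(1 := 1)"] n2 by simp
  moreover have "longest (idle(1 := 1)) \<le> 1" using longest_attained[of "idle(1 := 1)"] by (auto split: if_splits)
  ultimately show "longest (idle(1 := 1)) = 1" by simp
qed (use longest_submartingale[OF assms] longest_event_le in auto)

text \<open>With \<open>x\<close> the larger and \<open>y\<close> the smaller of the two lengths, a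
  job joins a queue of mean length \<open>y\<close> (also in a tie), or \<open>\<epsilon> x + (1 -
  \<epsilon>) y\<close> if the coin decides.\<close>

lemma dispatch_mean:
  obtains x y where "y \<le> x" "0 \<le> y" "x + y = real (q a) + real (q b)"
    "\<epsilon> * real (q (D q a b True)) + (1 - \<epsilon>) * real (q (D q a b False)) = y \<or>
      x - y \<in> G \<and> \<epsilon> * real (q (D q a b True)) + (1 - \<epsilon>) * real (q (D q a b False)) = \<epsilon> * x + (1 - \<epsilon>) * y"
proof -
  have same: "\<epsilon> * y + (1 - \<epsilon>) * y = y" for y :: real by (simp add: algebra_simps)
  consider "q a = q b" | "q a < q b" | "q b < q a" by linarith
  then show thesis
  proof cases
    case 1
    have "q (D q a b c) = q b" for c using po2_rule_cases[of G q a b c] 1 by auto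
    then show thesis using that[of "real (q b)" "real (q b)"] 1 by (simp add: same)
  next
    case 2
    then have diff: "\<bar>real (q a) - real (q b)\<bar> = real (q b) - real (q a)" by simp
    show thesis
      by (rule that[of "real (q a)" "real (q b)"], use 2 in \<open>simp_all add: po2_rule_def longer_def shorter_def diff same\<close>)
  next
    case 3
    then have diff: "\<bar>real (q a) - real (q b)\<bar> = real (q a) - real (q b)" by simp
    show thesis
      by (rule that[of "real (q b)" "real (q a)"], use 3 in \<open>simp_all add: po2_rule_def longer_def shorter_def diff same\<close>)
  qed
qed

text \<open>For \<open>\<epsilon> \<le> 1/2\<close> the weighted mean is at most the arithmetic
  mean; otherwise \<open>1 - \<epsilon> \<le> \<epsilon>\<close> gives \<open>\<epsilon> x + (1 -
  \<epsilon>) y \<le> \<epsilon> (x + y)\<close>.\<close>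

lemma dispatch_eps:
  "\<epsilon> * real (q (D q a b True)) + (1 - \<epsilon>) * real (q (D q a b False))
    \<le> max 1 (2 * \<epsilon>) * (real (q a) + real (q b)) / 2 + 0"
proof (rule dispatch_mean[of q a b])
  fix x y :: real
  let ?mean = "\<epsilon> * real (q (D q a b True)) + (1 - \<epsilon>) * real (q (D q a b False))"
  assume xy: "y \<le> x" "0 \<le> y" and sum: "x + y = real (q a) + real (q b)"
    and "?mean = y \<or> x - y \<in> G \<and> ?mean = \<epsilon> * x + (1 - \<epsilon>) * y"
  then consider "?mean = y" | "?mean = \<epsilon> * x + (1 - \<epsilon>) * y" by blast
  then show ?thesis
  proof cases
    case 1
    have "1 * (x + y) \<le> max 1 (2 * \<epsilon>) * (x + y)" using xy by (intro mult_right_mono) auto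
    then show ?thesis unfolding 1 sum[symmetric] using xy by simp
  next
    case 2
    show ?thesis
    proof (cases "\<epsilon> \<le> 1 / 2")
      case True
      then have "(1 / 2 - \<epsilon>) * y \<le> (1 / 2 - \<epsilon>) * x" using xy by (intro mult_left_mono) auto
      then show ?thesis unfolding 2 sum[symmetric] using True by (simp add: max_def field_simps)
    next
      case False
      then have "(1 - \<epsilon>) * y \<le> \<epsilon> * y" using xy by (intro mult_right_mono) auto
      then show ?thesis unfolding 2 sum[symmetric] using False by (simp add: max_def field_simps)
    qed
  qed
qed

text \<open>For \<open>\<epsilon> > 1/2\<close> the weighted mean exceeds the arithmetic mean by
  \<open>(\<epsilon> - 1/2) (x - y)\<close>, where \<open>x - y \<le> g\<close>.\<close>

lemma dispatch_g_eps:
  assumes G: "G = {..g}" and g: "0 \<le> g"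
  shows "\<epsilon> * real (q (D q a b True)) + (1 - \<epsilon>) * real (q (D q a b False))
    \<le> 1 * (real (q a) + real (q b)) / 2 + g * of_bool (\<epsilon> > 1/2)"
proof (rule dispatch_mean[of q a b])
  fix x y :: real
  let ?mean = "\<epsilon> * real (q (D q a b True)) + (1 - \<epsilon>) * real (q (D q a b False))"
  assume xy: "y \<le> x" "0 \<le> y" and sum: "x + y = real (q a) + real (q b)"
    and "?mean = y \<or> x - y \<in> G \<and> ?mean = \<epsilon> * x + (1 - \<epsilon>) * y"
  then consider "?mean = y" | "x - y \<le> g" "?mean = \<epsilon> * x + (1 - \<epsilon>) * y" using G by blast
  then show ?thesis
  proof cases
    case 1
    have "y \<le> (x + y) / 2" using xy by simp
    moreover have "0 \<le> g * of_bool (\<epsilon> > 1/2)" using g by simp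
    ultimately have "y \<le> (x + y) / 2 + g * of_bool (\<epsilon> > 1/2)" by linarith
    then show ?thesis unfolding 1 sum[symmetric] by simp
  next
    case 2
    show ?thesis
    proof (cases "\<epsilon> > 1 / 2")
      case True
      have "(\<epsilon> - 1 / 2) * (x - y) \<le> 1 * (x - y)" using xy eps1 by (intro mult_right_mono) auto
      then show ?thesis unfolding 2(2) sum[symmetric] using True 2(1) by (simp add: field_simps)
    next
      case False
      then have "(1 / 2 - \<epsilon>) * y \<le> (1 / 2 - \<epsilon>) * x" using xy by (intro mult_left_mono) auto
      then show ?thesis unfolding 2(2) sum[symmetric] using False by (simp add: field_simps)
    qed
  qed
qed

end

theorem theorem1:
  fixes n :: nat and lam \<epsilon> :: real
  assumes "n \<ge> 2" and "lam > 0" and "0 \<le> \<epsilon>" and "\<epsilon> \<le> 1"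
  shows
   "(\<forall>g::real. g \<ge> 0 \<longrightarrow>
       (positive_recurrent (po2_g_eps g) n lam \<epsilon> \<longleftrightarrow> lam < 1) \<and>
       (lam < 1 \<longrightarrow>
          (\<exists>!\<pi>. occupancy_invariant (po2_g_eps g) n lam \<epsilon> \<pi>) \<and>
          (\<exists>!\<mu>. queue_invariant (po2_g_eps g) n lam \<epsilon> \<mu>) \<and>
          (\<forall>\<pi>. occupancy_invariant (po2_g_eps g) n lam \<epsilon> \<pi> \<longrightarrow>
             (\<forall>\<mu>. queue_invariant (po2_g_eps g) n lam \<epsilon> \<mu> \<longrightarrow>
                map_pmf (occupancy n) \<mu> = \<pi> \<and>
                (\<Sum>i=1..n. mean_queue \<mu> i) / of_nat n = mean_total_occupancy \<pi>) \<and>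
             (\<forall>\<mu>. indistinguishable_version n \<pi> \<mu> \<longrightarrow>
                (\<forall>i\<in>{1..n}. mean_queue \<mu> i = mean_total_occupancy \<pi>)) \<and>
             mean_total_occupancy \<pi>
               \<le> ennreal ((1 + g * of_bool (\<epsilon> > 1/2)) * lam / (1 - lam)))))
    \<and>
    (let threshold = (if \<epsilon> = 0 then 1 else min 1 (1 / (2 * \<epsilon>))) in
       (positive_recurrent po2_eps n lam \<epsilon> \<longleftrightarrow> lam < threshold) \<and>
       (lam < threshold \<longrightarrow>
          (\<exists>!\<pi>. occupancy_invariant po2_eps n lam \<epsilon> \<pi>) \<and>
          (\<exists>!\<mu>. queue_invariant po2_eps n lam \<epsilon> \<mu>) \<and>
          (\<forall>\<pi>. occupancy_invariant po2_eps n lam \<epsilon> \<pi> \<longrightarrow>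
             (\<forall>\<mu>. queue_invariant po2_eps n lam \<epsilon> \<mu> \<longrightarrow>
                map_pmf (occupancy n) \<mu> = \<pi> \<and>
                (\<Sum>i=1..n. mean_queue \<mu> i) / of_nat n = mean_total_occupancy \<pi>) \<and>
             (\<forall>\<mu>. indistinguishable_version n \<pi> \<mu> \<longrightarrow>
                (\<forall>i\<in>{1..n}. mean_queue \<mu> i = mean_total_occupancy \<pi>)) \<and>
             mean_total_occupancy \<pi> \<le> ennreal (lam / (1 - max 1 (2 * \<epsilon>) * lam)))))"
    (is "(\<forall>g. _ \<longrightarrow> ?A g) \<and> Let ?threshold ?B")
proof (rule conjI)
  show "\<forall>g. 0 \<le> g \<longrightarrow> ?A g"
  proof (intro allI impI)
    fix g :: real assume g: "0 \<le> g"
    interpret po2 "{..g}" n lam \<epsilon> by unfold_locales (use assms in auto)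
    show "?A g"
    proof (cases "lam < 1")
      case True
      have \<beta>: "0 \<le> g * of_bool (\<epsilon> > 1/2)" using g by simp
      show ?thesis
        using stable_system[OF dispatch_g_eps[OF refl g] _ \<beta>] True unfolding po2_g_eps_eq by simp
    next
      case False
      then show ?thesis using unstable_arrival_rate unfolding po2_g_eps_eq by simp
    qed
  qed
  interpret po2 UNIV n lam \<epsilon> by unfold_locales (use assms in auto)
  have threshold: "lam < ?threshold \<longleftrightarrow> max 1 (2 * \<epsilon>) * lam < 1"
    using assms by (auto simp: max_def min_def field_simps)
  have "?B t" if t: "lam < t \<longleftrightarrow> max 1 (2 * \<epsilon>) * lam < 1" for t
  proof (cases "max 1 (2 * \<epsilon>) * lam < 1")
    case True
    then show ?thesis
      using stable_system[OF dispatch_eps True order_refl] unfolding po2_eps_eq by (simp add: t)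
  next
    case False
    then have "1 \<le> lam \<or> 1 \<le> 2 * \<epsilon> * lam" by (auto simp: max_def split: if_splits)
    then have "\<not> positive_recurrent po2_eps n lam \<epsilon>"
      using unstable_arrival_rate unstable_longest_queue[OF refl] unfolding po2_eps_eq by blast
    then show ?thesis using False by (simp add: t)
  qed
  from this[OF threshold] show "Let ?threshold ?B" unfolding Let_def .
qed

end
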